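(* Let $n>2$ and $a_1,a_2\in\mathbb{C}\setminus\mathbb{Z}$ with $a_1-a_2\in\mathbb{Z}$. Let $b\in\mathbb{Z}$, and let $x(b,0)=x(-1,\ldots,-1,a_1+b,a_2-b,0,\ldots,0)\in N_{a_1,a_2}$. Then the $\mathfrak{b}$-module $\mathcal{U}(\mathfrak{b})x(b,0)$ and the corresponding $\mathfrak{a}$-module $\mathcal{U}(\mathfrak{a})x(b,0)$ generated by the same vector are as follows. - If $a_1-a_2+2b-(n-2)=0$, then $\mathcal{U}(\mathfrak{b})x(b,0)$ is a simple $\mathfrak{b}$-module isomorphic to $L(a_2-b,0,\ldots,0,-1-a_1-b)$, and it corresponds to $\mathcal{U}(\mathfrak{a})x(b,0)\cong L(-1)$. - If $a_1-a_2+2b-(n-2)>0$, then $\mathcal{U}(\mathfrak{b})x(b,0)$ is a simple $\mathfrak{b}$-module isomorphic to $L(a_2-b,0,\ldots,0,-1-a_1-b)$, and it corresponds to $\mathcal{U}(\mathfrak{a})x(b,0)\cong V(a_1-a_2+2b-(n-1))$. - If $a_1-a_2+2b-(n-2)<0$, then $\mathcal{U}(\mathfrak{b})x(b,0)$ is an indecomposable $\mathfrak{b}$-module of length $2$, and it corresponds to $\mathcal{U}(\mathfrak{a})x(b,0)\cong L(a_1-a_2+2b-(n-1))$.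
   Context: The module $N_{a_1,a_2}$: let $n\ge 2$, $a_1,a_2\in\mathbb{C}\setminus\mathbb{Z}$ and $a=(-1,\ldots,-1,a_1,a_2,0,\ldots,0)\in\mathbb{C}^{2n}$ (with $n-1$ entries $-1$ and $n-1$ entries $0$). A tuple $\beta\in\mathbb{C}^{2n}$ is admissible if $\beta-a\in\mathbb{Z}^{2n}$, $\beta_i<0$ for $1\le i\le n-1$, $\beta_i\ge 0$ for $n+2\le i\le 2n$, and $\sum_i\beta_i=\sum_i a_i$. $N_{a_1,a_2}$ is the complex vector space with basis $\{x(\beta):\beta \text{ admissible}\}$. With $\epsilon_i$ the standard basis of $\mathbb{C}^{2n}$, put $q_i x(\beta)=(\beta_i+1)x(\beta+\epsilon_i)$ if $\beta_i$ is a negative integer and $q_i x(\beta)=x(\beta+\epsilon_i)$ otherwise; $p_j x(\beta)=x(\beta-\epsilon_j)$ if $\beta_j$ is a negative integer and $p_jx(\beta)=\beta_j x(\beta-\epsilon_j)$ otherwise (operators on the larger space where the condition on $\sum_i\beta_i$ is dropped; terms with zero coefficient are $0$). $\mathfrak{sl}_{2n}$ acts on $N_{a_1,a_2}$ by letting the elementary matrix $E_{i,j}$ act as $q_ip_j$. Dual pair: $\mathfrak{b}=\{\mathrm{diag}(A,A): A\in\mathfrak{sl}_n\}\cong\mathfrak{sl}_n$ (block diagonal matrices) and $\mathfrak{a}=\langle X,H,Y\rangle\cong\mathfrak{sl}_2$, where $X=\sum_{i=1}^n E_{n+i,i}$, $Y=\sum_{i=1}^n E_{i,n+i}$, $H=\mathrm{diag}(I_n,-I_n)$;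 they are commuting subalgebras of $\mathfrak{sl}_{2n}$. $\mathcal{U}(\cdot)$ denotes the universal enveloping algebra. Highest weight conventions: for $\mathfrak{a}$, $\mathbb{C}H$ is the Cartan subalgebra and $Y$ the raising operator; a weight is given by the eigenvalue of $H$; $L(\mu)$ is the simple highest weight module and $V(\mu)$ the Verma module of highest weight $\mu\in\mathbb{C}$. For $\mathfrak{b}$, the Cartan subalgebra is that of diagonal matrices, the positive part is $\mathfrak{b}^+=\{\mathrm{diag}(A,A): A \text{ strictly upper triangular}\}$, and a weight is given by the tuple of eigenvalues of $H_1,\ldots,H_{n-1}$, where $H_i=\mathrm{diag}(h_i,h_i)$, $h_i=E_{i,i}-E_{i+1,i+1}\in\mathfrak{sl}_n$; $L(\mu_1,\ldots,\mu_{n-1})$ is the simple highest weight $\mathfrak{b}$-module with that highest weight. *)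

theory Defs
  imports
    Complex_Main
    "HOL-Library.Poly_Mapping"
    "HOL-Algebra.Module"
    "HOL-Algebra.QuotRing"
    "Jordan_Normal_Form.Matrix"
begin

section \<open>Modules over matrix Lie algebras\<close>

text \<open>
  A Lie algebra is a complex subspace of square matrices, closed under the commutator; it is given
  by its carrier set. The modules extend the library's record of modules (over the field of complex
  numbers) by an action. The ring fields \<open>mult\<close> and \<open>one\<close> of that record play no role.
\<close>

definition complex_field :: "complex ring" where
  "complex_field = \<lparr>carrier = UNIV, monoid.mult = (*), one = 1, zero = 0, add = (+)\<rparr>"

definition lie_bracket :: "complex mat \<Rightarrow> complex mat \<Rightarrow> complex mat" where
  "lie_bracket A B = A * B - B * A"

record ('l, 'v) lie_rep = "(complex, 'v) module" +
  act :: "'l \<Rightarrow> 'v \<Rightarrow> 'v"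

locale lie_module = module complex_field M
  for g :: "complex mat set" and M :: "(complex mat, 'v) lie_rep" (structure) +
  assumes act_closed: "A \<in> g \<Longrightarrow> v \<in> carrier M \<Longrightarrow> act M A v \<in> carrier M"
    and act_add_right: "A \<in> g \<Longrightarrow> v \<in> carrier M \<Longrightarrow> w \<in> carrier M \<Longrightarrow>
          act M A (v \<oplus>\<^bsub>M\<^esub> w) = act M A v \<oplus>\<^bsub>M\<^esub> act M A w"
    and act_smult_right: "A \<in> g \<Longrightarrow> v \<in> carrier M \<Longrightarrow>
          act M A (c \<odot>\<^bsub>M\<^esub> v) = c \<odot>\<^bsub>M\<^esub> act M A v"
    and act_add_left: "A \<in> g \<Longrightarrow> B \<in> g \<Longrightarrow> v \<in> carrier M \<Longrightarrow>
          act M (A + B) v = act M A v \<oplus>\<^bsub>M\<^esub> act M B v"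
    and act_smult_left: "A \<in> g \<Longrightarrow> v \<in> carrier M \<Longrightarrow>
          act M (c \<cdot>\<^sub>m A) v = c \<odot>\<^bsub>M\<^esub> act M A v"
    and act_bracket: "A \<in> g \<Longrightarrow> B \<in> g \<Longrightarrow> v \<in> carrier M \<Longrightarrow>
          act M (lie_bracket A B) v = act M A (act M B v) \<ominus>\<^bsub>M\<^esub> act M B (act M A v)"

definition lie_submodule ::
  "complex mat set \<Rightarrow> (complex mat, 'v) lie_rep \<Rightarrow> 'v set \<Rightarrow> bool" where
  "lie_submodule g M W \<longleftrightarrow>
     submodule W complex_field M \<and> (\<forall>A\<in>g. \<forall>v\<in>W. act M A v \<in> W)"

definition generated_submodule ::
  "complex mat set \<Rightarrow> (complex mat, 'v) lie_rep \<Rightarrow> 'v set \<Rightarrow> 'v set" where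
  "generated_submodule g M S = \<Inter>{W. lie_submodule g M W \<and> S \<subseteq> W}"

text \<open>The quotient of \<open>M\<close> by a submodule \<open>K\<close>, in the style of the library's \<^const>\<open>FactRing\<close>.\<close>

definition quotient_module ::
  "(complex mat, 'v) lie_rep \<Rightarrow> 'v set \<Rightarrow> (complex mat, 'v set) lie_rep" where
  "quotient_module M K =
     \<lparr>carrier = a_rcosets\<^bsub>M\<^esub> K, monoid.mult = undefined, one = undefined, zero = K, add = set_add M,
      smult = (\<lambda>c S. \<Union>v\<in>S. K +>\<^bsub>M\<^esub> (c \<odot>\<^bsub>M\<^esub> v)),
      act = (\<lambda>A S. \<Union>v\<in>S. K +>\<^bsub>M\<^esub> act M A v)\<rparr>"

definition lie_iso ::
  "complex mat set \<Rightarrow> (complex mat, 'v) lie_rep \<Rightarrow> (complex mat, 'w) lie_rep \<Rightarrow> bool" where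
  "lie_iso g M M' \<longleftrightarrow>
     (\<exists>\<phi>. bij_betw \<phi> (carrier M) (carrier M') \<and>
        (\<forall>v\<in>carrier M. \<forall>w\<in>carrier M. \<phi> (v \<oplus>\<^bsub>M\<^esub> w) = \<phi> v \<oplus>\<^bsub>M'\<^esub> \<phi> w) \<and>
        (\<forall>c. \<forall>v\<in>carrier M. \<phi> (c \<odot>\<^bsub>M\<^esub> v) = c \<odot>\<^bsub>M'\<^esub> \<phi> v) \<and>
        (\<forall>A\<in>g. \<forall>v\<in>carrier M. \<phi> (act M A v) = act M' A (\<phi> v)))"

definition simple_module :: "complex mat set \<Rightarrow> (complex mat, 'v) lie_rep \<Rightarrow> bool" where
  "simple_module g M \<longleftrightarrow>
     lie_module g M \<and> carrier M \<noteq> {\<zero>\<^bsub>M\<^esub>} \<and>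
     (\<forall>W. lie_submodule g M W \<longrightarrow> W = {\<zero>\<^bsub>M\<^esub>} \<or> W = carrier M)"

definition indecomposable_module :: "complex mat set \<Rightarrow> (complex mat, 'v) lie_rep \<Rightarrow> bool" where
  "indecomposable_module g M \<longleftrightarrow>
     lie_module g M \<and> carrier M \<noteq> {\<zero>\<^bsub>M\<^esub>} \<and>
     (\<forall>W1 W2. lie_submodule g M W1 \<and> lie_submodule g M W2 \<and>
        W1 \<inter> W2 = {\<zero>\<^bsub>M\<^esub>} \<and> W1 <+>\<^bsub>M\<^esub> W2 = carrier M \<longrightarrow>
        W1 = {\<zero>\<^bsub>M\<^esub>} \<or> W2 = {\<zero>\<^bsub>M\<^esub>})"

text \<open>Length \<open>k\<close>: there is a composition series with \<open>k\<close> simple factors.\<close>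

definition has_length :: "complex mat set \<Rightarrow> (complex mat, 'v) lie_rep \<Rightarrow> nat \<Rightarrow> bool" where
  "has_length g M k \<longleftrightarrow>
     lie_module g M \<and>
     (\<exists>W :: nat \<Rightarrow> 'v set. W 0 = {\<zero>\<^bsub>M\<^esub>} \<and> W k = carrier M \<and>
        (\<forall>i\<le>k. lie_submodule g M (W i)) \<and>
        (\<forall>i<k. W i \<subseteq> W (Suc i) \<and>
           simple_module g (quotient_module (M\<lparr>carrier := W (Suc i)\<rparr>) (W i))))"


section \<open>The universal enveloping algebra\<close>

text \<open>
  Lists form the free monoid under concatenation, so \<open>'l list \<Rightarrow>\<^sub>0 complex\<close>, with the convolution
  product of \<^theory>\<open>HOL-Library.Poly_Mapping\<close>, is the free associative algebra on \<open>'l\<close>.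
\<close>

instantiation list :: (type) monoid_add
begin
definition zero_list :: "'a list" where "zero_list = []"
definition plus_list :: "'a list \<Rightarrow> 'a list \<Rightarrow> 'a list" where "plus_list = (@)"
instance by standard (simp_all add: zero_list_def plus_list_def)
end

type_synonym free_elem = "complex mat list \<Rightarrow>\<^sub>0 complex"

definition free_algebra :: "complex mat set \<Rightarrow> free_elem ring" where
  "free_algebra g =
     \<lparr>carrier = {t. \<forall>w\<in>Poly_Mapping.keys t. set w \<subseteq> g},
      monoid.mult = (*), one = 1, zero = 0, add = (+)\<rparr>"

definition free_gen :: "complex mat \<Rightarrow> free_elem" where
  "free_gen A = Poly_Mapping.single [A] 1"

definition free_const :: "complex \<Rightarrow> free_elem" where
  "free_const c = Poly_Mapping.single [] c"

text \<open>
  The first two families of relations turn the free algebra on the set \<open>g\<close> into the tensor algebra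
  of the vector space \<open>g\<close>.
\<close>

definition env_relations :: "complex mat set \<Rightarrow> free_elem set" where
  "env_relations g =
     {free_gen (A + B) - free_gen A - free_gen B | A B. A \<in> g \<and> B \<in> g} \<union>
     {free_gen (c \<cdot>\<^sub>m A) - free_const c * free_gen A | c A. A \<in> g} \<union>
     {free_gen A * free_gen B - free_gen B * free_gen A - free_gen (lie_bracket A B)
        | A B. A \<in> g \<and> B \<in> g}"

definition env_ideal :: "complex mat set \<Rightarrow> free_elem set" where
  "env_ideal g = genideal (free_algebra g) (env_relations g)"

definition env_algebra :: "complex mat set \<Rightarrow> free_elem set ring" where
  "env_algebra g = free_algebra g Quot env_ideal g"

definition env_class :: "complex mat set \<Rightarrow> free_elem \<Rightarrow> free_elem set" where
  "env_class g t = env_ideal g +>\<^bsub>free_algebra g\<^esub> t"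

text \<open>The enveloping algebra as a module over \<open>g\<close> by left multiplication.\<close>

definition env_regular :: "complex mat set \<Rightarrow> (complex mat, free_elem set) lie_rep" where
  "env_regular g =
     \<lparr>carrier = carrier (env_algebra g), monoid.mult = monoid.mult (env_algebra g), one = one (env_algebra g),
      zero = zero (env_algebra g), add = add (env_algebra g),
      smult = (\<lambda>c u. env_class g (free_const c) \<otimes>\<^bsub>env_algebra g\<^esub> u),
      act = (\<lambda>A u. env_class g (free_gen A) \<otimes>\<^bsub>env_algebra g\<^esub> u)\<rparr>"

definition free_act :: "(complex mat, 'v) lie_rep \<Rightarrow> free_elem \<Rightarrow> 'v \<Rightarrow> 'v" where
  "free_act M t v =
     (\<Oplus>\<^bsub>M\<^esub>w\<in>Poly_Mapping.keys t. Poly_Mapping.lookup t w \<odot>\<^bsub>M\<^esub> foldr (act M) w v)"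

text \<open>
  On a Lie module the relations act by zero, so all representatives of an element \<open>u\<close> of the
  enveloping algebra act in the same way; \<^const>\<open>the_elem\<close> picks the common value.
\<close>

definition env_act :: "(complex mat, 'v) lie_rep \<Rightarrow> free_elem set \<Rightarrow> 'v \<Rightarrow> 'v" where
  "env_act M u v = the_elem ((\<lambda>t. free_act M t v) ` u)"

definition cyclic_module ::
  "complex mat set \<Rightarrow> (complex mat, 'v) lie_rep \<Rightarrow> 'v \<Rightarrow> (complex mat, 'v) lie_rep" where
  "cyclic_module g M v = M\<lparr>carrier := (\<lambda>u. env_act M u v) ` carrier (env_algebra g)\<rparr>"


section \<open>Verma modules and simple highest weight modules\<close>

text \<open>
  \<open>P\<close> is the positive part of \<open>g\<close>; a weight is given as the set \<open>C\<close> of pairs of a Cartan element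
  (ranging over a basis of the Cartan subalgebra) and its eigenvalue. The Verma module is the
  quotient of the enveloping algebra by the left ideal generated by \<open>P\<close> and the elements \<open>h - c\<close>.
\<close>

definition verma_module :: "complex mat set \<Rightarrow> complex mat set \<Rightarrow> (complex mat \<times> complex) set \<Rightarrow>
    (complex mat, free_elem set set) lie_rep" where
  "verma_module g P C =
     quotient_module (env_regular g)
       (generated_submodule g (env_regular g)
          ({env_class g (free_gen A) | A. A \<in> P} \<union>
           {env_class g (free_gen h - free_const c) | h c. (h, c) \<in> C}))"

text \<open>The sum of all proper submodules.\<close>

definition radical :: "complex mat set \<Rightarrow> (complex mat, 'v) lie_rep \<Rightarrow> 'v set" where
  "radical g M = generated_submodule g M (\<Union>{W. lie_submodule g M W \<and> W \<noteq> carrier M})"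

definition simple_hw_module :: "complex mat set \<Rightarrow> complex mat set \<Rightarrow> (complex mat \<times> complex) set \<Rightarrow>
    (complex mat, free_elem set set set) lie_rep" where
  "simple_hw_module g P C =
     quotient_module (verma_module g P C) (radical g (verma_module g P C))"


section \<open>The dual pair\<close>

text \<open>Rows, columns and tuple entries are numbered from 0.\<close>

definition sl :: "nat \<Rightarrow> complex mat set" where
  "sl n = {A \<in> carrier_mat n n. (\<Sum>i<n. A $$ (i, i)) = 0}"

definition dbl :: "nat \<Rightarrow> complex mat \<Rightarrow> complex mat" where
  "dbl n A = four_block_mat A (0\<^sub>m n n) (0\<^sub>m n n) A"

definition b_alg :: "nat \<Rightarrow> complex mat set" where
  "b_alg n = dbl n ` sl n"

definition b_pos :: "nat \<Rightarrow> complex mat set" where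
  "b_pos n = dbl n ` {A \<in> carrier_mat n n. \<forall>i<n. \<forall>j\<le>i. A $$ (i, j) = 0}"

definition H_b :: "nat \<Rightarrow> nat \<Rightarrow> complex mat" where
  "H_b n i = dbl n (mat n n (\<lambda>(r, c).
     if r = i \<and> c = i then 1 else if r = Suc i \<and> c = Suc i then -1 else 0))"

definition X_a :: "nat \<Rightarrow> complex mat" where
  "X_a n = four_block_mat (0\<^sub>m n n) (0\<^sub>m n n) (1\<^sub>m n) (0\<^sub>m n n)"

definition Y_a :: "nat \<Rightarrow> complex mat" where
  "Y_a n = four_block_mat (0\<^sub>m n n) (1\<^sub>m n) (0\<^sub>m n n) (0\<^sub>m n n)"

definition H_a :: "nat \<Rightarrow> complex mat" where
  "H_a n = four_block_mat (1\<^sub>m n) (0\<^sub>m n n) (0\<^sub>m n n) (- 1\<^sub>m n)"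

definition a_alg :: "nat \<Rightarrow> complex mat set" where
  "a_alg n = {x \<cdot>\<^sub>m X_a n + h \<cdot>\<^sub>m H_a n + y \<cdot>\<^sub>m Y_a n | x h y. True}"

definition V_a :: "nat \<Rightarrow> complex \<Rightarrow> (complex mat, free_elem set set) lie_rep" where
  "V_a n \<mu> = verma_module (a_alg n) {Y_a n} {(H_a n, \<mu>)}"

definition L_a :: "nat \<Rightarrow> complex \<Rightarrow> (complex mat, free_elem set set set) lie_rep" where
  "L_a n \<mu> = simple_hw_module (a_alg n) {Y_a n} {(H_a n, \<mu>)}"

text \<open>The weight \<open>\<mu>\<close> is a list of length \<open>n - 1\<close>.\<close>

definition L_b :: "nat \<Rightarrow> complex list \<Rightarrow> (complex mat, free_elem set set set) lie_rep" where
  "L_b n \<mu> = simple_hw_module (b_alg n) (b_pos n) {(H_b n i, \<mu> ! i) | i. i < n - 1}"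


section \<open>The module N\<close>

text \<open>\<open>complex vec \<Rightarrow>\<^sub>0 complex\<close> is the vector space with basis all tuples.\<close>

definition basis_elt :: "complex vec \<Rightarrow> (complex vec \<Rightarrow>\<^sub>0 complex)" where
  "basis_elt \<beta> = Poly_Mapping.single \<beta> 1"

definition scale :: "complex \<Rightarrow> (complex vec \<Rightarrow>\<^sub>0 complex) \<Rightarrow> (complex vec \<Rightarrow>\<^sub>0 complex)" where
  "scale c v = Poly_Mapping.map (\<lambda>x. c * x) v"

definition lin_ext :: "(complex vec \<Rightarrow> (complex vec \<Rightarrow>\<^sub>0 complex)) \<Rightarrow>
    (complex vec \<Rightarrow>\<^sub>0 complex) \<Rightarrow> (complex vec \<Rightarrow>\<^sub>0 complex)" where
  "lin_ext f v = (\<Sum>\<beta>\<in>Poly_Mapping.keys v. scale (Poly_Mapping.lookup v \<beta>) (f \<beta>))"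

definition neg_integer :: "complex \<Rightarrow> bool" where
  "neg_integer z \<longleftrightarrow> z \<in> \<int> \<and> Re z < 0"

definition q_op :: "nat \<Rightarrow> nat \<Rightarrow> (complex vec \<Rightarrow>\<^sub>0 complex) \<Rightarrow> (complex vec \<Rightarrow>\<^sub>0 complex)" where
  "q_op n i = lin_ext (\<lambda>\<beta>.
     if neg_integer (\<beta> $ i) then scale (\<beta> $ i + 1) (basis_elt (\<beta> + unit_vec (2 * n) i))
     else basis_elt (\<beta> + unit_vec (2 * n) i))"

definition p_op :: "nat \<Rightarrow> nat \<Rightarrow> (complex vec \<Rightarrow>\<^sub>0 complex) \<Rightarrow> (complex vec \<Rightarrow>\<^sub>0 complex)" where
  "p_op n j = lin_ext (\<lambda>\<beta>.
     if neg_integer (\<beta> $ j) then basis_elt (\<beta> - unit_vec (2 * n) j)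
     else scale (\<beta> $ j) (basis_elt (\<beta> - unit_vec (2 * n) j)))"

text \<open>\<open>tuple n u v\<close> is \<open>(-1, \<dots>, -1, u, v, 0, \<dots>, 0)\<close>, with \<open>u\<close> at position \<open>n - 1\<close>.\<close>

definition tuple :: "nat \<Rightarrow> complex \<Rightarrow> complex \<Rightarrow> complex vec" where
  "tuple n u v = vec (2 * n) (\<lambda>i.
     if i < n - 1 then -1 else if i = n - 1 then u else if i = n then v else 0)"

text \<open>The real parts only serve to compare entries which are integers by the first condition.\<close>

definition admissible :: "nat \<Rightarrow> complex \<Rightarrow> complex \<Rightarrow> complex vec \<Rightarrow> bool" where
  "admissible n a1 a2 \<beta> \<longleftrightarrow>
     \<beta> \<in> carrier_vec (2 * n) \<and>
     (\<forall>i<2 * n. \<beta> $ i - tuple n a1 a2 $ i \<in> \<int>) \<and>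
     (\<forall>i<n - 1. Re (\<beta> $ i) < 0) \<and>
     (\<forall>i\<in>{n + 1..<2 * n}. Re (\<beta> $ i) \<ge> 0) \<and>
     (\<Sum>i<2 * n. \<beta> $ i) = (\<Sum>i<2 * n. tuple n a1 a2 $ i)"

definition N_mod :: "nat \<Rightarrow> complex \<Rightarrow> complex \<Rightarrow> (complex mat, complex vec \<Rightarrow>\<^sub>0 complex) lie_rep" where
  "N_mod n a1 a2 =
     \<lparr>carrier = {v. \<forall>\<beta>\<in>Poly_Mapping.keys v. admissible n a1 a2 \<beta>},
      monoid.mult = undefined, one = undefined, zero = 0, add = (+), smult = scale,
      act = (\<lambda>A v. \<Sum>i<2 * n. \<Sum>j<2 * n. scale (A $$ (i, j)) (q_op n i (p_op n j v)))\<rparr>"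

definition x_b0 :: "nat \<Rightarrow> complex \<Rightarrow> complex \<Rightarrow> int \<Rightarrow> (complex vec \<Rightarrow>\<^sub>0 complex)" where
  "x_b0 n a1 a2 b = basis_elt (tuple n (a1 + of_int b) (a2 - of_int b))"

definition Ub_x :: "nat \<Rightarrow> complex \<Rightarrow> complex \<Rightarrow> int \<Rightarrow>
    (complex mat, complex vec \<Rightarrow>\<^sub>0 complex) lie_rep" where
  "Ub_x n a1 a2 b = cyclic_module (b_alg n) (N_mod n a1 a2) (x_b0 n a1 a2 b)"

definition Ua_x :: "nat \<Rightarrow> complex \<Rightarrow> complex \<Rightarrow> int \<Rightarrow>
    (complex mat, complex vec \<Rightarrow>\<^sub>0 complex) lie_rep" where
  "Ua_x n a1 a2 b = cyclic_module (a_alg n) (N_mod n a1 a2) (x_b0 n a1 a2 b)"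

end

theory Submission
  imports Defs
begin

text \<open>
  Put \<open>c = a1 - a2 + 2 b - (n - 2)\<close> and \<open>x = x(b,0)\<close>. The vector \<open>x\<close> is a highest weight vector
  for both algebras, so each of the two modules that it generates is a quotient of a Verma module,
  and the question is which quotient.

  For the rank one algebra the highest weight is \<open>c - 1\<close>. The vectors \<open>X^k x\<close> are linearly
  independent, because \<open>X^k x\<close> is the only one of them that has a non-zero coefficient at the tuple
  obtained from \<open>x\<close> by moving \<open>k\<close> units from the first entry to the first entry of the second half.
  Hence \<open>U(a) x\<close> is the Verma module for every \<open>c\<close> (\<open>Ua_iso_verma\<close>). The formula
  \<open>Y X^k x = k (c - k) X^(k-1) x\<close> shows that it is simple, hence equal to \<open>L(c - 1)\<close>, as soon as \<open>c\<close> is not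
  a positive integer (\<open>Ua_iso_simple\<close>).

  For the algebra \<open>b\<close>, let \<open>i, j\<close> run through the indices strictly between the first and the last one.
  The lowering operators outside \<open>gl(n-2)\<close> form a Heisenberg algebra, and
  \<open>U(b) x\<close> is a generalized Verma module induced from a one-dimensional module of a parabolic
  subalgebra. It can be thought of as the polynomial ring in variables \<open>s, y_i, z_i\<close> on which
  \<open>E_(1,j)\<close> is the derivation by \<open>z_j\<close>, the operator \<open>E_(1,n)\<close> is minus
  the derivation by \<open>s\<close> after \<open>c + s d/ds\<close>, plus the sum of the mixed second derivatives in \<open>y_i, z_i\<close>,
  and \<open>E_(i,n)\<close> is a non-zero multiple of the derivation by \<open>y_i\<close> (non-zero because \<open>a1\<close> is not an
  integer) up to \<open>z_i E_(1,n)\<close>. A vector killed by all of them is therefore a polynomial in \<open>s\<close>, and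
  \<open>s^k\<close> is mapped by \<open>E_(1,n)\<close> to \<open>- k (c + k) s^(k-1)\<close>. So the only singular vectors are the multiples
  of \<open>x\<close> if \<open>c\<close> is not negative, which gives simplicity (\<open>Ub_simple\<close>), and the span of \<open>x\<close> and \<open>s^m\<close> if
  \<open>c = -m\<close> is negative. In the latter case the multiples of \<open>s^m\<close> form a simple submodule, and the
  same computation modulo this submodule shows that the quotient is simple (\<open>Ub_length\<close>). The module is
  indecomposable because a module generated by a highest weight vector always is (\<open>indecomposable_hw\<close>).

  The polynomial ring itself does not appear below. The vectors \<open>S k\<close> in the module play the role of
  \<open>s^k\<close>; the formulas for the raising operators on them (\<open>S_P\<close>, \<open>S_R\<close>, \<open>S_E\<close>) follow from the relations
  of \<open>gl(n)\<close> alone, and applying lowering operators to them gives a spanning family whose independence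
  is seen from explicit dual functionals (\<open>dual_basis\<close>). The passage from these computations to the abstract
  modules \<open>V\<close> and \<open>L\<close> is the general highest weight theory of \<open>simple_cyclic_iso_simple_hw\<close> and
  \<open>cyclic_iso_verma_rank_one\<close>.
\<close>

abbreviation lk :: "('k \<Rightarrow>\<^sub>0 'v :: zero) \<Rightarrow> 'k \<Rightarrow> 'v" where
  "lk \<equiv> Poly_Mapping.lookup"

section \<open>Submodules\<close>

definition lie_closed :: "complex mat set \<Rightarrow> bool" where
  "lie_closed g \<longleftrightarrow> (\<forall>A\<in>g. \<forall>B\<in>g. A + B \<in> g \<and> lie_bracket A B \<in> g) \<and> (\<forall>c. \<forall>A\<in>g. c \<cdot>\<^sub>m A \<in> g)"

lemma complex_field_simps [simp]:
  "carrier complex_field = UNIV" "x \<otimes>\<^bsub>complex_field\<^esub> y = x * y"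
  "\<one>\<^bsub>complex_field\<^esub> = 1" "\<zero>\<^bsub>complex_field\<^esub> = 0" "x \<oplus>\<^bsub>complex_field\<^esub> y = x + y"
  by (simp_all add: complex_field_def)

lemma cring_complex_field: "cring complex_field"
proof (intro cringI abelian_groupI comm_monoidI)
  fix x :: complex
  show "\<exists>y\<in>carrier complex_field. y \<oplus>\<^bsub>complex_field\<^esub> x = \<zero>\<^bsub>complex_field\<^esub>"
    by (intro bexI[of _ "- x"]) simp_all
qed (simp_all add: algebra_simps)

lemma complex_field_a_inv [simp]: "\<ominus>\<^bsub>complex_field\<^esub> x = - x"
proof -
  interpret cring complex_field by (rule cring_complex_field)
  show ?thesis by (rule minus_equality) simp_all
qed

context lie_module
begin

lemma smult_closed' [simp, intro]: "v \<in> carrier M \<Longrightarrow> c \<odot> v \<in> carrier M"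
  by (rule smult_closed) simp_all

lemma smult_smult: "v \<in> carrier M \<Longrightarrow> c \<odot> (d \<odot> v) = (c * d) \<odot> v"
  using smult_assoc1[of c d v] by simp

lemma smult_add_left: "v \<in> carrier M \<Longrightarrow> (c + d) \<odot> v = c \<odot> v \<oplus> d \<odot> v"
  using smult_l_distr[of c d v] by simp

lemma smult_add_right:
  "v \<in> carrier M \<Longrightarrow> w \<in> carrier M \<Longrightarrow> c \<odot> (v \<oplus> w) = c \<odot> v \<oplus> c \<odot> w"
  by (rule smult_r_distr) simp_all

lemma smult_1 [simp]: "v \<in> carrier M \<Longrightarrow> 1 \<odot> v = v"
  using smult_one[of v] by simp

lemma smult_0 [simp]: "v \<in> carrier M \<Longrightarrow> 0 \<odot> v = \<zero>"
  using smult_l_null[of v] by simp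

lemma smult_zero [simp]: "c \<odot> \<zero> = \<zero>"
  by (rule smult_r_null) simp

lemma a_inv_eq_smult: "v \<in> carrier M \<Longrightarrow> \<ominus> v = (-1) \<odot> v"
  using smult_l_minus[of 1 v] by simp

lemma a_minus_eq_smult:
  "v \<in> carrier M \<Longrightarrow> w \<in> carrier M \<Longrightarrow> v \<ominus> w = v \<oplus> (-1) \<odot> w"
  by (simp add: a_minus_def a_inv_eq_smult)

lemma act_zero: "A \<in> g \<Longrightarrow> act M A \<zero> = \<zero>"
  using act_smult_right[of A "\<zero>" 0] act_closed[of A "\<zero>"] by simp

lemma submodule_iff:
  "submodule W complex_field M \<longleftrightarrow> W \<subseteq> carrier M \<and> \<zero> \<in> W \<and>
     (\<forall>v\<in>W. \<forall>w\<in>W. v \<oplus> w \<in> W) \<and> (\<forall>c. \<forall>v\<in>W. c \<odot> v \<in> W)"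
proof
  assume W: "submodule W complex_field M"
  have "\<zero> \<in> W"
    using subgroup.one_closed[OF submodule.axioms(1)[OF W]] by simp
  then show "W \<subseteq> carrier M \<and> \<zero> \<in> W \<and>
     (\<forall>v\<in>W. \<forall>w\<in>W. v \<oplus> w \<in> W) \<and> (\<forall>c. \<forall>v\<in>W. c \<odot> v \<in> W)"
    using submoduleE[OF W] by simp
next
  assume W: "W \<subseteq> carrier M \<and> \<zero> \<in> W \<and>
     (\<forall>v\<in>W. \<forall>w\<in>W. v \<oplus> w \<in> W) \<and> (\<forall>c. \<forall>v\<in>W. c \<odot> v \<in> W)"
  show "submodule W complex_field M"
  proof (rule submoduleI)
    show "\<ominus> a \<in> W" if "a \<in> W" for a
      using that W by (auto simp: a_inv_eq_smult subset_iff)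
  qed (use W in auto)
qed

lemma lie_submodule_iff:
  "lie_submodule g M W \<longleftrightarrow> W \<subseteq> carrier M \<and> \<zero> \<in> W \<and>
     (\<forall>v\<in>W. \<forall>w\<in>W. v \<oplus> w \<in> W) \<and> (\<forall>c. \<forall>v\<in>W. c \<odot> v \<in> W) \<and>
     (\<forall>A\<in>g. \<forall>v\<in>W. act M A v \<in> W)"
  unfolding lie_submodule_def submodule_iff by blast

lemma lie_submodule_carrier: "lie_submodule g M (carrier M)"
  unfolding lie_submodule_iff by (auto intro: act_closed)

lemma lie_submodule_zero: "lie_submodule g M {\<zero>}"
  unfolding lie_submodule_iff by (auto simp: act_zero)

lemma lie_submodule_generated:
  assumes "S \<subseteq> carrier M"
  shows "lie_submodule g M (generated_submodule g M S)"
proof -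
  let ?C = "{W. lie_submodule g M W \<and> S \<subseteq> W}"
  have "carrier M \<in> ?C" using assms lie_submodule_carrier by simp
  then have "\<Inter>?C \<subseteq> carrier M" by (rule Inter_lower)
  then show ?thesis
    unfolding generated_submodule_def lie_submodule_iff[of "\<Inter>?C"]
    by (intro conjI ballI allI InterI) (auto simp: lie_submodule_iff)
qed

lemma generated_superset: "S \<subseteq> generated_submodule g M S"
  unfolding generated_submodule_def by blast

lemma generated_least: "lie_submodule g M W \<Longrightarrow> S \<subseteq> W \<Longrightarrow> generated_submodule g M S \<subseteq> W"
  unfolding generated_submodule_def by blast

lemma lie_module_restrict:
  assumes "lie_submodule g M W"
  shows "lie_module g (M\<lparr>carrier := W\<rparr>)"
proof -
  have W: "submodule W complex_field M" and st: "\<And>A v. A \<in> g \<Longrightarrow> v \<in> W \<Longrightarrow> act M A v \<in> W"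
    using assms by (auto simp: lie_submodule_def)
  have sub: "W \<subseteq> carrier M" by (rule submoduleE(1)[OF W])
  have mod: "module complex_field (M\<lparr>carrier := W\<rparr>)"
    by (rule submodule.submodule_is_module[OF W module_axioms])
  interpret MW: module complex_field "M\<lparr>carrier := W\<rparr>" by (rule mod)
  have inv: "\<ominus>\<^bsub>M\<lparr>carrier := W\<rparr>\<^esub> w = \<ominus> w" if "w \<in> W" for w
  proof -
    have "\<ominus>\<^bsub>M\<lparr>carrier := W\<rparr>\<^esub> w = (-1) \<odot> w"
      using MW.smult_l_minus[of 1 w] MW.smult_one[of w] that by simp
    then show ?thesis using that sub by (auto simp: a_inv_eq_smult)
  qed
  show ?thesis
  proof (intro lie_module.intro lie_module_axioms.intro mod)
    fix A B v assume AB: "A \<in> g" "B \<in> g" "v \<in> carrier (M\<lparr>carrier := W\<rparr>)"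
    show "act (M\<lparr>carrier := W\<rparr>) (lie_bracket A B) v =
      act (M\<lparr>carrier := W\<rparr>) A (act (M\<lparr>carrier := W\<rparr>) B v) \<ominus>\<^bsub>M\<lparr>carrier := W\<rparr>\<^esub>
      act (M\<lparr>carrier := W\<rparr>) B (act (M\<lparr>carrier := W\<rparr>) A v)"
      using AB sub st act_bracket[of A B v] by (auto simp: a_minus_def inv subset_iff)
  qed (use sub st in \<open>auto simp: subset_iff act_add_right act_smult_right act_add_left act_smult_left\<close>)
qed

lemma lie_submodule_restrict:
  assumes "lie_submodule g M W"
  shows "lie_submodule g (M\<lparr>carrier := W\<rparr>) Z \<longleftrightarrow> lie_submodule g M Z \<and> Z \<subseteq> W"
proof -
  interpret MW: lie_module g "M\<lparr>carrier := W\<rparr>" by (rule lie_module_restrict[OF assms])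
  show ?thesis
    using assms unfolding MW.lie_submodule_iff lie_submodule_iff by auto
qed

end

section \<open>Homomorphisms and quotients\<close>

locale lie_hom = M: lie_module g M + M': lie_module g M' for g M M' +
  fixes f
  assumes hom_closed: "v \<in> carrier M \<Longrightarrow> f v \<in> carrier M'"
    and hom_add: "v \<in> carrier M \<Longrightarrow> w \<in> carrier M \<Longrightarrow> f (v \<oplus>\<^bsub>M\<^esub> w) = f v \<oplus>\<^bsub>M'\<^esub> f w"
    and hom_smult: "v \<in> carrier M \<Longrightarrow> f (c \<odot>\<^bsub>M\<^esub> v) = c \<odot>\<^bsub>M'\<^esub> f v"
    and hom_act: "A \<in> g \<Longrightarrow> v \<in> carrier M \<Longrightarrow> f (act M A v) = act M' A (f v)"
begin

lemma hom_zero: "f \<zero>\<^bsub>M\<^esub> = \<zero>\<^bsub>M'\<^esub>"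
  using hom_smult[of "\<zero>\<^bsub>M\<^esub>" 0] hom_closed[of "\<zero>\<^bsub>M\<^esub>"] by simp

lemma hom_minus: "v \<in> carrier M \<Longrightarrow> w \<in> carrier M \<Longrightarrow> f (v \<ominus>\<^bsub>M\<^esub> w) = f v \<ominus>\<^bsub>M'\<^esub> f w"
  by (simp add: M.a_minus_eq_smult M'.a_minus_eq_smult hom_add hom_smult hom_closed)

definition ker where "ker = {v \<in> carrier M. f v = \<zero>\<^bsub>M'\<^esub>}"

lemma lie_submodule_ker: "lie_submodule g M ker"
  unfolding M.lie_submodule_iff ker_def
  by (auto simp: hom_zero hom_add hom_smult hom_act M.act_closed M'.act_zero)

lemma lie_submodule_image:
  assumes "lie_submodule g M W"
  shows "lie_submodule g M' (f ` W)"
proof -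
  have W: "W \<subseteq> carrier M" "\<zero>\<^bsub>M\<^esub> \<in> W" "\<And>v w. v \<in> W \<Longrightarrow> w \<in> W \<Longrightarrow> v \<oplus>\<^bsub>M\<^esub> w \<in> W"
    "\<And>c v. v \<in> W \<Longrightarrow> c \<odot>\<^bsub>M\<^esub> v \<in> W" "\<And>A v. A \<in> g \<Longrightarrow> v \<in> W \<Longrightarrow> act M A v \<in> W"
    using assms unfolding M.lie_submodule_iff by auto
  show ?thesis unfolding M'.lie_submodule_iff
  proof (intro conjI ballI allI)
    show "f ` W \<subseteq> carrier M'" using W(1) hom_closed by auto
    show "\<zero>\<^bsub>M'\<^esub> \<in> f ` W" using W(2) hom_zero by (metis imageI)
  next
    fix v w assume "v \<in> f ` W" "w \<in> f ` W"
    then obtain v' w' where "v = f v'" "w = f w'" "v' \<in> W" "w' \<in> W" by auto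
    then show "v \<oplus>\<^bsub>M'\<^esub> w \<in> f ` W" using hom_add[of v' w'] W by (metis imageI subsetD)
  next
    fix c v assume "v \<in> f ` W"
    then obtain v' where "v = f v'" "v' \<in> W" by auto
    then show "c \<odot>\<^bsub>M'\<^esub> v \<in> f ` W" using hom_smult[of v' c] W by (metis imageI subsetD)
  next
    fix A v assume "v \<in> f ` W" and A: "A \<in> g"
    then obtain v' where "v = f v'" "v' \<in> W" by auto
    then show "act M' A v \<in> f ` W" using hom_act[of A v'] W A by (metis imageI subsetD)
  qed
qed

lemma lie_submodule_vimage:
  assumes "lie_submodule g M' W"
  shows "lie_submodule g M {v \<in> carrier M. f v \<in> W}"
  using assms unfolding M.lie_submodule_iff M'.lie_submodule_iff
  by (auto simp: hom_zero hom_add hom_smult hom_act M.act_closed)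

lemma inj_on_if_ker_trivial:
  assumes "ker \<subseteq> {\<zero>\<^bsub>M\<^esub>}"
  shows "inj_on f (carrier M)"
proof (rule inj_onI)
  fix v w assume vw: "v \<in> carrier M" "w \<in> carrier M" "f v = f w"
  then have "v \<ominus>\<^bsub>M\<^esub> w \<in> ker" by (simp add: ker_def hom_minus hom_closed) (simp add: a_minus_def hom_closed M'.M.r_neg)
  then have "v \<oplus>\<^bsub>M\<^esub> \<ominus>\<^bsub>M\<^esub> w = \<zero>\<^bsub>M\<^esub>" using assms by (auto simp: a_minus_def)
  then show "v = w" using vw M.M.minus_equality[of v "\<ominus>\<^bsub>M\<^esub> w"] by simp
qed

lemma lie_iso_if_bij: "bij_betw f (carrier M) (carrier M') \<Longrightarrow> lie_iso g M M'"
  unfolding lie_iso_def using hom_add hom_smult hom_act by blast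

end

lemma lie_iso_sym:
  assumes "lie_module g M" and "lie_iso g M M'"
  shows "lie_iso g M' M"
proof -
  interpret M: lie_module g M by fact
  obtain f where f: "bij_betw f (carrier M) (carrier M')"
    "\<And>v w. v \<in> carrier M \<Longrightarrow> w \<in> carrier M \<Longrightarrow> f (v \<oplus>\<^bsub>M\<^esub> w) = f v \<oplus>\<^bsub>M'\<^esub> f w"
    "\<And>c v. v \<in> carrier M \<Longrightarrow> f (c \<odot>\<^bsub>M\<^esub> v) = c \<odot>\<^bsub>M'\<^esub> f v"
    "\<And>A v. A \<in> g \<Longrightarrow> v \<in> carrier M \<Longrightarrow> f (act M A v) = act M' A (f v)"
    using assms(2) unfolding lie_iso_def by blast
  define h where "h = inv_into (carrier M) f"
  have h: "h w \<in> carrier M" "f (h w) = w" if "w \<in> carrier M'" for w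
    using that f(1) by (auto simp: h_def bij_betw_def inv_into_into f_inv_into_f)
  have hf: "h (f v) = v" if "v \<in> carrier M" for v
    using that f(1) by (simp add: h_def bij_betw_def)
  show ?thesis unfolding lie_iso_def
  proof (intro exI[of _ h] conjI ballI allI)
    show "bij_betw h (carrier M') (carrier M)"
      unfolding h_def by (rule bij_betw_inv_into[OF f(1)])
    show "h (v \<oplus>\<^bsub>M'\<^esub> w) = h v \<oplus>\<^bsub>M\<^esub> h w" if "v \<in> carrier M'" "w \<in> carrier M'" for v w
      using f(2)[of "h v" "h w"] h that hf[of "h v \<oplus>\<^bsub>M\<^esub> h w"] by simp
    show "h (c \<odot>\<^bsub>M'\<^esub> v) = c \<odot>\<^bsub>M\<^esub> h v" if "v \<in> carrier M'" for c v
      using f(3)[of "h v" c] h that hf[of "c \<odot>\<^bsub>M\<^esub> h v"] by simp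
    show "h (act M' A v) = act M A (h v)" if "A \<in> g" "v \<in> carrier M'" for A v
      using f(4)[of A "h v"] h that hf[of "act M A (h v)"] M.act_closed by simp
  qed
qed

text \<open>
  The axioms of a module are equations between elements, so they pass to every surjective image.
  Quotients are recognised as modules in this way.
\<close>

lemma lie_module_image:
  assumes g: "lie_closed g" and "lie_module g M" and im: "f ` carrier M = carrier M'" and z: "f \<zero>\<^bsub>M\<^esub> = \<zero>\<^bsub>M'\<^esub>"
    and add: "\<And>v w. v \<in> carrier M \<Longrightarrow> w \<in> carrier M \<Longrightarrow> f (v \<oplus>\<^bsub>M\<^esub> w) = f v \<oplus>\<^bsub>M'\<^esub> f w"
    and sm: "\<And>c v. v \<in> carrier M \<Longrightarrow> f (c \<odot>\<^bsub>M\<^esub> v) = c \<odot>\<^bsub>M'\<^esub> f v"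
    and ac: "\<And>A v. A \<in> g \<Longrightarrow> v \<in> carrier M \<Longrightarrow> f (act M A v) = act M' A (f v)"
  shows "lie_module g M'" "lie_hom g M M' f"
proof -
  interpret M: lie_module g M by fact
  have rep: "\<exists>v\<in>carrier M. v' = f v" if "v' \<in> carrier M'" for v' using that im by auto
  have cl: "f v \<in> carrier M'" if "v \<in> carrier M" for v using that im by auto
  have "abelian_group M'"
  proof (rule abelian_groupI)
    fix x y assume "x \<in> carrier M'" "y \<in> carrier M'"
    then obtain v w where vw: "v \<in> carrier M" "w \<in> carrier M" "x = f v" "y = f w"
      using rep by metis
    show "x \<oplus>\<^bsub>M'\<^esub> y \<in> carrier M'" using vw by (simp add: add[symmetric] cl)
    show "x \<oplus>\<^bsub>M'\<^esub> y = y \<oplus>\<^bsub>M'\<^esub> x" using vw by (simp add: add[symmetric] M.a_comm)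
    fix z assume "z \<in> carrier M'"
    then obtain u where "u \<in> carrier M" "z = f u" using rep by metis
    then show "x \<oplus>\<^bsub>M'\<^esub> y \<oplus>\<^bsub>M'\<^esub> z = x \<oplus>\<^bsub>M'\<^esub> (y \<oplus>\<^bsub>M'\<^esub> z)"
      using vw by (simp add: add[symmetric] M.a_assoc)
  next
    show "\<zero>\<^bsub>M'\<^esub> \<in> carrier M'" using cl[of "\<zero>\<^bsub>M\<^esub>"] z by simp
    fix x assume "x \<in> carrier M'"
    then obtain v where v: "v \<in> carrier M" "x = f v" using rep by metis
    show "\<zero>\<^bsub>M'\<^esub> \<oplus>\<^bsub>M'\<^esub> x = x" using v by (simp add: add[symmetric] z[symmetric])
    show "\<exists>y\<in>carrier M'. y \<oplus>\<^bsub>M'\<^esub> x = \<zero>\<^bsub>M'\<^esub>"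
      using v by (intro bexI[of _ "f (\<ominus>\<^bsub>M\<^esub> v)"]) (simp_all add: add[symmetric] z[symmetric] cl M.l_neg)
  qed
  then interpret M': abelian_group M' .
  have mod: "module complex_field M'"
  proof (rule moduleI[OF cring_complex_field \<open>abelian_group M'\<close>])
    fix a b x y assume "x \<in> carrier M'" 
    then obtain v where v: "v \<in> carrier M" "x = f v" using rep by metis
    show "a \<odot>\<^bsub>M'\<^esub> x \<in> carrier M'" using v by (simp add: sm[symmetric] cl)
    show "(a \<oplus>\<^bsub>complex_field\<^esub> b) \<odot>\<^bsub>M'\<^esub> x = a \<odot>\<^bsub>M'\<^esub> x \<oplus>\<^bsub>M'\<^esub> b \<odot>\<^bsub>M'\<^esub> x"
      using v by (simp add: sm[symmetric] add[symmetric] M.smult_add_left)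
    show "(a \<otimes>\<^bsub>complex_field\<^esub> b) \<odot>\<^bsub>M'\<^esub> x = a \<odot>\<^bsub>M'\<^esub> (b \<odot>\<^bsub>M'\<^esub> x)"
      using v by (simp add: sm[symmetric] M.smult_smult)
    show "\<one>\<^bsub>complex_field\<^esub> \<odot>\<^bsub>M'\<^esub> x = x" using v by (simp add: sm[symmetric])
    assume "y \<in> carrier M'"
    then obtain w where w: "w \<in> carrier M" "y = f w" using rep by metis
    show "a \<odot>\<^bsub>M'\<^esub> (x \<oplus>\<^bsub>M'\<^esub> y) = a \<odot>\<^bsub>M'\<^esub> x \<oplus>\<^bsub>M'\<^esub> a \<odot>\<^bsub>M'\<^esub> y"
      using v w by (simp add: sm[symmetric] add[symmetric] M.smult_add_right)
  qed
  then interpret M': module complex_field M' .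
  have inv: "\<ominus>\<^bsub>M'\<^esub> f w = f (\<ominus>\<^bsub>M\<^esub> w)" if "w \<in> carrier M" for w
    by (rule M'.minus_equality) (use that in \<open>simp_all add: add[symmetric] z[symmetric] cl M.l_neg\<close>)
  show lm: "lie_module g M'"
  proof (intro lie_module.intro lie_module_axioms.intro mod)
    fix A B c x y assume A: "A \<in> g" and "x \<in> carrier M'"
    then obtain v where v: "v \<in> carrier M" "x = f v" using rep by metis
    show "act M' A x \<in> carrier M'" using v A by (simp add: ac[symmetric] cl M.act_closed)
    show "act M' A (c \<odot>\<^bsub>M'\<^esub> x) = c \<odot>\<^bsub>M'\<^esub> act M' A x"
      using v A by (simp add: ac[symmetric] sm[symmetric] M.act_closed M.act_smult_right)
    { assume "y \<in> carrier M'"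
      then obtain w where w: "w \<in> carrier M" "y = f w" using rep by metis
      show "act M' A (x \<oplus>\<^bsub>M'\<^esub> y) = act M' A x \<oplus>\<^bsub>M'\<^esub> act M' A y"
        using v w A by (simp add: ac[symmetric] add[symmetric] M.act_closed M.act_add_right) }
    show "act M' (c \<cdot>\<^sub>m A) x = c \<odot>\<^bsub>M'\<^esub> act M' A x"
      using v A g by (simp add: ac[symmetric] sm[symmetric] M.act_closed M.act_smult_left lie_closed_def)
    assume B: "B \<in> g"
    show "act M' (A + B) x = act M' A x \<oplus>\<^bsub>M'\<^esub> act M' B x"
      using v A B g by (simp add: ac[symmetric] add[symmetric] M.act_closed M.act_add_left lie_closed_def)
    show "act M' (lie_bracket A B) x = act M' A (act M' B x) \<ominus>\<^bsub>M'\<^esub> act M' B (act M' A x)"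
      using v A B g
      by (simp add: ac[symmetric] add[symmetric] M.act_closed M.act_bracket lie_closed_def a_minus_def inv)
  qed
  show "lie_hom g M M' f"
    by (intro lie_hom.intro lie_hom_axioms.intro lm assms(2)) (use cl add sm ac in auto)
qed

context lie_module
begin

lemma abelian_subgroup_if_submodule:
  assumes "lie_submodule g M K"
  shows "abelian_subgroup K M"
proof (rule abelian_subgroupI3)
  show "additive_subgroup K M"
    using assms unfolding lie_submodule_def submodule_def additive_subgroup_def by blast
qed (rule M.abelian_group_axioms)

text \<open>
  The unions that define the operations of a quotient run over the representatives of a coset, and
  all representatives give the same coset.
\<close>

lemma quotient_ops:
  assumes K: "lie_submodule g M K" and v: "v \<in> carrier M"
  shows "smult (quotient_module M K) c (K +> v) = K +> (c \<odot> v)" (is ?sm)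
    and "A \<in> g \<Longrightarrow> act (quotient_module M K) A (K +> v) = K +> act M A v"
    and "w \<in> carrier M \<Longrightarrow>
      (K +> v) \<oplus>\<^bsub>quotient_module M K\<^esub> (K +> w) = K +> (v \<oplus> w)"
proof -
  interpret K: abelian_subgroup K M by (rule abelian_subgroup_if_submodule[OF K])
  have Kst: "K \<subseteq> carrier M" "\<And>c v. v \<in> K \<Longrightarrow> c \<odot> v \<in> K" "\<And>A v. A \<in> g \<Longrightarrow> v \<in> K \<Longrightarrow> act M A v \<in> K"
    using K unfolding lie_submodule_iff by auto
  have mem: "\<exists>k\<in>K. u = k \<oplus> v" if "u \<in> K +> v" for u
    using that by (auto simp: a_r_coset_def')
  have self: "v \<in> K +> v" by (rule K.a_rcos_self[OF v])
  have absorb: "K +> (k \<oplus> w) = K +> w" if "k \<in> K" "w \<in> carrier M" for k w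
  proof -
    have "k \<oplus> w \<in> K +> w" using that by (auto simp: a_r_coset_def')
    then show ?thesis using K.a_repr_independence'[of "k \<oplus> w" w] that by simp
  qed
  have const: "(\<Union>u\<in>K +> v. K +> F u) = K +> F v"
    if F: "\<And>k. k \<in> K \<Longrightarrow> \<exists>k'\<in>K. F (k \<oplus> v) = k' \<oplus> F v" "F v \<in> carrier M" for F
  proof -
    have "K +> F u = K +> F v" if u: "u \<in> K +> v" for u
    proof -
      obtain k where "k \<in> K" "u = k \<oplus> v" using mem[OF u] by blast
      moreover then obtain k' where "k' \<in> K" "F u = k' \<oplus> F v" using F(1) by blast
      ultimately show ?thesis using absorb[OF _ F(2)] by simp
    qed
    moreover have "K +> v \<noteq> {}" using self by blast
    ultimately show ?thesis by (rule SUP_eq_const[rotated])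
  qed
  have smK: "\<exists>k'\<in>K. c \<odot> (k \<oplus> v) = k' \<oplus> c \<odot> v" if "k \<in> K" for k
    using that v Kst(1) Kst(2)[OF that] by (intro bexI[of _ "c \<odot> k"]) (auto simp: smult_add_right)
  show ?sm
    using const[of "\<lambda>u. c \<odot> u", OF smK] v by (simp add: quotient_module_def)
  show "act (quotient_module M K) A (K +> v) = K +> act M A v" if A: "A \<in> g"
  proof -
    have acK: "\<exists>k'\<in>K. act M A (k \<oplus> v) = k' \<oplus> act M A v" if "k \<in> K" for k
      using that v Kst(1) Kst(3)[OF A that] A by (intro bexI[of _ "act M A k"]) (auto simp: act_add_right)
    show ?thesis
      using const[of "act M A", OF acK act_closed[OF A v]] by (simp add: quotient_module_def)
  qed
  show "(K +> v) \<oplus>\<^bsub>quotient_module M K\<^esub> (K +> w) = K +> (v \<oplus> w)" if "w \<in> carrier M"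
    using K.a_rcos_sum[OF v that] by (simp add: quotient_module_def)
qed

lemma quotient_carrier: "carrier (quotient_module M K) = (\<lambda>v. K +> v) ` carrier M"
  by (auto simp: quotient_module_def A_RCOSETS_def' a_r_coset_def')

lemma quotient_zero:
  assumes "lie_submodule g M K"
  shows "\<zero>\<^bsub>quotient_module M K\<^esub> = K +> \<zero>"
proof -
  interpret K: abelian_subgroup K M by (rule abelian_subgroup_if_submodule[OF assms])
  show ?thesis using K.a_rcos_const[OF K.zero_closed] by (simp add: quotient_module_def)
qed

lemma quotient_hom:
  assumes g: "lie_closed g" and K: "lie_submodule g M K"
  shows "lie_module g (quotient_module M K)"
    and "lie_hom g M (quotient_module M K) (\<lambda>v. K +> v)"
proof -
  note im = lie_module_image[OF g lie_module_axioms, where f = "\<lambda>v. K +> v" and M' = "quotient_module M K"]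
  show "lie_module g (quotient_module M K)"
    by (rule im(1)) (simp_all add: quotient_ops[OF K] quotient_carrier quotient_zero[OF K])
  show "lie_hom g M (quotient_module M K) (\<lambda>v. K +> v)"
    by (rule im(2)) (simp_all add: quotient_ops[OF K] quotient_carrier quotient_zero[OF K])
qed

lemma coset_eq_iff:
  assumes K: "lie_submodule g M K" and "v \<in> carrier M" "w \<in> carrier M"
  shows "K +> v = K +> w \<longleftrightarrow> v \<ominus> w \<in> K"
proof -
  interpret K: abelian_subgroup K M by (rule abelian_subgroup_if_submodule[OF K])
  show ?thesis
    using K.a_rcos_module[OF assms(3,2)] K.a_repr_independence'[of v w] K.a_rcos_self[of v] assms
    by (auto simp: a_minus_def)
qed

lemma coset_eq_zero_iff:
  assumes K: "lie_submodule g M K" and "v \<in> carrier M"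
  shows "K +> v = \<zero>\<^bsub>quotient_module M K\<^esub> \<longleftrightarrow> v \<in> K"
  using coset_eq_iff[OF K assms(2), of "\<zero>"] assms(2) by (simp add: quotient_zero[OF K] a_minus_eq_smult)

text \<open>
  The submodules of a quotient correspond to the submodules that contain the kernel.
\<close>

lemma simple_quotientI:
  assumes g: "lie_closed g" and K: "lie_submodule g M K" and K': "K \<noteq> carrier M"
    and max: "\<And>Z. lie_submodule g M Z \<Longrightarrow> K \<subseteq> Z \<Longrightarrow> Z \<noteq> K \<Longrightarrow> Z = carrier M"
  shows "simple_module g (quotient_module M K)"
proof -
  interpret \<pi>: lie_hom g M "quotient_module M K" "\<lambda>v. K +> v" by (rule quotient_hom[OF g K])
  have Ks: "K \<subseteq> carrier M" using K by (simp add: lie_submodule_iff)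
  show ?thesis unfolding simple_module_def
  proof (intro conjI allI impI)
    show "lie_module g (quotient_module M K)" by (rule quotient_hom[OF g K])
    obtain v where v: "v \<in> carrier M" "v \<notin> K" using Ks K' by blast
    show "carrier (quotient_module M K) \<noteq> {\<zero>\<^bsub>quotient_module M K\<^esub>}"
      using v coset_eq_zero_iff[OF K v(1)] by (auto simp: quotient_carrier)
    fix W assume W: "lie_submodule g (quotient_module M K) W"
    define Z where "Z = {v \<in> carrier M. K +> v \<in> W}"
    have Z: "lie_submodule g M Z" unfolding Z_def by (rule \<pi>.lie_submodule_vimage[OF W])
    have W0: "W \<subseteq> carrier (quotient_module M K)" "\<zero>\<^bsub>quotient_module M K\<^esub> \<in> W"
      using W by (auto simp: \<pi>.M'.lie_submodule_iff)
    have WZ: "W = (\<lambda>v. K +> v) ` Z" using W0(1) by (auto simp: Z_def quotient_carrier)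
    have "K \<subseteq> Z" using Ks W0(2) coset_eq_zero_iff[OF K] by (metis (mono_tags, lifting) Z_def mem_Collect_eq subsetD subsetI)
    show "W = {\<zero>\<^bsub>quotient_module M K\<^esub>} \<or> W = carrier (quotient_module M K)"
    proof (cases "Z = K")
      case True
      then have "W \<subseteq> {\<zero>\<^bsub>quotient_module M K\<^esub>}"
        using coset_eq_zero_iff[OF K] Ks by (auto simp: WZ)
      then show ?thesis using W0 by blast
    next
      case False
      then have "Z = carrier M" by (rule max[OF Z \<open>K \<subseteq> Z\<close>])
      then show ?thesis by (simp add: WZ quotient_carrier)
    qed
  qed
qed

end

lemma (in lie_hom) factor_through_quotient:
  assumes g: "lie_closed g" and K: "lie_submodule g M K" and le: "K \<subseteq> ker"
  obtains h where "lie_hom g (quotient_module M K) M' h"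
    "\<And>v. v \<in> carrier M \<Longrightarrow> h (K +>\<^bsub>M\<^esub> v) = f v"
proof -
  \<comment> \<open>The value at any representative, as \<open>f\<close> is constant on cosets.\<close>
  define h where "h S = f (SOME v. v \<in> S)" for S
  interpret K: abelian_subgroup K M by (rule M.abelian_subgroup_if_submodule[OF K])
  have hf: "h (K +>\<^bsub>M\<^esub> v) = f v" if v: "v \<in> carrier M" for v
  proof -
    have "(SOME u. u \<in> K +>\<^bsub>M\<^esub> v) \<in> K +>\<^bsub>M\<^esub> v"
      using K.a_rcos_self[OF v] by (rule someI)
    then obtain k where k: "k \<in> K" "(SOME u. u \<in> K +>\<^bsub>M\<^esub> v) = k \<oplus>\<^bsub>M\<^esub> v"
      by (auto simp: a_r_coset_def')
    then show ?thesis using le v by (auto simp: h_def ker_def hom_add hom_closed)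
  qed
  have "lie_hom g (quotient_module M K) M' h"
  proof (intro lie_hom.intro lie_hom_axioms.intro M.quotient_hom[OF g K] M'.lie_module_axioms)
  qed (auto simp: M.quotient_carrier M.quotient_ops[OF K] hf hom_closed hom_add hom_smult hom_act
      M.act_closed)
  then show ?thesis using hf that by blast
qed

lemma (in lie_hom) first_isomorphism:
  assumes g: "lie_closed g" and surj: "f ` carrier M = carrier M'"
  shows "lie_iso g (quotient_module M ker) M'"
proof -
  obtain h where h: "lie_hom g (quotient_module M ker) M' h"
    "\<And>v. v \<in> carrier M \<Longrightarrow> h (ker +>\<^bsub>M\<^esub> v) = f v"
    using factor_through_quotient[OF g lie_submodule_ker order_refl] by blast
  interpret h: lie_hom g "quotient_module M ker" M' h by (rule h(1))
  show ?thesis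
  proof (rule h.lie_iso_if_bij)
    have "h.ker \<subseteq> {\<zero>\<^bsub>quotient_module M ker\<^esub>}"
    proof
      fix s assume "s \<in> h.ker"
      then obtain v where v: "v \<in> carrier M" "s = ker +>\<^bsub>M\<^esub> v" "f v = \<zero>\<^bsub>M'\<^esub>"
        using h(2) by (auto simp: h.ker_def M.quotient_carrier)
      then have "v \<in> ker" by (simp add: ker_def)
      then show "s \<in> {\<zero>\<^bsub>quotient_module M ker\<^esub>}"
        using M.coset_eq_zero_iff[OF lie_submodule_ker v(1)] v(2) by simp
    qed
    then have "inj_on h (carrier (quotient_module M ker))" by (rule h.inj_on_if_ker_trivial)
    moreover have "h ` carrier (quotient_module M ker) = carrier M'"
      using h(2) surj by (auto simp: M.quotient_carrier image_image)
    ultimately show "bij_betw h (carrier (quotient_module M ker)) (carrier M')"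
      by (simp add: bij_betw_def)
  qed
qed

section \<open>The enveloping algebra\<close>

lemma free_algebra_simps [simp]:
  "s \<otimes>\<^bsub>free_algebra g\<^esub> t = s * t" "\<one>\<^bsub>free_algebra g\<^esub> = 1"
  "\<zero>\<^bsub>free_algebra g\<^esub> = 0" "s \<oplus>\<^bsub>free_algebra g\<^esub> t = s + t"
  by (simp_all add: free_algebra_def)

lemma in_free_carrier:
  "t \<in> carrier (free_algebra g) \<longleftrightarrow> (\<forall>w. lk t w \<noteq> 0 \<longrightarrow> set w \<subseteq> g)"
  by (auto simp: free_algebra_def in_keys_iff)

lemma free_carrier_closed:
  "0 \<in> carrier (free_algebra g)" "1 \<in> carrier (free_algebra g)"
  "s \<in> carrier (free_algebra g) \<Longrightarrow> t \<in> carrier (free_algebra g) \<Longrightarrow> s + t \<in> carrier (free_algebra g)"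
  "s \<in> carrier (free_algebra g) \<Longrightarrow> t \<in> carrier (free_algebra g) \<Longrightarrow> s - t \<in> carrier (free_algebra g)"
  "s \<in> carrier (free_algebra g) \<Longrightarrow> - s \<in> carrier (free_algebra g)"
  "s \<in> carrier (free_algebra g) \<Longrightarrow> t \<in> carrier (free_algebra g) \<Longrightarrow> s * t \<in> carrier (free_algebra g)"
  "set w \<subseteq> g \<Longrightarrow> Poly_Mapping.single w c \<in> carrier (free_algebra g)"
  "A \<in> g \<Longrightarrow> free_gen A \<in> carrier (free_algebra g)"
  "free_const c \<in> carrier (free_algebra g)"
proof -
  assume "s \<in> carrier (free_algebra g)" "t \<in> carrier (free_algebra g)"
  then show "s * t \<in> carrier (free_algebra g)"
    using keys_mult[of s t] by (fastforce simp: free_algebra_def plus_list_def)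
next
  assume "s \<in> carrier (free_algebra g)" "t \<in> carrier (free_algebra g)"
  then show "s + t \<in> carrier (free_algebra g)"
    unfolding in_free_carrier by (metis add.right_neutral lookup_add)
next
  assume "s \<in> carrier (free_algebra g)" "t \<in> carrier (free_algebra g)"
  then show "s - t \<in> carrier (free_algebra g)"
    unfolding in_free_carrier by (metis diff_zero lookup_minus)
qed (auto simp: in_free_carrier lookup_one lookup_single when_def free_gen_def free_const_def
    zero_list_def)

lemma ring_free_algebra: "ring (free_algebra g)"
proof (intro ringI abelian_groupI monoidI)
  fix x assume "x \<in> carrier (free_algebra g)"
  then show "\<exists>y\<in>carrier (free_algebra g). y \<oplus>\<^bsub>free_algebra g\<^esub> x = \<zero>\<^bsub>free_algebra g\<^esub>"
    by (intro bexI[of _ "- x"]) (simp_all add: free_carrier_closed)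
qed (simp_all add: free_carrier_closed algebra_simps)

lemma free_a_inv [simp]:
  assumes "t \<in> carrier (free_algebra g)"
  shows "\<ominus>\<^bsub>free_algebra g\<^esub> t = - t"
proof -
  interpret ring "free_algebra g" by (rule ring_free_algebra)
  show ?thesis by (rule minus_equality) (simp_all add: assms free_carrier_closed)
qed

text \<open>
  Every element of the free algebra is a finite sum of monomials.
\<close>

lemma free_carrier_induct [consumes 1, case_names zero single add]:
  assumes "t \<in> carrier (free_algebra g)"
    and 0: "P 0" and 1: "\<And>w c. set w \<subseteq> g \<Longrightarrow> P (Poly_Mapping.single w c)"
    and add: "\<And>s t. s \<in> carrier (free_algebra g) \<Longrightarrow> t \<in> carrier (free_algebra g) \<Longrightarrow>
      P s \<Longrightarrow> P t \<Longrightarrow> P (s + t)"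
  shows "P t"
proof -
  have "P t" if "finite K" "Poly_Mapping.keys t \<subseteq> K" "\<forall>w\<in>K. set w \<subseteq> g" for K t
    using that
  proof (induction K arbitrary: t rule: finite_induct)
    case empty
    then show ?case using 0 by simp
  next
    case (insert w K)
    define s where "s = t - Poly_Mapping.single w (lk t w)"
    have s: "Poly_Mapping.keys s \<subseteq> K"
    proof
      fix u assume "u \<in> Poly_Mapping.keys s"
      then show "u \<in> K"
        using insert.prems(1) unfolding s_def in_keys_iff
        by (cases "u = w") (auto simp: lookup_minus lookup_single in_keys_iff subset_iff)
    qed
    have "P s" using insert.IH[OF s] insert.prems by simp
    then have "P (Poly_Mapping.single w (lk t w) + s)"
      using s insert.prems
      by (intro add 1) (auto simp: free_carrier_closed, auto simp: free_algebra_def)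
    then show ?case by (simp add: s_def)
  qed
  from this[of "Poly_Mapping.keys t" t] show ?thesis
    using assms(1) by (simp add: free_algebra_def)
qed

context lie_module
begin

lemma word_closed: "set w \<subseteq> g \<Longrightarrow> v \<in> carrier M \<Longrightarrow> foldr (act M) w v \<in> carrier M"
  by (induction w) (auto intro: act_closed)

lemma word_add:
  "set w \<subseteq> g \<Longrightarrow> u \<in> carrier M \<Longrightarrow> v \<in> carrier M \<Longrightarrow>
    foldr (act M) w (u \<oplus> v) = foldr (act M) w u \<oplus> foldr (act M) w v"
  by (induction w) (auto simp: act_add_right word_closed)

lemma word_smult:
  "set w \<subseteq> g \<Longrightarrow> v \<in> carrier M \<Longrightarrow> foldr (act M) w (c \<odot> v) = c \<odot> foldr (act M) w v"
  by (induction w) (auto simp: act_smult_right word_closed)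

lemma word_submodule: "lie_submodule g M W \<Longrightarrow> set w \<subseteq> g \<Longrightarrow> v \<in> W \<Longrightarrow> foldr (act M) w v \<in> W"
  by (induction w) (auto simp: lie_submodule_iff)

lemma free_act_superset:
  assumes "finite K" "Poly_Mapping.keys t \<subseteq> K" "\<forall>w\<in>K. set w \<subseteq> g" "v \<in> carrier M"
  shows "free_act M t v = (\<Oplus>w\<in>K. lk t w \<odot> foldr (act M) w v)"
  unfolding free_act_def
proof (rule M.add.finprod_mono_neutral_cong_left)
  show "lk t w \<odot> foldr (act M) w v = \<zero>"
    if "w \<in> K - Poly_Mapping.keys t" for w
    using that assms by (simp add: in_keys_iff word_closed)
qed (use assms word_closed in auto)

lemma keys_in_free: "t \<in> carrier (free_algebra g) \<Longrightarrow> w \<in> Poly_Mapping.keys t \<Longrightarrow> set w \<subseteq> g"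
  by (auto simp: free_algebra_def)

lemma free_act_closed:
  assumes "t \<in> carrier (free_algebra g)" "v \<in> carrier M"
  shows "free_act M t v \<in> carrier M"
  unfolding free_act_def
  using assms keys_in_free[OF assms(1)] by (intro M.finsum_closed) (auto simp: word_closed)

lemma free_act_add:
  assumes "s \<in> carrier (free_algebra g)" "t \<in> carrier (free_algebra g)" "v \<in> carrier M"
  shows "free_act M (s + t) v = free_act M s v \<oplus> free_act M t v"
proof -
  let ?K = "Poly_Mapping.keys s \<union> Poly_Mapping.keys t"
  have K: "finite ?K" "\<forall>w\<in>?K. set w \<subseteq> g" using assms by (auto simp: free_algebra_def)
  have wc: "foldr (act M) w v \<in> carrier M" if "w \<in> ?K" for w
    using that K assms by (blast intro: word_closed)
  have "free_act M (s + t) v =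
      (\<Oplus>w\<in>?K. lk s w \<odot> foldr (act M) w v \<oplus>
        lk t w \<odot> foldr (act M) w v)"
    unfolding free_act_superset[OF K(1) keys_add K(2) assms(3)]
    using wc by (intro M.finsum_cong') (auto simp: lookup_add smult_add_left)
  also have "\<dots> = free_act M s v \<oplus> free_act M t v"
    using wc K by (subst M.finsum_addf) (auto simp: free_act_superset[OF K(1) _ K(2) assms(3)])
  finally show ?thesis .
qed

lemma free_act_single:
  assumes "set w \<subseteq> g" "v \<in> carrier M"
  shows "free_act M (Poly_Mapping.single w c) v = c \<odot> foldr (act M) w v"
  using free_act_superset[of "{w}" "Poly_Mapping.single w c" v] assms by (simp add: word_closed)

lemma free_act_0: "v \<in> carrier M \<Longrightarrow> free_act M 0 v = \<zero>"
  by (simp add: free_act_def)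

lemma free_act_gen: "A \<in> g \<Longrightarrow> v \<in> carrier M \<Longrightarrow> free_act M (free_gen A) v = act M A v"
  by (simp add: free_gen_def free_act_single act_closed)

lemma free_act_const: "v \<in> carrier M \<Longrightarrow> free_act M (free_const c) v = c \<odot> v"
  by (simp add: free_const_def free_act_single)

lemma free_act_1: "v \<in> carrier M \<Longrightarrow> free_act M 1 v = v"
  using free_act_const[of v 1] by (simp add: free_const_def zero_list_def flip: single_one)

lemma free_act_zero: "t \<in> carrier (free_algebra g) \<Longrightarrow> free_act M t \<zero> = \<zero>"
proof (induction rule: free_carrier_induct)
  case (single w c)
  have "foldr (act M) w \<zero> = \<zero>"
    using word_smult[OF single, of "\<zero>" 0] word_closed[OF single, of "\<zero>"] by simp
  then show ?case using single by (simp add: free_act_single)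
qed (simp_all add: free_act_0 free_act_add)

lemma free_act_add_right:
  assumes "t \<in> carrier (free_algebra g)" and v: "v \<in> carrier M" "w \<in> carrier M"
  shows "free_act M t (v \<oplus> w) = free_act M t v \<oplus> free_act M t w"
  using assms(1)
proof (induction rule: free_carrier_induct)
  case (add s t)
  then show ?case using v
    by (simp add: free_act_add free_act_closed M.a_assoc M.a_lcomm)
qed (simp_all add: v free_act_0 free_act_single word_add word_closed smult_add_right)

lemma free_act_mult:
  assumes "s \<in> carrier (free_algebra g)" "t \<in> carrier (free_algebra g)" and v: "v \<in> carrier M"
  shows "free_act M (s * t) v = free_act M s (free_act M t v)"
  using assms(1)
proof (induction rule: free_carrier_induct)
  case zero
  show ?case using v assms(2) by (simp add: free_act_0 free_act_closed)
next
  case (single w c)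
  show ?case using assms(2)
  proof (induction rule: free_carrier_induct)
    case zero
    then show ?case using v single by (simp add: free_act_0 free_act_zero free_carrier_closed)
  next
    case (single u d)
    then show ?case using v \<open>set w \<subseteq> g\<close>
      by (simp add: mult_single plus_list_def free_act_single word_closed word_smult smult_smult)
  next
    case (add s t)
    then show ?case using v \<open>set w \<subseteq> g\<close>
      by (simp add: distrib_left free_act_add free_act_add_right free_act_closed free_carrier_closed)
  qed
next
  case (add s' t')
  then show ?case using v assms(2)
    by (simp add: distrib_right free_act_add free_act_closed free_carrier_closed)
qed

lemma free_act_uminus:
  assumes "t \<in> carrier (free_algebra g)" "v \<in> carrier M"
  shows "free_act M (- t) v = \<ominus> free_act M t v"
proof -
  have "free_act M (- t) v \<oplus> free_act M t v = \<zero>"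
    using free_act_add[of "- t" t v] assms by (simp add: free_carrier_closed free_act_0)
  then show ?thesis using assms
    by (metis M.minus_equality free_act_closed free_carrier_closed(5))
qed

lemma free_act_minus:
  assumes "s \<in> carrier (free_algebra g)" "t \<in> carrier (free_algebra g)" "v \<in> carrier M"
  shows "free_act M (s - t) v = free_act M s v \<ominus> free_act M t v"
  using free_act_add[of s "- t" v] assms by (simp add: free_carrier_closed free_act_uminus a_minus_def)

lemma free_act_submodule:
  assumes "lie_submodule g M W" "t \<in> carrier (free_algebra g)" "v \<in> W"
  shows "free_act M t v \<in> W"
  using assms(2)
proof (induction rule: free_carrier_induct)
  case zero
  then show ?case using assms unfolding lie_submodule_iff by (auto simp: free_act_0)
next
  case (single w c)
  then show ?case using assms word_submodule[of W w v] unfolding lie_submodule_iff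
    by (auto simp: free_act_single)
next
  case (add s t)
  then show ?case using assms unfolding lie_submodule_iff by (auto simp: free_act_add)
qed

end

lemma env_relations_subset:
  assumes "lie_closed g"
  shows "env_relations g \<subseteq> carrier (free_algebra g)"
  using assms unfolding env_relations_def lie_closed_def
  by (auto intro!: free_carrier_closed)

lemma ideal_env_ideal:
  assumes "lie_closed g"
  shows "ideal (env_ideal g) (free_algebra g)"
  unfolding env_ideal_def
  by (rule ring.genideal_ideal[OF ring_free_algebra env_relations_subset[OF assms]])

lemma env_relations_in_ideal:
  assumes "lie_closed g"
  shows "env_relations g \<subseteq> env_ideal g"
  unfolding env_ideal_def
  by (rule ring.genideal_self[OF ring_free_algebra env_relations_subset[OF assms]])

text \<open>
  The elements that act by zero on the whole module form a two-sided ideal, and the module axioms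
  say that this ideal contains the defining relations of the enveloping algebra.
\<close>

lemma (in lie_module) env_ideal_acts_by_zero:
  assumes g: "lie_closed g" and t: "t \<in> env_ideal g" and v: "v \<in> carrier M"
  shows "free_act M t v = \<zero>"
proof -
  define I where "I = {t \<in> carrier (free_algebra g). \<forall>v\<in>carrier M. free_act M t v = \<zero>}"
  interpret F: ring "free_algebra g" by (rule ring_free_algebra)
  have "ideal I (free_algebra g)"
  proof (intro idealI)
    show "ring (free_algebra g)" by (rule ring_free_algebra)
    show "subgroup I (add_monoid (free_algebra g))"
    proof (rule F.add.subgroupI)
      show "I \<subseteq> carrier (free_algebra g)" by (auto simp: I_def)
      show "I \<noteq> {}" unfolding I_def using free_carrier_closed(1) free_act_0 by blast
      show "\<ominus>\<^bsub>free_algebra g\<^esub> a \<in> I" if "a \<in> I" for a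
        using that by (auto simp: I_def free_act_uminus free_carrier_closed)
      show "a \<oplus>\<^bsub>free_algebra g\<^esub> b \<in> I" if "a \<in> I" "b \<in> I" for a b
        using that by (auto simp: I_def free_act_add free_carrier_closed)
    qed
    show "x \<otimes>\<^bsub>free_algebra g\<^esub> a \<in> I" "a \<otimes>\<^bsub>free_algebra g\<^esub> x \<in> I"
      if "a \<in> I" "x \<in> carrier (free_algebra g)" for a x
      using that by (auto simp: I_def free_act_mult free_act_zero free_act_closed free_carrier_closed)
  qed
  moreover have "env_relations g \<subseteq> I"
  proof
    fix r assume r: "r \<in> env_relations g"
    have rc: "r \<in> carrier (free_algebra g)" using r env_relations_subset[OF g] by blast
    have "free_act M r u = \<zero>" if u: "u \<in> carrier M" for u
    proof -
      have cancel: "x \<ominus> y \<ominus> z = \<zero>"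
        if "x = y \<oplus> z" "y \<in> carrier M" "z \<in> carrier M" for x y z
      proof -
        have "y \<oplus> z \<oplus> \<ominus> y \<oplus> \<ominus> z = (y \<oplus> \<ominus> y) \<oplus> (z \<oplus> \<ominus> z)"
          using that by (simp add: M.a_ac)
        then show ?thesis using that by (simp add: a_minus_def M.r_neg)
      qed
      consider A B where "A \<in> g" "B \<in> g" "r = free_gen (A + B) - free_gen A - free_gen B"
        | c A where "A \<in> g" "r = free_gen (c \<cdot>\<^sub>m A) - free_const c * free_gen A"
        | A B where "A \<in> g" "B \<in> g"
          "r = free_gen A * free_gen B - free_gen B * free_gen A - free_gen (lie_bracket A B)"
        using r unfolding env_relations_def by blast
      then show ?thesis
      proof cases
        case 1
        then show ?thesis using u g
          by (simp add: free_act_minus free_carrier_closed free_act_gen lie_closed_def act_add_left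
              act_closed cancel)
      next
        case 2
        then show ?thesis using u g
          by (simp add: free_act_minus free_carrier_closed free_act_gen lie_closed_def free_act_mult
              free_act_const act_smult_left act_closed) (simp add: a_minus_def act_closed M.r_neg)
      next
        case 3
        then show ?thesis using u g
          by (simp add: free_act_minus free_carrier_closed free_act_gen lie_closed_def free_act_mult
              act_bracket act_closed) (simp add: a_minus_def act_closed M.r_neg)
      qed
    qed
    then show "r \<in> I" using rc by (simp add: I_def)
  qed
  ultimately have "env_ideal g \<subseteq> I"
    unfolding env_ideal_def by (rule F.genideal_minimal)
  then show ?thesis using t v by (auto simp: I_def)
qed

lemma env_carrier: "carrier (env_algebra g) = env_class g ` carrier (free_algebra g)"
  by (auto simp: env_algebra_def FactRing_def A_RCOSETS_def' a_r_coset_def' env_class_def)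

lemma (in lie_module) env_act_class:
  assumes g: "lie_closed g" and t: "t \<in> carrier (free_algebra g)" and v: "v \<in> carrier M"
  shows "env_act M (env_class g t) v = free_act M t v"
proof -
  interpret I: ideal "env_ideal g" "free_algebra g" by (rule ideal_env_ideal[OF g])
  have "(\<lambda>s. free_act M s v) ` env_class g t = {free_act M t v}"
  proof -
    have "free_act M (i + t) v = free_act M t v" if "i \<in> env_ideal g" for i
      using that t v I.a_subset
      by (simp add: subset_iff free_act_add env_ideal_acts_by_zero[OF g] free_act_closed)
    moreover have "env_class g t = (\<lambda>i. i + t) ` env_ideal g"
      by (auto simp: env_class_def a_r_coset_def')
    moreover have "env_ideal g \<noteq> {}" using additive_subgroup.zero_closed[OF I.additive_subgroup_axioms] by auto
    ultimately show ?thesis by (simp add: image_image image_constant_conv cong: image_cong_simp)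
  qed
  then show ?thesis by (simp add: env_act_def)
qed

lemma env_class_ops:
  assumes g: "lie_closed g" and s: "s \<in> carrier (free_algebra g)" and t: "t \<in> carrier (free_algebra g)"
  shows "env_class g s \<oplus>\<^bsub>env_algebra g\<^esub> env_class g t = env_class g (s + t)"
    and "env_class g s \<otimes>\<^bsub>env_algebra g\<^esub> env_class g t = env_class g (s * t)"
    and "\<one>\<^bsub>env_algebra g\<^esub> = env_class g 1"
    and "\<zero>\<^bsub>env_algebra g\<^esub> = env_class g 0"
    and "env_class g s = env_class g t \<longleftrightarrow> s - t \<in> env_ideal g"
proof -
  interpret I: ideal "env_ideal g" "free_algebra g" by (rule ideal_env_ideal[OF g])
  note hom = I.rcos_ring_hom
  show "env_class g s \<oplus>\<^bsub>env_algebra g\<^esub> env_class g t = env_class g (s + t)"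
    using ring_hom_add[OF hom s t] by (simp add: env_class_def env_algebra_def)
  show "env_class g s \<otimes>\<^bsub>env_algebra g\<^esub> env_class g t = env_class g (s * t)"
    using ring_hom_mult[OF hom s t] by (simp add: env_class_def env_algebra_def)
  show "\<one>\<^bsub>env_algebra g\<^esub> = env_class g 1"
    using ring_hom_one[OF hom] by (simp add: env_class_def env_algebra_def)
  show "\<zero>\<^bsub>env_algebra g\<^esub> = env_class g 0"
    using ring_hom_zero[OF hom ring_free_algebra I.quotient_is_ring]
    by (simp add: env_class_def env_algebra_def)
  have "s \<in> env_class g t \<longleftrightarrow> s - t \<in> env_ideal g"
    using I.a_rcos_module[OF t s] t by (simp add: env_class_def)
  then show "env_class g s = env_class g t \<longleftrightarrow> s - t \<in> env_ideal g"
    using I.a_repr_independence'[of s t] I.a_rcos_self[OF s] t unfolding env_class_def by metis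
qed

lemma lie_module_env_regular:
  assumes g: "lie_closed g"
  shows "lie_module g (env_regular g)"
proof -
  interpret I: ideal "env_ideal g" "free_algebra g" by (rule ideal_env_ideal[OF g])
  note ops = env_class_ops(1-4)[OF g] and eq_iff = env_class_ops(5)[OF g]
  interpret E: ring "env_algebra g" unfolding env_algebra_def by (rule I.quotient_is_ring)
  let ?E = "env_regular g"
  have simps [simp]: "carrier ?E = carrier (env_algebra g)" "\<zero>\<^bsub>?E\<^esub> = \<zero>\<^bsub>env_algebra g\<^esub>"
    "u \<oplus>\<^bsub>?E\<^esub> v = u \<oplus>\<^bsub>env_algebra g\<^esub> v"
    "c \<odot>\<^bsub>?E\<^esub> u = env_class g (free_const c) \<otimes>\<^bsub>env_algebra g\<^esub> u"
    "act ?E A u = env_class g (free_gen A) \<otimes>\<^bsub>env_algebra g\<^esub> u" for u v c A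
    by (simp_all add: env_regular_def)
  have cl: "env_class g t \<in> carrier (env_algebra g)" if "t \<in> carrier (free_algebra g)" for t
    using that by (auto simp: env_carrier)
  have cc: "env_class g (free_const c) \<in> carrier (env_algebra g)" for c
    by (rule cl) (rule free_carrier_closed)
  have cg: "env_class g (free_gen A) \<in> carrier (env_algebra g)" if "A \<in> g" for A
    using that by (intro cl free_carrier_closed)
  have inv: "\<ominus>\<^bsub>?E\<^esub> u = \<ominus>\<^bsub>env_algebra g\<^esub> u" for u
    by (simp add: a_inv_def m_inv_def)
  have rel: "env_class g s = env_class g t"
    if "s - t \<in> env_relations g" "s \<in> carrier (free_algebra g)" "t \<in> carrier (free_algebra g)" for s t
    using that eq_iff[of s t] env_relations_in_ideal[OF g] by blast
  have radd: "env_class g (free_gen (A + B)) =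
      env_class g (free_gen A) \<oplus>\<^bsub>env_algebra g\<^esub> env_class g (free_gen B)"
    if "A \<in> g" "B \<in> g" for A B
  proof -
    have "env_class g (free_gen (A + B)) = env_class g (free_gen A + free_gen B)"
    proof (rule rel)
      show "free_gen (A + B) - (free_gen A + free_gen B) \<in> env_relations g"
        unfolding diff_diff_eq[symmetric] env_relations_def using that by blast
    qed (use that g in \<open>auto simp: lie_closed_def intro!: free_carrier_closed\<close>)
    then show ?thesis using that by (simp add: ops free_carrier_closed)
  qed
  have rsm: "env_class g (free_gen (c \<cdot>\<^sub>m A)) =
      env_class g (free_const c) \<otimes>\<^bsub>env_algebra g\<^esub> env_class g (free_gen A)"
    if "A \<in> g" for c A
  proof -
    have "env_class g (free_gen (c \<cdot>\<^sub>m A)) = env_class g (free_const c * free_gen A)"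
    proof (rule rel)
      show "free_gen (c \<cdot>\<^sub>m A) - free_const c * free_gen A \<in> env_relations g"
        unfolding env_relations_def using that by blast
    qed (use that g in \<open>auto simp: lie_closed_def intro!: free_carrier_closed\<close>)
    then show ?thesis using that by (simp add: ops free_carrier_closed)
  qed
  have rbr: "env_class g (free_gen (lie_bracket A B)) \<oplus>\<^bsub>env_algebra g\<^esub>
      env_class g (free_gen B) \<otimes>\<^bsub>env_algebra g\<^esub> env_class g (free_gen A) =
      env_class g (free_gen A) \<otimes>\<^bsub>env_algebra g\<^esub> env_class g (free_gen B)"
    if "A \<in> g" "B \<in> g" for A B
  proof -
    have "env_class g (free_gen (lie_bracket A B) + free_gen B * free_gen A) =
        env_class g (free_gen A * free_gen B)"
    proof (rule rel[symmetric])
      have "free_gen A * free_gen B - free_gen B * free_gen A - free_gen (lie_bracket A B)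
          \<in> env_relations g"
        unfolding env_relations_def using that by blast
      then show "free_gen A * free_gen B - (free_gen (lie_bracket A B) + free_gen B * free_gen A)
          \<in> env_relations g"
        by (simp add: algebra_simps)
    qed (use that g in \<open>auto simp: lie_closed_def intro!: free_carrier_closed\<close>)
    then show ?thesis using that g by (simp add: ops free_carrier_closed lie_closed_def)
  qed
  have central: "env_class g (free_gen A) \<otimes>\<^bsub>env_algebra g\<^esub> env_class g (free_const c) =
      env_class g (free_const c) \<otimes>\<^bsub>env_algebra g\<^esub> env_class g (free_gen A)" if "A \<in> g" for A c
    using that by (simp add: ops free_carrier_closed)
      (simp add: free_gen_def free_const_def mult_single plus_list_def)
  have cring_c: "free_const (c + d) = free_const c + free_const d"
    "free_const (c * d) = free_const c * free_const d" "free_const 1 = 1" for c d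
    by (simp_all add: free_const_def single_add mult_single plus_list_def)
      (simp add: zero_list_def flip: single_one)
  have mod: "module complex_field ?E"
  proof (rule moduleI[OF cring_complex_field])
    show "abelian_group ?E"
    proof (rule abelian_groupI)
      fix x assume "x \<in> carrier ?E"
      then show "\<exists>y\<in>carrier ?E. y \<oplus>\<^bsub>?E\<^esub> x = \<zero>\<^bsub>?E\<^esub>"
        by (intro bexI[of _ "\<ominus>\<^bsub>env_algebra g\<^esub> x"]) (simp_all add: E.l_neg)
    qed (simp_all add: E.a_ac)
    fix a b x y assume x: "x \<in> carrier ?E"
    show "a \<odot>\<^bsub>?E\<^esub> x \<in> carrier ?E" using x cc by simp
    show "(a \<oplus>\<^bsub>complex_field\<^esub> b) \<odot>\<^bsub>?E\<^esub> x = a \<odot>\<^bsub>?E\<^esub> x \<oplus>\<^bsub>?E\<^esub> b \<odot>\<^bsub>?E\<^esub> x"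
      using x cc E.l_distr[of "env_class g (free_const a)" "env_class g (free_const b)" x]
      by (simp add: cring_c ops free_carrier_closed)
    show "(a \<otimes>\<^bsub>complex_field\<^esub> b) \<odot>\<^bsub>?E\<^esub> x = a \<odot>\<^bsub>?E\<^esub> (b \<odot>\<^bsub>?E\<^esub> x)"
      using x cc E.m_assoc[of "env_class g (free_const a)" "env_class g (free_const b)" x]
      by (simp add: cring_c ops free_carrier_closed)
    show "\<one>\<^bsub>complex_field\<^esub> \<odot>\<^bsub>?E\<^esub> x = x"
      using x E.l_one[of x] by (simp add: cring_c ops(3)[OF free_carrier_closed(1,1)])
    assume "y \<in> carrier ?E"
    then show "a \<odot>\<^bsub>?E\<^esub> (x \<oplus>\<^bsub>?E\<^esub> y) = a \<odot>\<^bsub>?E\<^esub> x \<oplus>\<^bsub>?E\<^esub> a \<odot>\<^bsub>?E\<^esub> y"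
      using x cc by (simp add: E.r_distr)
  qed
  show ?thesis
  proof (intro lie_module.intro lie_module_axioms.intro mod)
    fix A B v w c assume A: "A \<in> g" and v: "v \<in> carrier ?E"
    show "act ?E A v \<in> carrier ?E" using A v cg by simp
    show "act ?E A (c \<odot>\<^bsub>?E\<^esub> v) = c \<odot>\<^bsub>?E\<^esub> act ?E A v"
      using A v cg cc central by (simp flip: E.m_assoc)
    show "act ?E (c \<cdot>\<^sub>m A) v = c \<odot>\<^bsub>?E\<^esub> act ?E A v"
      using A v cg cc rsm by (simp flip: E.m_assoc)
    { assume "w \<in> carrier ?E"
      then show "act ?E A (v \<oplus>\<^bsub>?E\<^esub> w) = act ?E A v \<oplus>\<^bsub>?E\<^esub> act ?E A w"
        using A v cg by (simp add: E.r_distr) }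
    assume B: "B \<in> g"
    show "act ?E (A + B) v = act ?E A v \<oplus>\<^bsub>?E\<^esub> act ?E B v"
      using A B v cg radd by (simp add: E.l_distr)
    have br: "env_class g (free_gen (lie_bracket A B)) \<in> carrier (env_algebra g)"
      using A B g by (intro cg) (simp add: lie_closed_def)
    have br_v: "env_class g (free_gen (lie_bracket A B)) \<otimes>\<^bsub>env_algebra g\<^esub> v \<oplus>\<^bsub>env_algebra g\<^esub>
        env_class g (free_gen B) \<otimes>\<^bsub>env_algebra g\<^esub> (env_class g (free_gen A) \<otimes>\<^bsub>env_algebra g\<^esub> v) =
        env_class g (free_gen A) \<otimes>\<^bsub>env_algebra g\<^esub> (env_class g (free_gen B) \<otimes>\<^bsub>env_algebra g\<^esub> v)"
      using A B v cg br by (simp flip: E.m_assoc E.l_distr add: rbr)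
    then show "act ?E (lie_bracket A B) v = act ?E A (act ?E B v) \<ominus>\<^bsub>?E\<^esub> act ?E B (act ?E A v)"
      using A B v cg br by (simp add: a_minus_def inv flip: br_v) (simp add: E.a_assoc E.r_neg)
  qed
qed

section \<open>Cyclic modules and Verma modules\<close>

context lie_module
begin

definition cyc :: "'v \<Rightarrow> 'v set" where
  "cyc x = (\<lambda>t. free_act M t x) ` carrier (free_algebra g)"

lemma cyclic_module_eq:
  assumes "lie_closed g" "x \<in> carrier M"
  shows "cyclic_module g M x = M\<lparr>carrier := cyc x\<rparr>"
proof -
  have "(\<lambda>u. env_act M u x) ` carrier (env_algebra g) = cyc x"
    unfolding env_carrier cyc_def image_image
    by (rule image_cong) (simp_all add: env_act_class[OF assms(1) _ assms(2)])
  then show ?thesis by (simp add: cyclic_module_def)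
qed

lemma generator_in_cyc: "x \<in> carrier M \<Longrightarrow> x \<in> cyc x"
  unfolding cyc_def using free_act_1[of x] free_carrier_closed(2)[of g] by (metis imageI)

lemma cyc_least: "lie_submodule g M W \<Longrightarrow> x \<in> W \<Longrightarrow> cyc x \<subseteq> W"
  by (auto simp: cyc_def intro: free_act_submodule)

lemma lie_submodule_cyc:
  assumes x: "x \<in> carrier M"
  shows "lie_submodule g M (cyc x)"
  unfolding lie_submodule_iff
proof (intro conjI ballI allI)
  show "cyc x \<subseteq> carrier M" using x by (auto simp: cyc_def free_act_closed)
  show "\<zero> \<in> cyc x"
    unfolding cyc_def using free_act_0[OF x] free_carrier_closed(1)[of g] by (metis imageI)
  fix v assume "v \<in> cyc x"
  then obtain t where t: "t \<in> carrier (free_algebra g)" "v = free_act M t x" by (auto simp: cyc_def)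
  show "c \<odot> v \<in> cyc x" for c
  proof -
    have "c \<odot> v = free_act M (free_const c * t) x"
      using t x by (simp add: free_act_mult free_act_const free_carrier_closed free_act_closed)
    then show ?thesis unfolding cyc_def using t free_carrier_closed by (metis imageI)
  qed
  show "act M A v \<in> cyc x" if "A \<in> g" for A
  proof -
    have "act M A v = free_act M (free_gen A * t) x"
      using t x that by (simp add: free_act_mult free_act_gen free_carrier_closed free_act_closed)
    then show ?thesis unfolding cyc_def using t that free_carrier_closed by (metis imageI)
  qed
  fix w assume "w \<in> cyc x"
  then obtain s where s: "s \<in> carrier (free_algebra g)" "w = free_act M s x" by (auto simp: cyc_def)
  have "v \<oplus> w = free_act M (t + s) x"
    using s t x by (simp add: free_act_add)
  then show "v \<oplus> w \<in> cyc x" unfolding cyc_def using t s free_carrier_closed by (metis imageI)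
qed

lemma lie_module_cyclic:
  assumes "lie_closed g" "x \<in> carrier M"
  shows "lie_module g (cyclic_module g M x)"
  unfolding cyclic_module_eq[OF assms] by (rule lie_module_restrict[OF lie_submodule_cyc[OF assms(2)]])

lemma evaluation_hom:
  assumes g: "lie_closed g" and x: "x \<in> carrier M"
  shows "lie_hom g (env_regular g) (cyclic_module g M x) (\<lambda>u. env_act M u x)"
proof (intro lie_hom.intro lie_hom_axioms.intro lie_module_env_regular[OF g] lie_module_cyclic[OF g x])
  note ops = env_class_ops(1,2)[OF g]
  note ev = env_act_class[OF g _ x]
  have R: "carrier (env_regular g) = env_class g ` carrier (free_algebra g)"
    by (simp add: env_regular_def env_carrier)
  fix u v c A assume "u \<in> carrier (env_regular g)"
  then obtain t where t: "t \<in> carrier (free_algebra g)" "u = env_class g t" unfolding R by blast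
  show "env_act M u x \<in> carrier (cyclic_module g M x)"
    using t unfolding cyclic_module_eq[OF g x] by (simp add: ev cyc_def)
  show "env_act M (c \<odot>\<^bsub>env_regular g\<^esub> u) x = c \<odot>\<^bsub>cyclic_module g M x\<^esub> env_act M u x"
    using t x unfolding cyclic_module_eq[OF g x]
    by (simp add: env_regular_def ops free_carrier_closed ev free_act_mult free_act_const free_act_closed)
  show "env_act M (act (env_regular g) A u) x = act (cyclic_module g M x) A (env_act M u x)"
    if "A \<in> g"
    using t x that unfolding cyclic_module_eq[OF g x]
    by (simp add: env_regular_def ops free_carrier_closed ev free_act_mult free_act_gen free_act_closed)
  assume "v \<in> carrier (env_regular g)"
  then obtain s where s: "s \<in> carrier (free_algebra g)" "v = env_class g s" unfolding R by blast
  show "env_act M (u \<oplus>\<^bsub>env_regular g\<^esub> v) x =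
      env_act M u x \<oplus>\<^bsub>cyclic_module g M x\<^esub> env_act M v x"
    using s t x unfolding cyclic_module_eq[OF g x]
    by (simp add: env_regular_def ops free_carrier_closed ev free_act_add)
qed

end

text \<open>
  Left multiplication reaches every monomial from the unit, one letter at a time.
\<close>

lemma env_regular_generated:
  assumes g: "lie_closed g" and W: "lie_submodule g (env_regular g) W" and 1: "env_class g 1 \<in> W"
  shows "W = carrier (env_regular g)"
proof -
  interpret E: lie_module g "env_regular g" by (rule lie_module_env_regular[OF g])
  note ops = env_class_ops(1,2)[OF g] and zero_eq = env_class_ops(4)[OF g free_carrier_closed(1) free_carrier_closed(1)]
  have W': "W \<subseteq> carrier (env_regular g)" "\<zero>\<^bsub>env_regular g\<^esub> \<in> W"
    "\<And>v w. v \<in> W \<Longrightarrow> w \<in> W \<Longrightarrow> v \<oplus>\<^bsub>env_regular g\<^esub> w \<in> W"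
    "\<And>c v. v \<in> W \<Longrightarrow> c \<odot>\<^bsub>env_regular g\<^esub> v \<in> W"
    "\<And>A v. A \<in> g \<Longrightarrow> v \<in> W \<Longrightarrow> act (env_regular g) A v \<in> W"
    using W unfolding E.lie_submodule_iff by auto
  have word: "env_class g (Poly_Mapping.single w c) \<in> W" if "set w \<subseteq> g" for w c
    using that
  proof (induction w)
    case Nil
    have "c \<odot>\<^bsub>env_regular g\<^esub> env_class g 1 = env_class g (Poly_Mapping.single [] c)"
      by (simp add: env_regular_def ops free_carrier_closed) (simp add: free_const_def)
    then show ?case using W'(4)[OF 1, of c] by simp
  next
    case (Cons A w)
    then have "act (env_regular g) A (env_class g (Poly_Mapping.single w c)) =
        env_class g (Poly_Mapping.single (A # w) c)"
      by (simp add: env_regular_def ops free_carrier_closed)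
        (simp add: free_gen_def mult_single plus_list_def)
    then show ?case using W'(5)[of A "env_class g (Poly_Mapping.single w c)"] Cons by simp
  qed
  have "env_class g t \<in> W" if "t \<in> carrier (free_algebra g)" for t
    using that
  proof (induction rule: free_carrier_induct)
    case zero
    then show ?case using W'(2) zero_eq by (simp add: env_regular_def)
  next
    case (add s t)
    then show ?case using W'(3)[of "env_class g s" "env_class g t"]
      by (simp add: env_regular_def ops)
  qed (rule word)
  then show ?thesis using W'(1) by (auto simp: env_regular_def env_carrier)
qed

definition hw_vector :: "(complex mat, 'v) lie_rep \<Rightarrow> complex mat set \<Rightarrow> (complex mat \<times> complex) set \<Rightarrow> 'v \<Rightarrow> bool" where
  "hw_vector M P C x \<longleftrightarrow> x \<in> carrier M \<and> (\<forall>A\<in>P. act M A x = \<zero>\<^bsub>M\<^esub>) \<and> (\<forall>(h, c)\<in>C. act M h x = c \<odot>\<^bsub>M\<^esub> x)"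

definition verma_ideal where
  "verma_ideal g P C = generated_submodule g (env_regular g)
          ({env_class g (free_gen A) | A. A \<in> P} \<union>
           {env_class g (free_gen h - free_const c) | h c. (h, c) \<in> C})"

definition verma_generator where
  "verma_generator g P C = verma_ideal g P C +>\<^bsub>env_regular g\<^esub> env_class g 1"

context
  fixes g P :: "complex mat set" and C :: "(complex mat \<times> complex) set"
  assumes g: "lie_closed g" and P: "P \<subseteq> g" and C: "fst ` C \<subseteq> g"
begin

interpretation E: lie_module g "env_regular g" by (rule lie_module_env_regular[OF g])

lemma verma_eq: "verma_module g P C = quotient_module (env_regular g) (verma_ideal g P C)"
  by (simp add: verma_module_def verma_ideal_def)

lemma Cg: "(h, c) \<in> C \<Longrightarrow> h \<in> g"
  using C by force

lemma verma_gens_subset: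
  "{env_class g (free_gen A) | A. A \<in> P} \<union>
     {env_class g (free_gen h - free_const c) | h c. (h, c) \<in> C} \<subseteq> carrier (env_regular g)"
  using P Cg by (auto simp: env_regular_def env_carrier intro!: imageI free_carrier_closed)

lemma verma_ideal_submodule: "lie_submodule g (env_regular g) (verma_ideal g P C)"
  unfolding verma_ideal_def by (rule E.lie_submodule_generated[OF verma_gens_subset])

lemma lie_module_verma: "lie_module g (verma_module g P C)"
  unfolding verma_eq by (rule E.quotient_hom(1)[OF g verma_ideal_submodule])

lemma one_in_regular: "env_class g 1 \<in> carrier (env_regular g)"
  by (auto simp: env_regular_def env_carrier intro!: free_carrier_closed)

lemma verma_generator_in: "verma_generator g P C \<in> carrier (verma_module g P C)"
  unfolding verma_eq verma_generator_def E.quotient_carrier using one_in_regular by blast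

lemma verma_generated:
  assumes "lie_submodule g (verma_module g P C) W" "verma_generator g P C \<in> W"
  shows "W = carrier (verma_module g P C)"
proof -
  interpret \<pi>: lie_hom g "env_regular g" "quotient_module (env_regular g) (verma_ideal g P C)"
    "\<lambda>v. verma_ideal g P C +>\<^bsub>env_regular g\<^esub> v"
    by (rule E.quotient_hom(2)[OF g verma_ideal_submodule])
  have W: "W \<subseteq> carrier (verma_module g P C)"
    using assms(1) by (auto simp: verma_eq \<pi>.M'.lie_submodule_iff)
  have "{v \<in> carrier (env_regular g). verma_ideal g P C +>\<^bsub>env_regular g\<^esub> v \<in> W} = carrier (env_regular g)"
    using assms one_in_regular
    by (intro env_regular_generated[OF g \<pi>.lie_submodule_vimage])
      (auto simp: verma_eq verma_generator_def)
  then show ?thesis using W by (auto simp: verma_eq E.quotient_carrier)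
qed

lemma verma_generator_hw: "hw_vector (verma_module g P C) P C (verma_generator g P C)"
  unfolding hw_vector_def
proof (intro conjI ballI verma_generator_in)
  note q = E.quotient_ops[OF verma_ideal_submodule one_in_regular]
  have gens: "{env_class g (free_gen A) | A. A \<in> P} \<union>
     {env_class g (free_gen h - free_const c) | h c. (h, c) \<in> C} \<subseteq> verma_ideal g P C"
    unfolding verma_ideal_def by (rule E.generated_superset)
  note ops = env_class_ops(1,2)[OF g]
  have act1: "act (env_regular g) A (env_class g 1) = env_class g (free_gen A)" if "A \<in> g" for A
    using that by (simp add: env_regular_def ops free_carrier_closed)
  have sm1: "c \<odot>\<^bsub>env_regular g\<^esub> (env_class g 1) = env_class g (free_const c)" for c
    by (simp add: env_regular_def ops free_carrier_closed)
  have cl: "env_class g t \<in> carrier (env_regular g)" if "t \<in> carrier (free_algebra g)" for t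
    using that by (auto simp: env_regular_def env_carrier)
  show "act (verma_module g P C) A (verma_generator g P C) = \<zero>\<^bsub>verma_module g P C\<^esub>" if "A \<in> P" for A
  proof -
    have A: "A \<in> g" using that P by blast
    show ?thesis unfolding verma_eq verma_generator_def q(2)[OF A] act1[OF A]
      using gens that A by (subst E.coset_eq_zero_iff[OF verma_ideal_submodule]) (auto intro!: cl free_carrier_closed)
  qed
  fix hc assume hc: "hc \<in> C"
  obtain h c where [simp]: "hc = (h, c)" by (cases hc)
  have h: "h \<in> g" using hc Cg by simp
  have "env_class g (free_gen h) \<ominus>\<^bsub>env_regular g\<^esub> env_class g (free_const c) =
      env_class g (free_gen h - free_const c)"
  proof -
    have "\<ominus>\<^bsub>env_regular g\<^esub> env_class g (free_const c) = env_class g (- free_const c)"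
    proof (rule E.M.minus_equality)
      show "env_class g (- free_const c) \<oplus>\<^bsub>env_regular g\<^esub> env_class g (free_const c) = \<zero>\<^bsub>env_regular g\<^esub>"
        using env_class_ops(4)[OF g free_carrier_closed(1) free_carrier_closed(1)]
        by (simp add: env_regular_def ops free_carrier_closed)
    qed (auto intro!: cl free_carrier_closed)
    then show ?thesis using h ops(1)[of "free_gen h" "- free_const c"]
      by (simp add: a_minus_def env_regular_def free_carrier_closed)
  qed
  moreover have "env_class g (free_gen h - free_const c) \<in> verma_ideal g P C"
  proof -
    have "(h, c) \<in> C" using hc by simp
    then show ?thesis using gens by blast
  qed
  ultimately have "verma_ideal g P C +>\<^bsub>env_regular g\<^esub> env_class g (free_gen h) =
      verma_ideal g P C +>\<^bsub>env_regular g\<^esub> env_class g (free_const c)"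
    using h by (subst E.coset_eq_iff[OF verma_ideal_submodule]) (auto intro!: cl free_carrier_closed)
  then show "case hc of (h, c) \<Rightarrow> act (verma_module g P C) h (verma_generator g P C) =
      c \<odot>\<^bsub>verma_module g P C\<^esub> verma_generator g P C"
    unfolding verma_eq verma_generator_def using h
    by (simp add: q act1 sm1)
qed

text \<open>
  Evaluation at \<open>x\<close> is a homomorphism from the enveloping algebra, and the conditions on a highest weight
  vector say that it kills the generators of the left ideal that defines the Verma module.
\<close>

lemma verma_universal:
  assumes M: "lie_module g M" and x: "hw_vector M P C x"
  obtains h where "lie_hom g (verma_module g P C) (cyclic_module g M x) h"
    "h (verma_generator g P C) = x"
    "h ` carrier (verma_module g P C) = carrier (cyclic_module g M x)"
proof -
  interpret M: lie_module g M by fact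
  have xM: "x \<in> carrier M" using x by (simp add: hw_vector_def)
  interpret ev: lie_hom g "env_regular g" "cyclic_module g M x" "\<lambda>u. env_act M u x"
    by (rule M.evaluation_hom[OF g xM])
  note cyc = M.cyclic_module_eq[OF g xM]
  have "{env_class g (free_gen A) | A. A \<in> P} \<union>
     {env_class g (free_gen h - free_const c) | h c. (h, c) \<in> C} \<subseteq> ev.ker"
  proof -
    have "free_act M (free_gen A) x = \<zero>\<^bsub>M\<^esub>" if "A \<in> P" for A
      using that x P xM by (auto simp: hw_vector_def M.free_act_gen subset_iff)
    moreover have "free_act M (free_gen h - free_const c) x = \<zero>\<^bsub>M\<^esub>" if "(h, c) \<in> C" for h c
    proof -
      have "act M h x = c \<odot>\<^bsub>M\<^esub> x" using that x by (auto simp: hw_vector_def)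
      then show ?thesis using Cg[OF that] xM
        by (simp add: M.free_act_gen M.free_act_minus M.free_act_const free_carrier_closed)
          (simp add: a_minus_def M.M.r_neg)
    qed
    moreover have "\<zero>\<^bsub>cyclic_module g M x\<^esub> = \<zero>\<^bsub>M\<^esub>" by (simp add: cyc)
    then have "u \<in> ev.ker \<longleftrightarrow> u \<in> carrier (env_regular g) \<and> env_act M u x = \<zero>\<^bsub>M\<^esub>" for u
      by (simp add: ev.ker_def)
    ultimately show ?thesis
      using verma_gens_subset P Cg
      by (auto simp: M.env_act_class[OF g _ xM] free_carrier_closed subset_iff)
  qed
  then have "verma_ideal g P C \<subseteq> ev.ker"
    unfolding verma_ideal_def by (rule E.generated_least[OF ev.lie_submodule_ker])
  from ev.factor_through_quotient[OF g verma_ideal_submodule this]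
  obtain h where h: "lie_hom g (verma_module g P C) (cyclic_module g M x) h"
    "\<And>v. v \<in> carrier (env_regular g) \<Longrightarrow> h (verma_ideal g P C +>\<^bsub>env_regular g\<^esub> v) = env_act M v x"
    unfolding verma_eq by blast
  show ?thesis
  proof (rule that[OF h(1)])
    show "h (verma_generator g P C) = x"
      unfolding verma_generator_def h(2)[OF one_in_regular]
      by (simp add: M.env_act_class[OF g _ xM] free_carrier_closed M.free_act_1 xM)
    show "h ` carrier (verma_module g P C) = carrier (cyclic_module g M x)"
      unfolding verma_eq E.quotient_carrier image_image
      using h(2) by (auto simp: cyclic_module_def env_regular_def)
  qed
qed

end

section \<open>Triangular decomposition and highest weight vectors\<close>

inductive_set mspan :: "complex mat set \<Rightarrow> complex mat set" for S where
  base: "A \<in> S \<Longrightarrow> A \<in> mspan S"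
| add: "A \<in> mspan S \<Longrightarrow> B \<in> mspan S \<Longrightarrow> A + B \<in> mspan S"
| smult: "A \<in> mspan S \<Longrightarrow> c \<cdot>\<^sub>m A \<in> mspan S"

lemma mspan_subset: "lie_closed g \<Longrightarrow> S \<subseteq> g \<Longrightarrow> mspan S \<subseteq> g"
proof
  fix A assume "lie_closed g" "S \<subseteq> g" and A: "A \<in> mspan S"
  from A show "A \<in> g"
    by induction (use \<open>lie_closed g\<close> \<open>S \<subseteq> g\<close> in \<open>auto simp: lie_closed_def\<close>)
qed

text \<open>
  The elements of \<open>nm\<close> are lowering: \<open>h0\<close> is a grading element of the Cartan subalgebra for which
  they have negative integral degree.
\<close>

definition triangular where
  "triangular g nm P C h0 \<longleftrightarrow> lie_closed g \<and> nm \<subseteq> g \<and> P \<subseteq> g \<and> fst ` C \<subseteq> g \<and>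
     g \<subseteq> mspan (nm \<union> P \<union> fst ` C) \<and> h0 \<in> mspan (fst ` C) \<and>
     (\<forall>f\<in>nm. \<exists>d::nat. d > 0 \<and> lie_bracket h0 f = (- of_nat d) \<cdot>\<^sub>m f)"

inductive_set lower_span :: "(complex mat, 'v) lie_rep \<Rightarrow> complex mat set \<Rightarrow> 'v \<Rightarrow> 'v set" for M nm x where
  word: "set w \<subseteq> nm \<Longrightarrow> foldr (act M) w x \<in> lower_span M nm x"
| add: "v \<in> lower_span M nm x \<Longrightarrow> w \<in> lower_span M nm x \<Longrightarrow> v \<oplus>\<^bsub>M\<^esub> w \<in> lower_span M nm x"
| smult: "v \<in> lower_span M nm x \<Longrightarrow> c \<odot>\<^bsub>M\<^esub> v \<in> lower_span M nm x"

context lie_module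
begin

lemma lower_span_closed:
  assumes "nm \<subseteq> g" "x \<in> carrier M" "v \<in> lower_span M nm x"
  shows "v \<in> carrier M"
  using assms(3) by induction (use assms word_closed in auto)

lemma lower_span_least:
  assumes x: "x \<in> S" and nm: "\<And>f v. f \<in> nm \<Longrightarrow> v \<in> S \<Longrightarrow> act M f v \<in> S"
    and add: "\<And>v w. v \<in> S \<Longrightarrow> w \<in> S \<Longrightarrow> v \<oplus> w \<in> S" and sm: "\<And>c v. v \<in> S \<Longrightarrow> c \<odot> v \<in> S"
  shows "lower_span M nm x \<subseteq> S"
proof
  fix v assume "v \<in> lower_span M nm x"
  then show "v \<in> S"
  proof induction
    case (word w)
    then show ?case by (induction w) (use x nm in auto)
  qed (use add sm in auto)
qed

lemma lower_span_act:
  assumes nm: "nm \<subseteq> g" and x: "x \<in> carrier M" and A: "A \<in> g"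
    and w: "\<And>w. set w \<subseteq> nm \<Longrightarrow> act M A (foldr (act M) w x) \<in> lower_span M nm x"
    and v: "v \<in> lower_span M nm x"
  shows "act M A v \<in> lower_span M nm x"
  using v
proof induction
  case (word u)
  then show ?case by (rule w)
next
  case (add v w)
  then show ?case using A lower_span_closed[OF nm x]
    by (simp add: act_add_right lower_span.add)
next
  case (smult v c)
  then show ?case using A lower_span_closed[OF nm x]
    by (simp add: act_smult_right lower_span.smult)
qed

lemma lower_span_lower:
  assumes nm: "nm \<subseteq> g" and x: "x \<in> carrier M" and f: "f \<in> nm" and v: "v \<in> lower_span M nm x"
  shows "act M f v \<in> lower_span M nm x"
proof (rule lower_span_act[OF nm x _ _ v])
  show "act M f (foldr (act M) w x) \<in> lower_span M nm x" if "set w \<subseteq> nm" for w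
    using lower_span.word[of "f # w" nm M x] that f by simp
qed (use nm f in auto)

lemma act_act_eq:
  assumes "A \<in> g" "B \<in> g" "v \<in> carrier M"
  shows "act M A (act M B v) = act M (lie_bracket A B) v \<oplus> act M B (act M A v)"
  using assms by (simp add: act_bracket act_closed) (simp add: a_minus_def M.a_assoc M.l_neg act_closed)

text \<open>
  This is the easy half of the theorem of Poincare, Birkhoff and Witt. Moving \<open>A\<close> past the first letter
  \<open>f\<close> of a word costs \<open>lie_bracket A f\<close>, which acts on a shorter word. The induction on the word
  therefore has to treat all \<open>A\<close> in \<open>g\<close> at once, and the decomposition of \<open>g\<close> enters only at the empty word.
\<close>

lemma lower_span_submodule:
  assumes tri: "triangular g nm P C h0" and hw: "hw_vector M P C x"
  shows "lie_submodule g M (lower_span M nm x)"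
proof -
  let ?L = "lower_span M nm x"
  have g: "lie_closed g" and nm: "nm \<subseteq> g" and P: "P \<subseteq> g" and C: "fst ` C \<subseteq> g"
    and span: "g \<subseteq> mspan (nm \<union> P \<union> fst ` C)"
    using tri by (auto simp: triangular_def)
  have x: "x \<in> carrier M" using hw by (simp add: hw_vector_def)
  have xL: "x \<in> ?L" using lower_span.word[of "[]" nm M x] by simp
  have zL: "\<zero> \<in> ?L" using lower_span.smult[OF xL, of 0] x by simp
  have base: "act M A x \<in> ?L" if "A \<in> g" for A
  proof -
    have "A \<in> mspan (nm \<union> P \<union> fst ` C)" using that span by blast
    then have "A \<in> g \<and> act M A x \<in> ?L"
    proof induction
      case (base A)
      then consider "A \<in> nm" | "A \<in> P" | c where "(A, c) \<in> C" by force
      then show ?case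
      proof cases
        case 1
        then show ?thesis using lower_span.word[of "[A]" nm M x] nm by auto
      next
        case 2
        then have "act M A x = \<zero>" using hw by (simp add: hw_vector_def)
        then show ?thesis using 2 P zL by auto
      next
        case 3
        then have "act M A x = c \<odot> x" using hw by (auto simp: hw_vector_def)
        moreover have "A \<in> g" using 3 C by force
        ultimately show ?thesis using lower_span.smult[OF xL] by simp
      qed
    next
      case (add A B)
      then show ?case using g x by (simp add: lie_closed_def act_add_left lower_span.add)
    next
      case (smult A c)
      then show ?case using g x by (simp add: lie_closed_def act_smult_left lower_span.smult)
    qed
    then show ?thesis ..
  qed
  have "act M A (foldr (act M) w x) \<in> ?L" if "set w \<subseteq> nm" "A \<in> g" for A w
    using that
  proof (induction w arbitrary: A)
    case Nil
    then show ?case using base by simp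
  next
    case (Cons f w)
    let ?u = "foldr (act M) w x"
    have f: "f \<in> nm" "f \<in> g" and w: "set w \<subseteq> nm" and u: "?u \<in> carrier M"
      using Cons nm x by (auto intro!: word_closed)
    have "act M A (act M f ?u) = act M (lie_bracket A f) ?u \<oplus> act M f (act M A ?u)"
      using Cons f u by (intro act_act_eq)
    moreover have "act M (lie_bracket A f) ?u \<in> ?L"
      using Cons f g w by (simp add: lie_closed_def)
    moreover have "act M f (act M A ?u) \<in> ?L"
      using Cons w f by (intro lower_span_lower[OF nm x f(1)]) simp
    ultimately show ?case by (simp add: lower_span.add)
  qed
  then show ?thesis unfolding lie_submodule_iff
    using lower_span_closed[OF nm x] zL lower_span_act[OF nm x]
    by (auto intro: lower_span.intros)
qed

lemma lower_span_eq_cyc: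
  assumes tri: "triangular g nm P C h0" and hw: "hw_vector M P C x"
  shows "lower_span M nm x = cyc x"
proof
  have x: "x \<in> carrier M" using hw by (simp add: hw_vector_def)
  have cyc: "lie_submodule g M (cyc x)" by (rule lie_submodule_cyc[OF x])
  have nm: "nm \<subseteq> g" using tri by (simp add: triangular_def)
  show "cyc x \<subseteq> lower_span M nm x"
    using lower_span.word[of "[]" nm M x] by (intro cyc_least lower_span_submodule[OF tri hw]) simp
  show "lower_span M nm x \<subseteq> cyc x"
    by (rule lower_span_least)
      (use cyc nm generator_in_cyc[OF x] in \<open>auto simp: lie_submodule_iff\<close>)
qed

text \<open>
  Words of positive length are eigenvectors of \<open>h0\<close> with an eigenvalue different from that of \<open>x\<close>. A
  vector is thus a multiple of \<open>x\<close> plus eigenvectors of lower weight; an operator that is a polynomial in \<open>h0\<close>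
  removes the latter. Hence a submodule with an element in which \<open>x\<close> occurs contains \<open>x\<close>, and all
  proper submodules lie in the common subspace \<open>U\<close> of the vectors in which \<open>x\<close> does not occur.
\<close>

lemma proper_submodules_bounded:
  assumes tri: "triangular g nm P C h0" and hw: "hw_vector M P C x" and x0: "x \<noteq> \<zero>"
    and gen: "\<And>W. lie_submodule g M W \<Longrightarrow> x \<in> W \<Longrightarrow> W = carrier M"
  obtains U where "U \<subseteq> carrier M" "x \<notin> U" "\<And>v w. v \<in> U \<Longrightarrow> w \<in> U \<Longrightarrow> v \<oplus> w \<in> U"
    "\<And>c v. v \<in> U \<Longrightarrow> c \<odot> v \<in> U"
    "\<And>W. lie_submodule g M W \<Longrightarrow> W \<noteq> carrier M \<Longrightarrow> W \<subseteq> U"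
proof -
  have g: "lie_closed g" and nm: "nm \<subseteq> g" and C: "fst ` C \<subseteq> g" and h0: "h0 \<in> mspan (fst ` C)"
    and br: "\<And>f. f \<in> nm \<Longrightarrow> \<exists>d::nat. d > 0 \<and> lie_bracket h0 f = (- of_nat d) \<cdot>\<^sub>m f"
    using tri by (auto simp: triangular_def)
  have h0g: "h0 \<in> g" using mspan_subset[OF g C] h0 by blast
  have x: "x \<in> carrier M" using hw by (simp add: hw_vector_def)
  have "h0 \<in> g \<and> (\<exists>lam. act M h0 x = lam \<odot> x)" using h0
  proof induction
    case (base A)
    then obtain c where c: "(A, c) \<in> C" by force
    then have "act M A x = c \<odot> x" using hw by (auto simp: hw_vector_def)
    moreover have "A \<in> g" using c C by force
    ultimately show ?case by blast
  next
    case (add A B)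
    then obtain l k where "act M A x = l \<odot> x" "act M B x = k \<odot> x" "A \<in> g" "B \<in> g" by blast
    then have "act M (A + B) x = (l + k) \<odot> x" "A + B \<in> g"
      using x g by (simp_all add: act_add_left smult_add_left lie_closed_def)
    then show ?case by blast
  next
    case (smult A c)
    then obtain l where "act M A x = l \<odot> x" "A \<in> g" by blast
    then have "act M (c \<cdot>\<^sub>m A) x = (c * l) \<odot> x" "c \<cdot>\<^sub>m A \<in> g"
      using x g by (simp_all add: act_smult_left smult_smult lie_closed_def)
    then show ?case by blast
  qed
  then obtain lam where lam: "act M h0 x = lam \<odot> x" by blast
  \<comment> \<open>The operator \<open>T k\<close> kills the eigenvectors of weight \<open>lam - k\<close>. In the product \<open>prj n\<close> of the first \<open>n\<close> of them new factors are put on the left, so that vectors killed by \<open>prj n\<close> stay killed for larger \<open>n\<close>.\<close>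
  define T where "T k v = act M h0 v \<oplus> (of_nat k - lam) \<odot> v" for k :: nat and v
  define prj where "prj = rec_nat (\<lambda>v. v) (\<lambda>n F v. T (Suc n) (F v))"
  have prj_simps: "prj 0 v = v" "prj (Suc n) v = T (Suc n) (prj n v)" for n v
    by (simp_all add: prj_def)
  have T_cl: "T k v \<in> carrier M" if "v \<in> carrier M" for k v
    using that h0g by (simp add: T_def act_closed)
  have T_add: "T k (v \<oplus> w) = T k v \<oplus> T k w" if "v \<in> carrier M" "w \<in> carrier M" for k v w
    using that h0g by (simp add: T_def act_closed act_add_right smult_add_right M.a_ac)
  have T_smult: "T k (c \<odot> v) = c \<odot> T k v" if "v \<in> carrier M" for k c v
    using that h0g by (simp add: T_def act_closed act_smult_right smult_add_right smult_smult mult.commute)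
  have T_eigen: "T k v = (of_nat k - of_nat j) \<odot> v"
    if "v \<in> carrier M" "act M h0 v = (lam - of_nat j) \<odot> v" for k j :: nat and v
    using that smult_add_left[of v "lam - of_nat j" "of_nat k - lam"] by (simp add: T_def)
  have T_zero: "T k \<zero> = \<zero>" for k
    using T_smult[of "\<zero>" k 0] T_cl[of "\<zero>" k] by simp
  have prj_cl: "prj n v \<in> carrier M" if "v \<in> carrier M" for n v
    using that by (induction n) (simp_all add: prj_simps T_cl)
  have prj_add: "prj n (v \<oplus> w) = prj n v \<oplus> prj n w" if "v \<in> carrier M" "w \<in> carrier M" for n v w
    using that by (induction n) (simp_all add: prj_simps T_add prj_cl)
  have prj_smult: "prj n (c \<odot> v) = c \<odot> prj n v" if "v \<in> carrier M" for n c v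
    using that by (induction n) (simp_all add: prj_simps T_smult prj_cl)
  have prj_mono: "prj n v = \<zero>" if "prj m v = \<zero>" "m \<le> n" for m n v
    using that(2,1) by (induction n rule: dec_induct) (simp_all add: prj_simps T_zero)
  have prj_eigen: "\<exists>c. prj n v = c \<odot> v \<and> (j = 0 \<longrightarrow> c \<noteq> 0) \<and> (0 < j \<and> j \<le> n \<longrightarrow> c = 0)"
    if v: "v \<in> carrier M" "act M h0 v = (lam - of_nat j) \<odot> v" for n j :: nat and v
  proof (induction n)
    case 0
    then show ?case using v by (intro exI[of _ 1]) (auto simp: prj_simps)
  next
    case (Suc n)
    then obtain c where c: "prj n v = c \<odot> v" "j = 0 \<longrightarrow> c \<noteq> 0" "0 < j \<and> j \<le> n \<longrightarrow> c = 0" by blast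
    have "prj (Suc n) v = (c * (of_nat (Suc n) - of_nat j)) \<odot> v"
      using c(1) v by (simp add: prj_simps T_smult T_eigen smult_smult del: of_nat_Suc)
    moreover have "j = 0 \<longrightarrow> c * (of_nat (Suc n) - of_nat j) \<noteq> 0"
      using c(2) by (simp del: of_nat_Suc)
    moreover have "0 < j \<and> j \<le> Suc n \<longrightarrow> c * (of_nat (Suc n) - of_nat j) = 0"
      using c(3) by (auto simp: le_Suc_eq)
    ultimately show ?case by blast
  qed
  define U where "U = {v \<in> carrier M. \<exists>n. prj n v = \<zero>}"
  have U_add: "v \<oplus> w \<in> U" if vw: "v \<in> U" "w \<in> U" for v w
  proof -
    obtain m n where "prj m v = \<zero>" "prj n w = \<zero>" using vw by (auto simp: U_def)
    then have "prj (max m n) v = \<zero>" "prj (max m n) w = \<zero>"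
      by (auto intro: prj_mono)
    then have "prj (max m n) (v \<oplus> w) = \<zero>" using vw by (simp add: prj_add U_def)
    then show ?thesis using vw by (auto simp: U_def)
  qed
  have U_smult: "c \<odot> v \<in> U" if v: "v \<in> U" for c v
  proof -
    obtain n where "prj n v = \<zero>" using v by (auto simp: U_def)
    then have "prj n (c \<odot> v) = \<zero>" using v by (simp add: prj_smult U_def)
    then show ?thesis using v by (auto simp: U_def)
  qed
  have prj_x: "\<exists>c. prj n x = c \<odot> x \<and> c \<noteq> 0" for n
    using prj_eigen[of x 0 n] x lam by auto
  have c0: "c = 0" if "c \<odot> x = \<zero>" for c
  proof (rule ccontr)
    assume "c \<noteq> 0"
    then have "x = inverse c \<odot> (c \<odot> x)" using x by (simp add: smult_smult)
    then show False using that x0 by simp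
  qed
  have xU: "x \<notin> U" using prj_x c0 by (auto simp: U_def) metis
  have word_eigen: "\<exists>j::nat. act M h0 (foldr (act M) w x) = (lam - of_nat j) \<odot> foldr (act M) w x \<and> (w \<noteq> [] \<longrightarrow> j > 0)"
    if "set w \<subseteq> nm" for w
    using that
  proof (induction w)
    case Nil
    then show ?case using lam by (intro exI[of _ 0]) simp
  next
    case (Cons f w)
    let ?u = "foldr (act M) w x"
    have f: "f \<in> nm" "f \<in> g" and u: "?u \<in> carrier M"
      using Cons nm x by (auto intro!: word_closed)
    obtain d :: nat where d: "d > 0" "lie_bracket h0 f = (- of_nat d) \<cdot>\<^sub>m f" using br[OF f(1)] by blast
    obtain j :: nat where j: "act M h0 ?u = (lam - of_nat j) \<odot> ?u" using Cons by auto
    have "act M h0 (act M f ?u) = (lam - of_nat (j + d)) \<odot> act M f ?u"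
      unfolding act_act_eq[OF h0g f(2) u] d(2) j
      using f u smult_add_left[of "act M f ?u" "- of_nat d" "lam - of_nat j"]
      by (simp add: act_smult_left act_smult_right act_closed algebra_simps)
    then show ?case using d(1) by (intro exI[of _ "j + d"]) simp
  qed
  have decomp: "\<exists>c. \<exists>u\<in>U. v = c \<odot> x \<oplus> u" if "v \<in> lower_span M nm x" for v
    using that
  proof induction
    case (word w)
    have cl: "foldr (act M) w x \<in> carrier M" using word nm x by (auto intro!: word_closed)
    have zU: "\<zero> \<in> U" using prj_simps(1) by (auto simp: U_def)
    show ?case
    proof (cases "w = []")
      case True
      then show ?thesis using zU x by (intro exI[of _ 1] bexI[of _ "\<zero>"]) simp_all
    next
      case False
      with word_eigen[OF word] obtain j :: nat where
        j: "act M h0 (foldr (act M) w x) = (lam - of_nat j) \<odot> foldr (act M) w x" "j > 0" by blast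
      have "prj j (foldr (act M) w x) = \<zero>"
        using prj_eigen[OF cl j(1), of j] j(2) cl by auto
      then have "foldr (act M) w x \<in> U" using cl by (auto simp: U_def)
      then show ?thesis using x cl by (intro exI[of _ 0] bexI[of _ "foldr (act M) w x"]) simp_all
    qed
  next
    case (add v w)
    then obtain c d u u' where "v = c \<odot> x \<oplus> u" "w = d \<odot> x \<oplus> u'" and u: "u \<in> U" "u' \<in> U"
      by blast
    then have "v \<oplus> w = (c + d) \<odot> x \<oplus> (u \<oplus> u')"
      using x by (simp add: smult_add_left U_def M.a_ac)
    then show ?case using U_add[OF u] by blast
  next
    case (smult v c)
    then obtain d u where "v = d \<odot> x \<oplus> u" and u: "u \<in> U" by blast
    then have "c \<odot> v = (c * d) \<odot> x \<oplus> c \<odot> u"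
      using x by (simp add: smult_add_right smult_smult U_def)
    then show ?case using U_smult[OF u] by blast
  qed
  have xL: "x \<in> lower_span M nm x" using lower_span.word[of "[]" nm M x] by simp
  have all: "lower_span M nm x = carrier M"
    by (rule gen[OF lower_span_submodule[OF tri hw] xL])
  have proper: "W \<subseteq> U" if W: "lie_submodule g M W" "W \<noteq> carrier M" for W
  proof
    fix w assume w: "w \<in> W"
    have Wst: "W \<subseteq> carrier M" "\<And>v w. v \<in> W \<Longrightarrow> w \<in> W \<Longrightarrow> v \<oplus> w \<in> W"
      "\<And>c v. v \<in> W \<Longrightarrow> c \<odot> v \<in> W" "\<And>A v. A \<in> g \<Longrightarrow> v \<in> W \<Longrightarrow> act M A v \<in> W"
      using W(1) unfolding lie_submodule_iff by auto
    have prj_W: "prj n v \<in> W" if "v \<in> W" for n v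
      using that by (induction n) (auto simp: prj_simps T_def intro!: Wst h0g)
    obtain c u where cu: "u \<in> U" "w = c \<odot> x \<oplus> u"
      using decomp[of w] w Wst(1) all by blast
    obtain n where n: "prj n u = \<zero>" "u \<in> carrier M" using cu by (auto simp: U_def)
    obtain d where d: "prj n x = d \<odot> x" "d \<noteq> 0" using prj_x by blast
    have "prj n w = (c * d) \<odot> x"
      using cu n d x by (simp add: prj_add prj_smult smult_smult)
    then have cd: "(c * d) \<odot> x \<in> W" using prj_W[OF w, of n] by simp
    have "c = 0"
    proof (rule ccontr)
      assume "c \<noteq> 0"
      then have "x = inverse (c * d) \<odot> ((c * d) \<odot> x)"
        using d(2) x by (simp add: smult_smult left_inverse[of "c * d"] del: inverse_mult_distrib)
      then have "x \<in> W" using Wst(3)[OF cd] by metis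
      then show False using gen[OF W(1)] W(2) by blast
    qed
    then show "w \<in> U" using cu n x by simp
  qed
  show ?thesis by (rule that[of U]) (use U_add U_smult xU proper in \<open>auto simp: U_def\<close>)
qed

text \<open>
  Two proper submodules lie in a common proper subspace and so cannot sum up to the whole module.
\<close>

lemma indecomposable_hw:
  assumes tri: "triangular g nm P C h0" and hw: "hw_vector M P C x" and x0: "x \<noteq> \<zero>"
    and gen: "\<And>W. lie_submodule g M W \<Longrightarrow> x \<in> W \<Longrightarrow> W = carrier M"
  shows "indecomposable_module g M"
proof -
  obtain U where U: "U \<subseteq> carrier M" "x \<notin> U" "\<And>v w. v \<in> U \<Longrightarrow> w \<in> U \<Longrightarrow> v \<oplus> w \<in> U"
    "\<And>W. lie_submodule g M W \<Longrightarrow> W \<noteq> carrier M \<Longrightarrow> W \<subseteq> U"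
    using proper_submodules_bounded[OF assms] by metis
  have x: "x \<in> carrier M" using hw by (simp add: hw_vector_def)
  show ?thesis unfolding indecomposable_module_def
  proof (intro conjI allI impI)
    show "lie_module g M" by (rule lie_module_axioms)
    show "carrier M \<noteq> {\<zero>}" using x x0 by blast
    fix W1 W2
    assume W: "lie_submodule g M W1 \<and> lie_submodule g M W2 \<and>
      W1 \<inter> W2 = {\<zero>} \<and> W1 <+> W2 = carrier M"
    show "W1 = {\<zero>} \<or> W2 = {\<zero>}"
    proof (rule ccontr)
      assume n: "\<not> ?thesis"
      have sub: "W1 \<subseteq> carrier M" "W2 \<subseteq> carrier M" using W by (auto simp: lie_submodule_iff)
      have "W1 \<noteq> carrier M" "W2 \<noteq> carrier M" using W n sub by auto
      then have "W1 \<subseteq> U" "W2 \<subseteq> U" using U(4) W by auto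
      moreover have "x \<in> (\<Union>h\<in>W1. \<Union>k\<in>W2. {h \<oplus> k})" using W x by (simp add: set_add_def')
      then obtain w1 w2 where "w1 \<in> W1" "w2 \<in> W2" "x = w1 \<oplus> w2" by blast
      ultimately show False using U(2,3) by blast
    qed
  qed
qed

end

text \<open>
  A proper submodule of the Verma module is mapped to zero in the simple module generated by \<open>x\<close>:
  otherwise its image would contain \<open>x\<close>, and then the generator of the Verma module would be the sum of an
  element of this submodule and an element of the kernel, while both lie in a subspace that misses
  the generator. So the radical is exactly the kernel.
\<close>

theorem simple_cyclic_iso_simple_hw:
  assumes tri: "triangular g nm P C h0" and M: "lie_module g M" and hw: "hw_vector M P C x"
    and simple: "simple_module g (cyclic_module g M x)"
  shows "lie_iso g (cyclic_module g M x) (simple_hw_module g P C)"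
proof -
  interpret M: lie_module g M by fact
  have g: "lie_closed g" and P: "P \<subseteq> g" and C: "fst ` C \<subseteq> g" using tri by (auto simp: triangular_def)
  have x: "x \<in> carrier M" using hw by (simp add: hw_vector_def)
  let ?V = "verma_module g P C" and ?Y = "cyclic_module g M x" and ?v = "verma_generator g P C"
  obtain h where h: "lie_hom g ?V ?Y h" "h ?v = x" "h ` carrier ?V = carrier ?Y"
    using verma_universal[OF g P C M hw] by blast
  interpret h: lie_hom g ?V ?Y h by fact
  have sub: "W = {\<zero>\<^bsub>?Y\<^esub>} \<or> W = carrier ?Y" if "lie_submodule g ?Y W" for W
    using simple that by (simp add: simple_module_def)
  have xY: "x \<in> carrier ?Y" using h(2) h.hom_closed[OF verma_generator_in[OF g P C]] by simp
  have Ycyc: "carrier ?Y = M.cyc x" "\<zero>\<^bsub>?Y\<^esub> = \<zero>\<^bsub>M\<^esub>" using M.cyclic_module_eq[OF g x] by simp_all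
  have x0: "x \<noteq> \<zero>\<^bsub>?Y\<^esub>"
  proof
    assume "x = \<zero>\<^bsub>?Y\<^esub>"
    then have "M.cyc x \<subseteq> {\<zero>\<^bsub>M\<^esub>}" using Ycyc by (intro M.cyc_least M.lie_submodule_zero) simp
    then show False using simple xY Ycyc by (auto simp: simple_module_def)
  qed
  have v0: "?v \<noteq> \<zero>\<^bsub>?V\<^esub>" using x0 h(2) h.hom_zero by metis
  obtain U where U: "U \<subseteq> carrier ?V" "?v \<notin> U" "\<And>v w. v \<in> U \<Longrightarrow> w \<in> U \<Longrightarrow> v \<oplus>\<^bsub>?V\<^esub> w \<in> U"
    "\<And>c v. v \<in> U \<Longrightarrow> c \<odot>\<^bsub>?V\<^esub> v \<in> U"
    "\<And>W. lie_submodule g ?V W \<Longrightarrow> W \<noteq> carrier ?V \<Longrightarrow> W \<subseteq> U"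
    using h.M.proper_submodules_bounded[OF tri verma_generator_hw[OF g P C] v0 verma_generated[OF g P C]]
    by metis
  have vV: "?v \<in> carrier ?V" by (rule verma_generator_in[OF g P C])
  have ker_proper: "h.ker \<noteq> carrier ?V" using vV x0 h(2) by (auto simp: h.ker_def)
  have kerU: "h.ker \<subseteq> U" by (rule U(5)[OF h.lie_submodule_ker ker_proper])
  have le: "W \<subseteq> h.ker" if W: "lie_submodule g ?V W" "W \<noteq> carrier ?V" for W
  proof -
    have WV: "W \<subseteq> carrier ?V" and WU: "W \<subseteq> U" using W U(5) by (auto simp: h.M.lie_submodule_iff)
    have "h ` W \<noteq> carrier ?Y"
    proof
      assume "h ` W = carrier ?Y"
      then obtain w where w: "w \<in> W" "h w = x" using xY by (metis imageE)
      have "?v \<ominus>\<^bsub>?V\<^esub> w \<in> h.ker"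
        using w vV WV xY h.hom_minus[OF vV, of w] h(2)
        by (auto simp: h.ker_def a_minus_def h.M'.M.r_neg)
      then have "w \<oplus>\<^bsub>?V\<^esub> (?v \<ominus>\<^bsub>?V\<^esub> w) \<in> U" using U(3) WU w kerU by blast
      moreover have "w \<oplus>\<^bsub>?V\<^esub> (?v \<ominus>\<^bsub>?V\<^esub> w) = ?v"
      proof -
        have wV: "w \<in> carrier ?V" using w(1) WV by blast
        have "w \<oplus>\<^bsub>?V\<^esub> (?v \<ominus>\<^bsub>?V\<^esub> w) = ?v \<oplus>\<^bsub>?V\<^esub> (w \<oplus>\<^bsub>?V\<^esub> \<ominus>\<^bsub>?V\<^esub> w)"
          using wV vV by (simp add: a_minus_def h.M.M.a_lcomm)
        then show ?thesis using wV vV by (simp add: h.M.M.r_neg)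
      qed
      ultimately show False using U(2) by simp
    qed
    then have "h ` W = {\<zero>\<^bsub>?Y\<^esub>}" using sub[OF h.lie_submodule_image[OF W(1)]] by blast
    then show ?thesis using WV by (auto simp: h.ker_def)
  qed
  have "radical g ?V = h.ker"
  proof
    show "radical g ?V \<subseteq> h.ker"
      unfolding radical_def by (rule h.M.generated_least[OF h.lie_submodule_ker]) (use le in blast)
    have "h.ker \<subseteq> \<Union>{W. lie_submodule g ?V W \<and> W \<noteq> carrier ?V}"
      using ker_proper h.lie_submodule_ker by blast
    then show "h.ker \<subseteq> radical g ?V"
      unfolding radical_def using h.M.generated_superset by blast
  qed
  then have "lie_iso g (simple_hw_module g P C) ?Y"
    unfolding simple_hw_module_def using h.first_isomorphism[OF g h(3)] by simp
  moreover have "lie_module g (simple_hw_module g P C)"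
    unfolding simple_hw_module_def \<open>radical g ?V = h.ker\<close>
    by (rule h.M.quotient_hom(1)[OF g h.lie_submodule_ker])
  ultimately show ?thesis by (rule lie_iso_sym[rotated])
qed

text \<open>
  A polynomial in \<open>X\<close> applied to \<open>x\<close>, given by its coefficient list and evaluated by the scheme of Horner;
  thus \<open>X\<close> acts by putting a zero in front of the list.
\<close>

primrec horner :: "(complex mat, 'v) lie_rep \<Rightarrow> complex mat \<Rightarrow> 'v \<Rightarrow> complex list \<Rightarrow> 'v" where
  "horner M X x [] = \<zero>\<^bsub>M\<^esub>"
| "horner M X x (c # cs) = c \<odot>\<^bsub>M\<^esub> x \<oplus>\<^bsub>M\<^esub> act M X (horner M X x cs)"

context lie_module
begin

lemma horner_closed: "X \<in> g \<Longrightarrow> x \<in> carrier M \<Longrightarrow> horner M X x cs \<in> carrier M"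
  by (induction cs) (auto simp: act_closed)

lemma horner_add:
  assumes "X \<in> g" "x \<in> carrier M"
  shows "\<exists>es. horner M X x cs \<oplus> horner M X x ds = horner M X x es"
proof (induction cs arbitrary: ds)
  case Nil
  then show ?case using assms by (intro exI[of _ ds]) (simp add: horner_closed)
next
  case (Cons c cs)
  show ?case
  proof (cases ds)
    case Nil
    then show ?thesis using assms horner_closed[OF assms, of "c # cs"] by (intro exI[of _ "c # cs"]) simp
  next
    case ds: (Cons d ds')
    obtain es where es: "horner M X x cs \<oplus> horner M X x ds' = horner M X x es" using Cons by blast
    have "horner M X x (c # cs) \<oplus> horner M X x ds = horner M X x ((c + d) # es)"
      unfolding ds horner.simps es[symmetric] using assms
      by (simp add: smult_add_left act_add_right horner_closed act_closed M.a_ac)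
    then show ?thesis by blast
  qed
qed

lemma horner_smult:
  assumes "X \<in> g" "x \<in> carrier M"
  shows "c \<odot> horner M X x cs = horner M X x (map ((*) c) cs)"
  using assms
  by (induction cs) (auto simp: smult_add_right smult_smult act_smult_right act_closed horner_closed
      simp flip: act_smult_right)

lemma lower_span_horner:
  assumes "X \<in> g" "x \<in> carrier M" "v \<in> lower_span M {X} x"
  shows "\<exists>cs. v = horner M X x cs"
proof -
  have "lower_span M {X} x \<subseteq> range (horner M X x)"
  proof (rule lower_span_least)
    show "x \<in> range (horner M X x)"
      using assms by (intro range_eqI[of _ _ "[1]"]) (simp add: act_zero)
    show "act M f v \<in> range (horner M X x)" if f: "f \<in> {X}" and v: "v \<in> range (horner M X x)" for f v
    proof -
      obtain cs where "v = horner M X x cs" using v by blast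
      then have "act M f v = horner M X x (0 # cs)" using f assms by (simp add: act_closed horner_closed)
      then show ?thesis by blast
    qed
  qed (use horner_add[OF assms(1,2)] horner_smult[OF assms(1,2)] in \<open>auto, metis rangeI\<close>)
  then show ?thesis using assms by blast
qed

end

text \<open>
  With one lowering element the Verma module is spanned by the powers of \<open>X\<close> applied to the generator.
  If the powers of \<open>X\<close> applied to \<open>x\<close> are independent, then nothing is lost on the way to the module
  generated by \<open>x\<close>.
\<close>

theorem cyclic_iso_verma_rank_one:
  assumes tri: "triangular g {X} P C h0" and M: "lie_module g M" and hw: "hw_vector M P C x"
    and indep: "\<And>cs. horner M X x cs = \<zero>\<^bsub>M\<^esub> \<Longrightarrow> set cs \<subseteq> {0}"
  shows "lie_iso g (cyclic_module g M x) (verma_module g P C)"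
proof -
  interpret M: lie_module g M by fact
  have g: "lie_closed g" and P: "P \<subseteq> g" and C: "fst ` C \<subseteq> g" and X: "X \<in> g"
    using tri by (auto simp: triangular_def)
  have x: "x \<in> carrier M" using hw by (simp add: hw_vector_def)
  let ?V = "verma_module g P C" and ?Y = "cyclic_module g M x" and ?v = "verma_generator g P C"
  obtain h where h: "lie_hom g ?V ?Y h" "h ?v = x" "h ` carrier ?V = carrier ?Y"
    using verma_universal[OF g P C M hw] by blast
  interpret h: lie_hom g ?V ?Y h by fact
  note Y = M.cyclic_module_eq[OF g x]
  have vV: "?v \<in> carrier ?V" by (rule verma_generator_in[OF g P C])
  have all: "lower_span ?V {X} ?v = carrier ?V"
    using lower_span.word[of "[]" "{X}" ?V ?v]
    by (intro verma_generated[OF g P C] h.M.lower_span_submodule[OF tri verma_generator_hw[OF g P C]]) simp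
  have hh: "h (horner ?V X ?v cs) = horner M X x cs" for cs
  proof (induction cs)
    case Nil
    then show ?case using h.hom_zero by (simp add: Y)
  next
    case (Cons c cs)
    then show ?case using X vV h(2)
      by (simp add: h.hom_add h.hom_smult h.hom_act h.M.horner_closed h.M.act_closed) (simp add: Y)
  qed
  have zero: "horner ?V X ?v cs = \<zero>\<^bsub>?V\<^esub>" if "set cs \<subseteq> {0}" for cs
    using that by (induction cs) (auto simp: vV X h.M.act_zero)
  have "h.ker \<subseteq> {\<zero>\<^bsub>?V\<^esub>}"
  proof
    fix v assume v: "v \<in> h.ker"
    then have "v \<in> lower_span ?V {X} ?v" unfolding all by (simp add: h.ker_def)
    from h.M.lower_span_horner[OF X vV this] obtain cs where cs: "v = horner ?V X ?v cs" by blast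
    have "\<zero>\<^bsub>?Y\<^esub> = \<zero>\<^bsub>M\<^esub>" by (simp add: Y)
    then have "horner M X x cs = \<zero>\<^bsub>M\<^esub>" using v hh[of cs] by (simp add: h.ker_def cs)
    then show "v \<in> {\<zero>\<^bsub>?V\<^esub>}" using zero[OF indep] cs by simp
  qed
  then have "bij_betw h (carrier ?V) (carrier ?Y)"
    using h.inj_on_if_ker_trivial h(3) by (simp add: bij_betw_def)
  then have "lie_iso g ?V ?Y" by (rule h.lie_iso_if_bij)
  then show ?thesis by (rule lie_iso_sym[OF lie_module_verma[OF g P C]])
qed

section \<open>The Weyl algebra action\<close>

lemma lookup_scale [simp]: "lk (scale c v) \<beta> = c * lk v \<beta>"
  by (simp add: scale_def map.rep_eq when_def)

interpretation cvs: vector_space scale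
  by unfold_locales (auto intro!: poly_mapping_eqI simp: lookup_add algebra_simps)

text \<open>
  On tuples of another length, adding a unit vector would change the length, and the operators
  \<open>q_i\<close>, \<open>p_j\<close> would not satisfy the relations of the Weyl algebra.
\<close>

definition supp :: "nat \<Rightarrow> (complex vec \<Rightarrow>\<^sub>0 complex) set" where
  "supp n = {v. Poly_Mapping.keys v \<subseteq> carrier_vec (2 * n)}"

lemma supp_iff: "v \<in> supp n \<longleftrightarrow> (\<forall>\<beta>. lk v \<beta> \<noteq> 0 \<longrightarrow> \<beta> \<in> carrier_vec (2 * n))"
  by (auto simp: supp_def in_keys_iff)

lemma subspace_supp: "cvs.subspace (supp n)"
proof (rule cvs.subspaceI)
  show "x + y \<in> supp n" if "x \<in> supp n" "y \<in> supp n" for x y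
    using that unfolding supp_iff by (metis add.right_neutral lookup_add)
qed (simp_all add: supp_iff)

lemmas supp_closed = cvs.subspace_add[OF subspace_supp] cvs.subspace_scale[OF subspace_supp]
  cvs.subspace_diff[OF subspace_supp] cvs.subspace_0[OF subspace_supp]

lemma lookup_lin_ext:
  assumes "finite K" "Poly_Mapping.keys v \<subseteq> K"
  shows "lk (lin_ext f v) \<beta> =
    (\<Sum>\<alpha>\<in>K. lk v \<alpha> * lk (f \<alpha>) \<beta>)"
  unfolding lin_ext_def using assms
  by (simp add: lookup_sum) (rule sum.mono_neutral_left, auto simp: in_keys_iff)

lemma lin_ext_add: "lin_ext f (v + w) = lin_ext f v + lin_ext f w"
proof (rule poly_mapping_eqI)
  fix \<beta>
  let ?K = "Poly_Mapping.keys v \<union> Poly_Mapping.keys w"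
  have "finite ?K" by simp
  then show "lk (lin_ext f (v + w)) \<beta> = lk (lin_ext f v + lin_ext f w) \<beta>"
    using keys_add[of v w]
    by (simp add: lookup_add lookup_lin_ext[of ?K] sum.distrib[symmetric] algebra_simps)
qed

lemma lin_ext_scale: "lin_ext f (scale c v) = scale c (lin_ext f v)"
proof (rule poly_mapping_eqI)
  fix \<beta>
  have "Poly_Mapping.keys (scale c v) \<subseteq> Poly_Mapping.keys v" by (auto simp: in_keys_iff)
  then show "lk (lin_ext f (scale c v)) \<beta> = lk (scale c (lin_ext f v)) \<beta>"
    by (simp add: lookup_lin_ext[of "Poly_Mapping.keys v"] sum_distrib_left algebra_simps)
qed

text \<open>
  The scalars in the definitions of \<open>q_i\<close> and \<open>p_j\<close>.
\<close>

definition qc :: "complex \<Rightarrow> complex" where "qc z = (if neg_integer z then z + 1 else 1)"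
definition pc :: "complex \<Rightarrow> complex" where "pc z = (if neg_integer z then 1 else z)"

lemma q_op_eq: "q_op n i = lin_ext (\<lambda>\<beta>. scale (qc (\<beta> $ i)) (basis_elt (\<beta> + unit_vec (2 * n) i)))"
  unfolding q_op_def by (rule arg_cong[of _ _ lin_ext]) (auto simp: qc_def fun_eq_iff)

lemma p_op_eq: "p_op n i = lin_ext (\<lambda>\<beta>. scale (pc (\<beta> $ i)) (basis_elt (\<beta> - unit_vec (2 * n) i)))"
  unfolding p_op_def by (rule arg_cong[of _ _ lin_ext]) (auto simp: pc_def fun_eq_iff)

lemma lookup_shift:
  assumes v: "v \<in> supp n" and inv: "\<And>\<alpha>. \<alpha> \<in> carrier_vec (2 * n) \<Longrightarrow> T \<alpha> = \<beta> \<longleftrightarrow> \<alpha> = \<gamma>"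
  shows "lk (lin_ext (\<lambda>\<alpha>. scale (k \<alpha>) (basis_elt (T \<alpha>))) v) \<beta> =
    k \<gamma> * lk v \<gamma>"
proof -
  have "lk (lin_ext (\<lambda>\<alpha>. scale (k \<alpha>) (basis_elt (T \<alpha>))) v) \<beta> =
      (\<Sum>\<alpha>\<in>Poly_Mapping.keys v. lk v \<alpha> * (k \<alpha> * (1 when T \<alpha> = \<beta>)))"
    by (simp add: lookup_lin_ext[OF finite_keys order_refl] basis_elt_def lookup_single)
  also have "\<dots> = (\<Sum>\<alpha>\<in>Poly_Mapping.keys v. if \<alpha> = \<gamma> then k \<gamma> * lk v \<gamma> else 0)"
    using v inv by (intro sum.cong refl) (auto simp: supp_def when_def subset_iff)
  also have "\<dots> = k \<gamma> * lk v \<gamma>"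
    by (simp add: in_keys_iff)
  finally show ?thesis .
qed

lemma lookup_q_op:
  assumes "v \<in> supp n" "i < 2 * n" "\<beta> \<in> carrier_vec (2 * n)"
  shows "lk (q_op n i v) \<beta> =
    qc (\<beta> $ i - 1) * lk v (\<beta> - unit_vec (2 * n) i)"
proof -
  have "\<alpha> + unit_vec (2 * n) i = \<beta> \<longleftrightarrow> \<alpha> = \<beta> - unit_vec (2 * n) i"
    if "\<alpha> \<in> carrier_vec (2 * n)" for \<alpha>
    using that assms by (auto simp: vec_eq_iff) (metis add_diff_cancel_right')
  from lookup_shift[OF assms(1) this, where k = "\<lambda>\<beta>. qc (\<beta> $ i)"] show ?thesis
    using assms by (simp add: q_op_eq)
qed

lemma lookup_p_op:
  assumes "v \<in> supp n" "i < 2 * n" "\<beta> \<in> carrier_vec (2 * n)"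
  shows "lk (p_op n i v) \<beta> =
    pc (\<beta> $ i + 1) * lk v (\<beta> + unit_vec (2 * n) i)"
proof -
  have "\<alpha> - unit_vec (2 * n) i = \<beta> \<longleftrightarrow> \<alpha> = \<beta> + unit_vec (2 * n) i"
    if "\<alpha> \<in> carrier_vec (2 * n)" for \<alpha>
    using that assms by (auto simp: vec_eq_iff) (metis diff_add_cancel)
  from lookup_shift[OF assms(1) this, where k = "\<lambda>\<beta>. pc (\<beta> $ i)"] show ?thesis
    using assms by (simp add: p_op_eq)
qed

lemma lin_ext_supp:
  assumes "v \<in> supp n" "\<And>\<alpha>. \<alpha> \<in> carrier_vec (2 * n) \<Longrightarrow> f \<alpha> \<in> supp n"
  shows "lin_ext f v \<in> supp n"
  unfolding lin_ext_def using assms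
  by (intro cvs.subspace_sum[OF subspace_supp] cvs.subspace_scale[OF subspace_supp])
    (auto simp: supp_def)

lemma basis_elt_supp: "\<beta> \<in> carrier_vec (2 * n) \<Longrightarrow> basis_elt \<beta> \<in> supp n"
  by (simp add: supp_def basis_elt_def)

lemma q_op_supp: "v \<in> supp n \<Longrightarrow> q_op n i v \<in> supp n"
  and p_op_supp: "v \<in> supp n \<Longrightarrow> p_op n i v \<in> supp n"
  unfolding q_op_eq p_op_eq
  by (auto intro!: lin_ext_supp cvs.subspace_scale[OF subspace_supp] basis_elt_supp)

lemma supp_eqI:
  assumes "v \<in> supp n" "w \<in> supp n"
    and "\<And>\<beta>. \<beta> \<in> carrier_vec (2 * n) \<Longrightarrow> lk v \<beta> = lk w \<beta>"
  shows "v = w"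
  using assms unfolding supp_iff by (intro poly_mapping_eqI) metis

lemma q_op_linear: "q_op n i (v + w) = q_op n i v + q_op n i w" "q_op n i (scale c v) = scale c (q_op n i v)"
  and p_op_linear: "p_op n i (v + w) = p_op n i v + p_op n i w" "p_op n i (scale c v) = scale c (p_op n i v)"
  by (simp_all add: q_op_eq p_op_eq lin_ext_add lin_ext_scale)

lemma neg_integer_shift:
  "neg_integer (z + 1) \<Longrightarrow> neg_integer z" "neg_integer z \<Longrightarrow> neg_integer (z - 1)"
  "neg_integer z \<Longrightarrow> \<not> neg_integer (z + 1) \<Longrightarrow> z = -1"
  "\<not> neg_integer z \<Longrightarrow> neg_integer (z - 1) \<Longrightarrow> z = 0"
proof -
  have iff: "neg_integer z \<longleftrightarrow> (\<exists>k::int. z = of_int k \<and> k < 0)" for z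
    by (auto simp: neg_integer_def elim!: Ints_cases)
  show "neg_integer z" if neg: "neg_integer (z + 1)"
  proof -
    obtain k :: int where "z + 1 = of_int k" "k < 0" using neg unfolding iff by blast
    then have "z = of_int (k - 1)" "k - 1 < 0" by (simp_all add: eq_diff_eq)
    then show ?thesis unfolding iff by blast
  qed
  show "neg_integer (z - 1)" if neg: "neg_integer z"
  proof -
    obtain k :: int where "z = of_int k" "k < 0" using neg unfolding iff by blast
    then have "z - 1 = of_int (k - 1)" "k - 1 < 0" by simp_all
    then show ?thesis unfolding iff by blast
  qed
  show "neg_integer z \<Longrightarrow> \<not> neg_integer (z + 1) \<Longrightarrow> z = -1"
  proof -
    assume "neg_integer z" "\<not> neg_integer (z + 1)"
    then obtain k :: int where "z = of_int k" "k < 0" "\<not> k + 1 < 0" unfolding iff by (metis of_int_1 of_int_add)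
    then have "k = -1" by simp
    then show ?thesis using \<open>z = of_int k\<close> by simp
  qed
  show "\<not> neg_integer z \<Longrightarrow> neg_integer (z - 1) \<Longrightarrow> z = 0"
  proof -
    assume "\<not> neg_integer z" "neg_integer (z - 1)"
    then obtain k :: int where k: "z - 1 = of_int k" "k < 0" unfolding iff by blast
    then have z: "z = of_int (k + 1)" by (simp add: algebra_simps)
    then have "\<not> k + 1 < 0" using \<open>\<not> neg_integer z\<close> unfolding iff by blast
    then have "k + 1 = 0" using k by simp
    then show ?thesis using z by simp
  qed
qed

text \<open>
  Neighbouring entries fall under the same convention for the scalars except at the step between \<open>-1\<close> and \<open>0\<close>, and there
  the products are zero.
\<close>

lemma qc_pc: "qc (z - 1) * pc z = z" "pc (z + 1) * qc z = z + 1"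
  using neg_integer_shift[of z] neg_integer_shift[of "z + 1"] neg_integer_shift[of "z - 1"]
  by (auto simp: qc_def pc_def)

lemma p_q_commute:
  assumes v: "v \<in> supp n" and ij: "i < 2 * n" "j < 2 * n"
  shows "p_op n j (q_op n i v) = q_op n i (p_op n j v) + (if i = j then v else 0)"
proof (rule supp_eqI[of _ n])
  fix \<beta> :: "complex vec" assume \<beta>: "\<beta> \<in> carrier_vec (2 * n)"
  note [simp] = lookup_q_op lookup_p_op q_op_supp p_op_supp lookup_add
  show "lk (p_op n j (q_op n i v)) \<beta> =
      lk (q_op n i (p_op n j v) + (if i = j then v else 0)) \<beta>"
  proof (cases "i = j")
    case True
    have "\<beta> + unit_vec (2 * n) i - unit_vec (2 * n) i = \<beta>" "\<beta> - unit_vec (2 * n) i + unit_vec (2 * n) i = \<beta>"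
      using \<beta> by (auto simp: vec_eq_iff)
    then show ?thesis using True \<beta> v ij qc_pc[of "\<beta> $ i"]
      by (simp add: algebra_simps)
  next
    case False
    have "\<beta> + unit_vec (2 * n) j - unit_vec (2 * n) i = \<beta> - unit_vec (2 * n) i + unit_vec (2 * n) j"
      using \<beta> by (auto simp: vec_eq_iff)
    then show ?thesis using False \<beta> v ij by simp
  qed
qed (use v in \<open>auto intro!: supp_closed p_op_supp q_op_supp\<close>)

lemma q_q_commute:
  assumes v: "v \<in> supp n" and ij: "i < 2 * n" "j < 2 * n"
  shows "q_op n i (q_op n j v) = q_op n j (q_op n i v)"
proof (rule supp_eqI[of _ n])
  fix \<beta> :: "complex vec" assume \<beta>: "\<beta> \<in> carrier_vec (2 * n)"
  have "\<beta> - unit_vec (2 * n) j - unit_vec (2 * n) i = \<beta> - unit_vec (2 * n) i - unit_vec (2 * n) j"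
    using \<beta> by (auto simp: vec_eq_iff)
  then show "lk (q_op n i (q_op n j v)) \<beta> = lk (q_op n j (q_op n i v)) \<beta>"
    using \<beta> v ij by (cases "i = j") (simp_all add: lookup_q_op q_op_supp)
qed (use v in \<open>auto intro!: q_op_supp\<close>)

lemma p_p_commute:
  assumes v: "v \<in> supp n" and ij: "i < 2 * n" "j < 2 * n"
  shows "p_op n i (p_op n j v) = p_op n j (p_op n i v)"
proof (rule supp_eqI[of _ n])
  fix \<beta> :: "complex vec" assume \<beta>: "\<beta> \<in> carrier_vec (2 * n)"
  have "\<beta> + unit_vec (2 * n) j + unit_vec (2 * n) i = \<beta> + unit_vec (2 * n) i + unit_vec (2 * n) j"
    using \<beta> by (auto simp: vec_eq_iff)
  then show "lk (p_op n i (p_op n j v)) \<beta> = lk (p_op n j (p_op n i v)) \<beta>"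
    using \<beta> v ij by (cases "i = j") (simp_all add: lookup_p_op p_op_supp)
qed (use v in \<open>auto intro!: p_op_supp\<close>)

text \<open>
  The action of an elementary matrix of size \<open>2n\<close>.
\<close>

definition eop :: "nat \<Rightarrow> nat \<Rightarrow> nat \<Rightarrow> (complex vec \<Rightarrow>\<^sub>0 complex) \<Rightarrow> (complex vec \<Rightarrow>\<^sub>0 complex)" where
  "eop n i j v = q_op n i (p_op n j v)"

lemma eop_linear: "eop n i j (v + w) = eop n i j v + eop n i j w" "eop n i j (scale c v) = scale c (eop n i j v)"
  by (simp_all add: eop_def q_op_linear p_op_linear)

lemma eop_sum: "eop n i j (sum f A) = (\<Sum>a\<in>A. eop n i j (f a))"
proof -
  have "eop n i j 0 = 0" using eop_linear(2)[of n i j 0 0] by simp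
  then show ?thesis by (induction A rule: infinite_finite_induct) (simp_all add: eop_linear)
qed

lemma eop_supp: "v \<in> supp n \<Longrightarrow> eop n i j v \<in> supp n"
  by (simp add: eop_def q_op_supp p_op_supp)

lemma lookup_eop:
  assumes "v \<in> supp n" "i < 2 * n" "j < 2 * n" "\<beta> \<in> carrier_vec (2 * n)" "i \<noteq> j"
  shows "lk (eop n i j v) \<beta> = qc (\<beta> $ i - 1) * pc (\<beta> $ j + 1) *
    lk v (\<beta> - unit_vec (2 * n) i + unit_vec (2 * n) j)"
  using assms by (simp add: eop_def lookup_q_op lookup_p_op p_op_supp)

lemma lookup_eop_same:
  assumes "v \<in> supp n" "i < 2 * n" "\<beta> \<in> carrier_vec (2 * n)"
  shows "lk (eop n i i v) \<beta> = \<beta> $ i * lk v \<beta>"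
proof -
  have "\<beta> - unit_vec (2 * n) i + unit_vec (2 * n) i = \<beta>"
    using assms by (auto simp: vec_eq_iff)
  then show ?thesis
    using assms qc_pc(1)[of "\<beta> $ i"]
    by (simp add: eop_def lookup_q_op lookup_p_op p_op_supp)
qed

lemma eop_commutator:
  assumes v: "v \<in> supp n" and "i < 2 * n" "j < 2 * n" "k < 2 * n" "l < 2 * n"
  shows "eop n i j (eop n k l v) - eop n k l (eop n i j v) =
    (if j = k then eop n i l v else 0) - (if l = i then eop n k j v else 0)"
proof -
  have q0: "q_op n i 0 = 0" for i using q_op_linear(2)[of n i 0 0] by simp
  have "eop n i j (eop n k l v) = q_op n i (q_op n k (p_op n j (p_op n l v))) + (if j = k then eop n i l v else 0)"
    using assms by (auto simp: eop_def p_q_commute p_op_supp q_op_linear q0)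
  moreover have "eop n k l (eop n i j v) = q_op n k (q_op n i (p_op n l (p_op n j v))) + (if l = i then eop n k j v else 0)"
    using assms by (auto simp: eop_def p_q_commute p_op_supp q_op_linear q0)
  moreover have "q_op n i (q_op n k (p_op n j (p_op n l v))) = q_op n k (q_op n i (p_op n l (p_op n j v)))"
    using assms by (simp add: p_p_commute[of v n j l] q_q_commute p_op_supp)
  ultimately show ?thesis by simp
qed

section \<open>The module N\<close>

lemma N_simps [simp]:
  "\<zero>\<^bsub>N_mod n a1 a2\<^esub> = 0" "v \<oplus>\<^bsub>N_mod n a1 a2\<^esub> w = v + w" "c \<odot>\<^bsub>N_mod n a1 a2\<^esub> v = scale c v"
  by (simp_all add: N_mod_def)

lemma N_act: "act (N_mod n a1 a2) A v = (\<Sum>i<2 * n. \<Sum>j<2 * n. scale (A $$ (i, j)) (eop n i j v))"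
  by (simp add: N_mod_def eop_def)

lemma N_carrier: "v \<in> carrier (N_mod n a1 a2) \<longleftrightarrow>
    (\<forall>\<beta>. lk v \<beta> \<noteq> 0 \<longrightarrow> admissible n a1 a2 \<beta>)"
  by (auto simp: N_mod_def in_keys_iff)

lemma N_supp: "carrier (N_mod n a1 a2) \<subseteq> supp n"
  by (auto simp: N_carrier supp_iff admissible_def)

lemma N_subspace: "cvs.subspace (carrier (N_mod n a1 a2))"
proof (rule cvs.subspaceI)
  show "x + y \<in> carrier (N_mod n a1 a2)" if "x \<in> carrier (N_mod n a1 a2)" "y \<in> carrier (N_mod n a1 a2)" for x y
    using that unfolding N_carrier by (metis add.right_neutral lookup_add)
qed (simp_all add: N_carrier)

lemma Ints_Re_neg: "z \<in> \<int> \<Longrightarrow> Re (z - 1) < 0 \<Longrightarrow> \<not> Re z < 0 \<Longrightarrow> z = 0"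
  by (elim Ints_cases) auto

lemma Ints_Re_nonneg: "z \<in> \<int> \<Longrightarrow> Re (z + 1) \<ge> 0 \<Longrightarrow> \<not> Re z \<ge> 0 \<Longrightarrow> z = -1"
proof (elim Ints_cases)
  fix k :: int assume "Re (z + 1) \<ge> 0" "\<not> Re z \<ge> 0" and z: "z = of_int k"
  then have "real_of_int (k + 1) \<ge> 0" "\<not> real_of_int k \<ge> 0" by auto
  then have "k = -1" by linarith
  then show "z = -1" using z by simp
qed

text \<open>
  An entry can leave the negative integers only from \<open>-1\<close>, and it can leave the non-negative ones only
  from \<open>0\<close>; in both cases the scalar in \<open>q_i\<close> or \<open>p_j\<close> is zero.
\<close>

lemma eop_N:
  assumes v: "v \<in> carrier (N_mod n a1 a2)" and ij: "i < 2 * n" "j < 2 * n"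
  shows "eop n i j v \<in> carrier (N_mod n a1 a2)"
  unfolding N_carrier
proof (intro allI impI)
  fix \<beta> assume nz: "lk (eop n i j v) \<beta> \<noteq> 0"
  have vs: "v \<in> supp n" using v N_supp by blast
  have \<beta>: "\<beta> \<in> carrier_vec (2 * n)" using nz eop_supp[OF vs] unfolding supp_iff by blast
  show "admissible n a1 a2 \<beta>"
  proof (cases "i = j")
    case True
    then show ?thesis using nz lookup_eop_same[OF vs ij(1) \<beta>] v by (auto simp: N_carrier)
  next
    case False
    define \<gamma> where "\<gamma> = \<beta> - unit_vec (2 * n) i + unit_vec (2 * n) j"
    have \<gamma>: "admissible n a1 a2 \<gamma>" and q: "qc (\<beta> $ i - 1) \<noteq> 0" and p: "pc (\<beta> $ j + 1) \<noteq> 0"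
      using nz lookup_eop[OF vs ij \<beta> False] v by (auto simp: N_carrier \<gamma>_def)
    have \<gamma>k: "\<gamma> $ k = \<beta> $ k - (if k = i then 1 else 0) + (if k = j then 1 else 0)" if "k < 2 * n" for k
      using that \<beta> ij by (auto simp: \<gamma>_def)
    have int: "\<beta> $ k - tuple n a1 a2 $ k \<in> \<int>" if "k < 2 * n" for k
    proof -
      have "\<beta> $ k - tuple n a1 a2 $ k = (\<gamma> $ k - tuple n a1 a2 $ k) + (if k = i then 1 else 0) - (if k = j then 1 else 0)"
        using \<gamma>k[OF that] by simp
      also have "\<dots> \<in> \<int>" using \<gamma> that by (auto simp: admissible_def)
      finally show ?thesis .
    qed
    have int': "\<beta> $ k \<in> \<int>" if "k < n - 1 \<or> k \<in> {n + 1..<2 * n}" for k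
    proof -
      have k: "k < 2 * n" using that by auto
      then have "tuple n a1 a2 $ k \<in> \<int>" using that by (auto simp: tuple_def)
      then show ?thesis using int[OF k] Ints_add by fastforce
    qed
    show ?thesis unfolding admissible_def
    proof (intro conjI allI impI ballI \<beta> int)
      fix k assume k: "k < n - 1"
      then have neg: "Re (\<gamma> $ k) < 0" and k2: "k < 2 * n" using \<gamma> by (auto simp: admissible_def)
      show "Re (\<beta> $ k) < 0"
      proof (cases "k = i")
        case True
        show ?thesis
        proof (rule ccontr)
          assume "\<not> Re (\<beta> $ k) < 0"
          then have "\<beta> $ k = 0" using Ints_Re_neg[of "\<beta> $ k"] int'[of k] k neg \<gamma>k[OF k2] True False by auto
          then show False using q True by (simp add: qc_def neg_integer_def)
        qed
      qed (use neg \<gamma>k[OF k2] in \<open>auto split: if_splits\<close>)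
    next
      fix k assume k: "k \<in> {n + 1..<2 * n}"
      then have pos: "Re (\<gamma> $ k) \<ge> 0" and k2: "k < 2 * n" using \<gamma> by (auto simp: admissible_def)
      show "Re (\<beta> $ k) \<ge> 0"
      proof (cases "k = j")
        case True
        show ?thesis
        proof (rule ccontr)
          assume "\<not> Re (\<beta> $ k) \<ge> 0"
          then have "\<beta> $ k = -1" using Ints_Re_nonneg[of "\<beta> $ k"] int'[of k] k pos \<gamma>k[OF k2] True False by auto
          then show False using p True by (simp add: pc_def neg_integer_def)
        qed
      qed (use pos \<gamma>k[OF k2] in \<open>auto split: if_splits\<close>)
    next
      have "(\<Sum>k<2 * n. \<gamma> $ k) = (\<Sum>k<2 * n. \<beta> $ k)"
        using ij by (simp add: \<gamma>k sum.distrib sum_subtractf)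
      then show "(\<Sum>k<2 * n. \<beta> $ k) = (\<Sum>k<2 * n. tuple n a1 a2 $ k)"
        using \<gamma> by (simp add: admissible_def)
    qed
  qed
qed

lemma N_act_closed:
  assumes "v \<in> carrier (N_mod n a1 a2)"
  shows "act (N_mod n a1 a2) A v \<in> carrier (N_mod n a1 a2)"
  unfolding N_act using assms
  by (intro cvs.subspace_sum[OF N_subspace] cvs.subspace_scale[OF N_subspace] eop_N) auto

lemma N_act_bracket:
  assumes A: "A \<in> carrier_mat (2 * n) (2 * n)" and B: "B \<in> carrier_mat (2 * n) (2 * n)"
    and v: "v \<in> supp n"
  shows "act (N_mod n a1 a2) (lie_bracket A B) v =
    act (N_mod n a1 a2) A (act (N_mod n a1 a2) B v) - act (N_mod n a1 a2) B (act (N_mod n a1 a2) A v)"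
proof (rule poly_mapping_eqI)
  fix \<beta>
  let ?I = "{..<2 * n}" and ?L = "\<lambda>v :: complex vec \<Rightarrow>\<^sub>0 complex. lk v \<beta>"
  define a where "a i j = A $$ (i, j)" for i j
  define b where "b i j = B $$ (i, j)" for i j
  define e where "e i j = ?L (eop n i j v)" for i j
  define f where "f i j k l = ?L (eop n i j (eop n k l v))" for i j k l
  have comm: "f i j k l - f k l i j = (if j = k then e i l else 0) - (if l = i then e k j else 0)"
    if "i < 2 * n" "j < 2 * n" "k < 2 * n" "l < 2 * n" for i j k l
    using arg_cong[OF eop_commutator[OF v that], of ?L] by (auto simp: lookup_minus e_def f_def)
  have AB: "lie_bracket A B $$ (i, j) = (\<Sum>k<2 * n. a i k * b k j) - (\<Sum>k<2 * n. b i k * a k j)"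
    if "i < 2 * n" "j < 2 * n" for i j
    using that A B by (simp add: lie_bracket_def scalar_prod_def a_def b_def lessThan_atLeast0)
  have 1: "?L (act (N_mod n a1 a2) A (act (N_mod n a1 a2) B v)) =
      (\<Sum>i\<in>?I. \<Sum>j\<in>?I. \<Sum>k\<in>?I. \<Sum>l\<in>?I. a i j * b k l * f i j k l)"
    by (simp add: N_act lookup_sum eop_sum eop_linear sum_distrib_left a_def b_def f_def mult.assoc)
  have 2: "?L (act (N_mod n a1 a2) B (act (N_mod n a1 a2) A v)) =
      (\<Sum>k\<in>?I. \<Sum>l\<in>?I. \<Sum>i\<in>?I. \<Sum>j\<in>?I. b k l * a i j * f k l i j)"
    by (simp add: N_act lookup_sum eop_sum eop_linear sum_distrib_left a_def b_def f_def mult.assoc)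
  also have "\<dots> = (\<Sum>i\<in>?I. \<Sum>j\<in>?I. \<Sum>k\<in>?I. \<Sum>l\<in>?I. a i j * b k l * f k l i j)"
  proof -
    have swap: "(\<Sum>k\<in>?I. \<Sum>l\<in>?I. \<Sum>i\<in>?I. \<Sum>j\<in>?I. F i j k l) = (\<Sum>i\<in>?I. \<Sum>j\<in>?I. \<Sum>k\<in>?I. \<Sum>l\<in>?I. F i j k l)"
      for F :: "nat \<Rightarrow> nat \<Rightarrow> nat \<Rightarrow> nat \<Rightarrow> complex"
    proof -
      have "(\<Sum>k\<in>?I. \<Sum>l\<in>?I. \<Sum>i\<in>?I. \<Sum>j\<in>?I. F i j k l) = (\<Sum>k\<in>?I. \<Sum>i\<in>?I. \<Sum>l\<in>?I. \<Sum>j\<in>?I. F i j k l)"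
        by (intro sum.cong refl sum.swap)
      also have "\<dots> = (\<Sum>i\<in>?I. \<Sum>k\<in>?I. \<Sum>l\<in>?I. \<Sum>j\<in>?I. F i j k l)" by (rule sum.swap)
      also have "\<dots> = (\<Sum>i\<in>?I. \<Sum>k\<in>?I. \<Sum>j\<in>?I. \<Sum>l\<in>?I. F i j k l)"
        by (intro sum.cong refl sum.swap)
      also have "\<dots> = (\<Sum>i\<in>?I. \<Sum>j\<in>?I. \<Sum>k\<in>?I. \<Sum>l\<in>?I. F i j k l)"
        by (intro sum.cong refl sum.swap)
      finally show ?thesis .
    qed
    show ?thesis by (subst swap) (simp add: mult.commute)
  qed
  finally have 2: "?L (act (N_mod n a1 a2) B (act (N_mod n a1 a2) A v)) = \<dots>" .
  have "?L (act (N_mod n a1 a2) A (act (N_mod n a1 a2) B v)) - ?L (act (N_mod n a1 a2) B (act (N_mod n a1 a2) A v)) =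
     (\<Sum>i\<in>?I. \<Sum>j\<in>?I. \<Sum>k\<in>?I. \<Sum>l\<in>?I. a i j * b k l * (f i j k l - f k l i j))"
    unfolding 1 2 by (simp add: sum_subtractf right_diff_distrib)
  also have "\<dots> = (\<Sum>i\<in>?I. \<Sum>j\<in>?I. \<Sum>k\<in>?I. \<Sum>l\<in>?I.
      (if j = k then a i j * b k l * e i l else 0) - (if l = i then a i j * b k l * e k j else 0))"
    by (intro sum.cong refl) (auto simp: comm algebra_simps)
  also have "\<dots> = (\<Sum>i\<in>?I. \<Sum>j\<in>?I. \<Sum>l\<in>?I. a i j * b j l * e i l) -
      (\<Sum>i\<in>?I. \<Sum>j\<in>?I. \<Sum>k\<in>?I. a i j * b k i * e k j)"
  proof -
    have "(\<Sum>k\<in>?I. \<Sum>l\<in>?I. if j = k then a i j * b k l * e i l else 0) = (\<Sum>l\<in>?I. a i j * b j l * e i l)"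
      if "j \<in> ?I" for i j
      using that by (subst sum.swap) simp
    moreover have "(\<Sum>k\<in>?I. \<Sum>l\<in>?I. if l = i then a i j * b k l * e k j else 0) = (\<Sum>k\<in>?I. a i j * b k i * e k j)"
      if "i \<in> ?I" for i j
      using that by simp
    ultimately show ?thesis by (simp add: sum_subtractf)
  qed
  also have "(\<Sum>i\<in>?I. \<Sum>j\<in>?I. \<Sum>l\<in>?I. a i j * b j l * e i l) = (\<Sum>i\<in>?I. \<Sum>l\<in>?I. \<Sum>j\<in>?I. a i j * b j l * e i l)"
    by (intro sum.cong refl sum.swap)
  also have "(\<Sum>i\<in>?I. \<Sum>j\<in>?I. \<Sum>k\<in>?I. a i j * b k i * e k j) = (\<Sum>k\<in>?I. \<Sum>j\<in>?I. \<Sum>i\<in>?I. b k i * a i j * e k j)"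
  proof -
    have "(\<Sum>i\<in>?I. \<Sum>j\<in>?I. \<Sum>k\<in>?I. a i j * b k i * e k j) = (\<Sum>i\<in>?I. \<Sum>k\<in>?I. \<Sum>j\<in>?I. a i j * b k i * e k j)"
      by (intro sum.cong refl sum.swap)
    also have "\<dots> = (\<Sum>k\<in>?I. \<Sum>i\<in>?I. \<Sum>j\<in>?I. a i j * b k i * e k j)" by (rule sum.swap)
    also have "\<dots> = (\<Sum>k\<in>?I. \<Sum>j\<in>?I. \<Sum>i\<in>?I. a i j * b k i * e k j)"
      by (intro sum.cong refl sum.swap)
    finally show ?thesis by (simp add: mult.commute)
  qed
  also have "(\<Sum>i\<in>?I. \<Sum>l\<in>?I. \<Sum>j\<in>?I. a i j * b j l * e i l) - (\<Sum>k\<in>?I. \<Sum>j\<in>?I. \<Sum>i\<in>?I. b k i * a i j * e k j)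
      = ?L (act (N_mod n a1 a2) (lie_bracket A B) v)"
    by (simp add: N_act lookup_sum AB sum_subtractf left_diff_distrib sum_distrib_right e_def)
  finally show "?L (act (N_mod n a1 a2) (lie_bracket A B) v) =
      ?L (act (N_mod n a1 a2) A (act (N_mod n a1 a2) B v) - act (N_mod n a1 a2) B (act (N_mod n a1 a2) A v))"
    by (simp add: lookup_minus)
qed

theorem lie_module_N:
  assumes g: "g \<subseteq> carrier_mat (2 * n) (2 * n)"
  shows "lie_module g (N_mod n a1 a2)"
proof -
  note cl = cvs.subspace_add[OF N_subspace] cvs.subspace_scale[OF N_subspace]
    cvs.subspace_0[OF N_subspace] cvs.subspace_neg[OF N_subspace]
  have ab: "abelian_group (N_mod n a1 a2)"
  proof (rule abelian_groupI)
    fix x assume "x \<in> carrier (N_mod n a1 a2)"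
    then show "\<exists>y\<in>carrier (N_mod n a1 a2). y \<oplus>\<^bsub>N_mod n a1 a2\<^esub> x = \<zero>\<^bsub>N_mod n a1 a2\<^esub>"
      by (intro bexI[of _ "- x"] cl) simp_all
  qed (simp_all add: cl algebra_simps)
  then interpret N: abelian_group "N_mod n a1 a2" .
  have inv: "\<ominus>\<^bsub>N_mod n a1 a2\<^esub> x = - x" if "x \<in> carrier (N_mod n a1 a2)" for x
    by (rule N.minus_equality) (use that in \<open>simp_all add: cl\<close>)
  show ?thesis
  proof (intro lie_module.intro lie_module_axioms.intro moduleI cring_complex_field ab)
    fix A B v assume A: "A \<in> g" "B \<in> g" and v: "v \<in> carrier (N_mod n a1 a2)"
    have AB: "A \<in> carrier_mat (2 * n) (2 * n)" "B \<in> carrier_mat (2 * n) (2 * n)" using A g by auto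
    show "act (N_mod n a1 a2) (lie_bracket A B) v = act (N_mod n a1 a2) A (act (N_mod n a1 a2) B v)
        \<ominus>\<^bsub>N_mod n a1 a2\<^esub> act (N_mod n a1 a2) B (act (N_mod n a1 a2) A v)"
      using N_act_bracket[OF AB subsetD[OF N_supp v]] v by (simp add: a_minus_def inv N_act_closed)
    show "act (N_mod n a1 a2) (A + B) v = act (N_mod n a1 a2) A v \<oplus>\<^bsub>N_mod n a1 a2\<^esub> act (N_mod n a1 a2) B v"
      using AB by (simp add: N_act cvs.scale_left_distrib sum.distrib)
  next
    fix A c v assume "A \<in> g"
    then have "A \<in> carrier_mat (2 * n) (2 * n)" using g by auto
    then show "act (N_mod n a1 a2) (c \<cdot>\<^sub>m A) v = c \<odot>\<^bsub>N_mod n a1 a2\<^esub> act (N_mod n a1 a2) A v"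
      by (simp add: N_act cvs.scale_sum_right)
  next
    fix A v assume "v \<in> carrier (N_mod n a1 a2)"
    then show "act (N_mod n a1 a2) A v \<in> carrier (N_mod n a1 a2)" by (rule N_act_closed)
  qed (simp_all add: cl N_act eop_linear cvs.scale_right_distrib cvs.scale_left_distrib
      sum.distrib cvs.scale_sum_right mult.commute)
qed

section \<open>The action of gl(n) and the vectors S k\<close>

lemma lin_ext_basis: "lin_ext f (basis_elt \<beta>) = f \<beta>"
  by (simp add: lin_ext_def basis_elt_def)

text \<open>
  These identities are used in the inductions for \<open>S_R\<close> and \<open>S_E\<close> with \<open>t = \<tau> k\<close> and \<open>s = \<tau> (k - 1)\<close>.
\<close>

lemma shifted_fraction_identities:
  fixes p q r s t :: complex
  assumes "t \<noteq> 0" "s \<noteq> 0" "s = t + 1"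
  shows "r / s * p + 1 / t * (r / s * q) = r / t * (p + 1 / s * (q - p))"
    and "r * p + 1 / t * (r * q - r / s * q) = r * (p + 1 / s * q)"
proof -
  have "1 / t - 1 / s = (s - t) / (s * t)"
    using assms(1,2) by (simp add: diff_frac_eq mult.commute)
  then have e: "1 / (s * t) = 1 / t - 1 / s" using assms(3) by simp
  have "r / s * p + 1 / t * (r / s * q) - r / t * (p + 1 / s * (q - p)) =
      r * p * (1 / s - 1 / t + 1 / (s * t))"
    by (simp add: algebra_simps add_divide_distrib diff_divide_distrib)
  then show "r / s * p + 1 / t * (r / s * q) = r / t * (p + 1 / s * (q - p))" by (simp add: e)
  have "r * p + 1 / t * (r * q - r / s * q) - r * (p + 1 / s * q) = r * q * (1 / t - 1 / s - 1 / (s * t))"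
    by (simp add: algebra_simps add_divide_distrib diff_divide_distrib)
  then show "r * p + 1 / t * (r * q - r / s * q) = r * (p + 1 / s * q)" by (simp add: e)
qed

locale dual_pair =
  fixes n :: nat and a1 a2 :: complex and b :: int
  assumes n2: "n > 2" and a1: "a1 \<notin> \<int>" and a2: "a2 \<notin> \<int>"
begin

abbreviation N where "N \<equiv> carrier (N_mod n a1 a2)"

text \<open>
  The action of the block diagonal matrix with two blocks \<open>E_(i,j)\<close>. Indices start at \<open>0\<close>; \<open>\<omega>\<close> is the last index
  and \<open>mid\<close> the set of the indices strictly between. The lowering operators \<open>e \<omega> i\<close>, \<open>e i 0\<close>, with \<open>i\<close> in
  \<open>mid\<close>, and \<open>e \<omega> 0\<close> satisfy the relations of a Heisenberg algebra with centre \<open>e \<omega> 0\<close>, on which the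
  operators \<open>e i j\<close>, with \<open>i, j\<close> in \<open>mid\<close>, act as \<open>gl(n-2)\<close>.
\<close>

definition e :: "nat \<Rightarrow> nat \<Rightarrow> (complex vec \<Rightarrow>\<^sub>0 complex) \<Rightarrow> (complex vec \<Rightarrow>\<^sub>0 complex)" where
  "e i j v = eop n i j v + eop n (n + i) (n + j) v"

definition \<omega> :: nat where "\<omega> = n - 1"

definition mid :: "nat set" where "mid = {1..<\<omega>}"

lemma mid_neq [simp]: "i \<in> mid \<Longrightarrow> i \<noteq> 0" "i \<in> mid \<Longrightarrow> 0 \<noteq> i" "i \<in> mid \<Longrightarrow> i \<noteq> \<omega>"
  "i \<in> mid \<Longrightarrow> \<omega> \<noteq> i" "\<omega> \<noteq> 0" "0 \<noteq> \<omega>" "i \<in> mid \<Longrightarrow> i < n" "\<omega> < n" "0 < n" "finite mid" "i \<in> mid \<Longrightarrow> 0 < i" "i \<in> mid \<Longrightarrow> i < \<omega>" "0 < \<omega>"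
  using n2 by (auto simp: mid_def \<omega>_def)

lemma card_mid: "card mid = n - 2"
  using n2 by (simp add: mid_def \<omega>_def)

lemma N_cl [intro]: "v \<in> N \<Longrightarrow> w \<in> N \<Longrightarrow> v + w \<in> N" "v \<in> N \<Longrightarrow> w \<in> N \<Longrightarrow> v - w \<in> N"
  "v \<in> N \<Longrightarrow> scale c v \<in> N" "0 \<in> N" "(\<And>i. i \<in> A \<Longrightarrow> f i \<in> N) \<Longrightarrow> sum f A \<in> N"
  by (auto intro: cvs.subspace_add[OF N_subspace] cvs.subspace_diff[OF N_subspace] cvs.subspace_sum[OF N_subspace]
      cvs.subspace_scale[OF N_subspace] cvs.subspace_0[OF N_subspace])

lemma e_N [simp]: "v \<in> N \<Longrightarrow> i < n \<Longrightarrow> j < n \<Longrightarrow> e i j v \<in> N"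
  unfolding e_def by (intro N_cl eop_N) auto

lemma e_N_mid [simp]: "v \<in> N \<Longrightarrow> i \<in> mid \<Longrightarrow> e \<omega> i v \<in> N" "v \<in> N \<Longrightarrow> i \<in> mid \<Longrightarrow> e i 0 v \<in> N"
  "v \<in> N \<Longrightarrow> i \<in> mid \<Longrightarrow> e i \<omega> v \<in> N" "v \<in> N \<Longrightarrow> i \<in> mid \<Longrightarrow> e 0 i v \<in> N"
  "v \<in> N \<Longrightarrow> e \<omega> 0 v \<in> N" "v \<in> N \<Longrightarrow> e 0 \<omega> v \<in> N" "v \<in> N \<Longrightarrow> e 0 0 v \<in> N" "v \<in> N \<Longrightarrow> e \<omega> \<omega> v \<in> N"
  "v \<in> N \<Longrightarrow> i \<in> mid \<Longrightarrow> j \<in> mid \<Longrightarrow> e i j v \<in> N"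
  by simp_all

lemma e_add: "e i j (v + w) = e i j v + e i j w"
  and e_scale: "e i j (scale c v) = scale c (e i j v)"
  by (simp_all add: e_def eop_linear cvs.scale_right_distrib)

lemma e_0 [simp]: "e i j 0 = 0"
  using e_scale[of i j 0 0] by simp

lemma e_minus: "e i j (- v) = - e i j v"
  using e_scale[of i j "-1" v] by simp

lemma e_diff: "e i j (v - w) = e i j v - e i j w"
  using e_add[of i j v "- w"] by (simp add: e_minus)

lemma e_sum: "e i j (sum f A) = (\<Sum>a\<in>A. e i j (f a))"
  by (induction A rule: infinite_finite_induct) (simp_all add: e_add)

lemma e_swap:
  assumes "v \<in> N" "i < n" "j < n" "k < n" "l < n"
  shows "e i j (e k l v) = e k l (e i j v) + (if j = k then e i l v else 0) - (if l = i then e k j v else 0)"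
proof -
  have v: "v \<in> supp n" using assms N_supp by blast
  have 1: "eop n i j (eop n k l v) - eop n k l (eop n i j v) = (if j = k then eop n i l v else 0) - (if l = i then eop n k j v else 0)"
    and 2: "eop n (n + i) (n + j) (eop n (n + k) (n + l) v) - eop n (n + k) (n + l) (eop n (n + i) (n + j) v) =
      (if j = k then eop n (n + i) (n + l) v else 0) - (if l = i then eop n (n + k) (n + j) v else 0)"
    and 3: "eop n i j (eop n (n + k) (n + l) v) - eop n (n + k) (n + l) (eop n i j v) = 0"
    and 4: "eop n (n + i) (n + j) (eop n k l v) - eop n k l (eop n (n + i) (n + j) v) = 0"
    using assms by (simp_all add: eop_commutator[OF v])
  have "e i j (e k l v) - e k l (e i j v) = (eop n i j (eop n k l v) - eop n k l (eop n i j v)) +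
     (eop n (n + i) (n + j) (eop n (n + k) (n + l) v) - eop n (n + k) (n + l) (eop n (n + i) (n + j) v)) +
     (eop n i j (eop n (n + k) (n + l) v) - eop n (n + k) (n + l) (eop n i j v)) +
     (eop n (n + i) (n + j) (eop n k l v) - eop n k l (eop n (n + i) (n + j) v))"
    by (simp add: e_def eop_linear)
  also have "\<dots> = (if j = k then e i l v else 0) - (if l = i then e k j v else 0)"
    unfolding 1 2 3 4 by (auto simp: e_def)
  finally show ?thesis by (simp add: algebra_simps)
qed

abbreviation x0 where "x0 \<equiv> x_b0 n a1 a2 b"

definition \<tau> :: "nat \<Rightarrow> complex" where "\<tau> k = a2 - of_int b - of_nat k"

lemma nonint: "a1 + of_int k + of_nat m \<noteq> 0" "a1 + of_int k + of_nat m \<notin> \<int>" "a2 - of_int k \<notin> \<int>"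
proof -
  show 1: "a1 + of_int k + of_nat m \<notin> \<int>" for m
  proof
    assume "a1 + of_int k + of_nat m \<in> \<int>"
    then have "a1 + of_int k + of_nat m - of_int k - of_nat m \<in> \<int>" by (intro Ints_diff) auto
    then show False using a1 by simp
  qed
  then show "a1 + of_int k + of_nat m \<noteq> 0" by (metis Ints_0)
  show "a2 - of_int k \<notin> \<int>"
  proof
    assume "a2 - of_int k \<in> \<int>"
    then have "a2 - of_int k + of_int k \<in> \<int>" by (intro Ints_add) auto
    then show False using a2 by simp
  qed
qed

lemma \<tau>_minus_nz: "\<tau> k - of_nat j \<noteq> 0"
proof
  assume "\<tau> k - of_nat j = 0"
  then have "a2 - of_int b = of_nat (k + j)" by (simp add: \<tau>_def algebra_simps)
  then show False using nonint(3)[of b] by (metis Ints_of_nat)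
qed

lemma \<tau>_nz [simp]: "\<tau> k \<noteq> 0"
  using \<tau>_minus_nz[of k 0] by simp

lemma tuple_carrier: "tuple n u v \<in> carrier_vec (2 * n)"
  by (simp add: tuple_def)

lemma x_N [simp]: "x0 \<in> N"
proof -
  have s: "(\<Sum>i<2 * n. tuple n u v $ i) = u + v + (\<Sum>i\<in>{..<2 * n} - {n - 1, n}. if i < n - 1 then -1 else 0)" for u v
  proof -
    have "(\<Sum>i<2 * n. tuple n u v $ i) = (\<Sum>i\<in>{n - 1, n}. tuple n u v $ i) + (\<Sum>i\<in>{..<2 * n} - {n - 1, n}. tuple n u v $ i)"
      using n2 by (subst sum.subset_diff[of "{n - 1, n}"]) auto
    also have "(\<Sum>i\<in>{..<2 * n} - {n - 1, n}. tuple n u v $ i) = (\<Sum>i\<in>{..<2 * n} - {n - 1, n}. if i < n - 1 then -1 else 0)"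
      by (intro sum.cong) (auto simp: tuple_def)
    also have "(\<Sum>i\<in>{n - 1, n}. tuple n u v $ i) = u + v"
      using n2 by (auto simp: tuple_def)
    finally show ?thesis .
  qed
  have "admissible n a1 a2 (tuple n (a1 + of_int b) (a2 - of_int b))"
    unfolding admissible_def s by (auto simp: tuple_def)
  then show ?thesis by (simp add: N_mod_def x_b0_def basis_elt_def)
qed

lemma eop_basis:
  assumes "i < 2 * n" "j < 2 * n" "\<beta> \<in> carrier_vec (2 * n)" "i \<noteq> j"
  shows "eop n i j (basis_elt \<beta>) = scale (pc (\<beta> $ j) * qc (\<beta> $ i)) (basis_elt (\<beta> - unit_vec (2 * n) j + unit_vec (2 * n) i))"
  using assms by (simp add: eop_def p_op_eq q_op_eq lin_ext_basis lin_ext_scale)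

lemma e_x_zero:
  assumes "i < \<omega>" "0 < j" "j < n" "i \<noteq> j"
  shows "e i j x0 = 0"
proof -
  let ?t = "tuple n (a1 + of_int b) (a2 - of_int b)"
  have i: "i < n - 1" using assms(1) by (simp add: \<omega>_def)
  have "?t $ i = -1" "?t $ (n + j) = 0" using i assms(2,3) by (auto simp: tuple_def)
  then have "qc (?t $ i) = 0" "pc (?t $ (n + j)) = 0" by (simp_all add: qc_def pc_def neg_integer_def)
  moreover have "i < 2 * n" "j < 2 * n" "n + i < 2 * n" "n + j < 2 * n" using i assms(3) by auto
  ultimately show ?thesis
    using assms(4) by (simp add: e_def x_b0_def eop_basis[OF _ _ tuple_carrier])
qed

lemma e_raise_x: "i < j \<Longrightarrow> j < n \<Longrightarrow> e i j x0 = 0"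
  by (rule e_x_zero) (auto simp: \<omega>_def)

lemma e_diag_x:
  assumes "i < n"
  shows "e i i x0 = scale (if i = 0 then a2 - of_int b - 1 else if i = \<omega> then a1 + of_int b else -1) x0"
proof (rule supp_eqI[of _ n])
  have xs: "x0 \<in> supp n" using x_N N_supp by blast
  show "e i i x0 \<in> supp n" "scale (if i = 0 then a2 - of_int b - 1 else if i = \<omega> then a1 + of_int b else -1) x0 \<in> supp n"
    using xs unfolding e_def by (blast intro: supp_closed eop_supp)+
  fix \<beta> :: "complex vec" assume \<beta>: "\<beta> \<in> carrier_vec (2 * n)"
  have "lk x0 \<beta> = 0" if "\<beta> \<noteq> tuple n (a1 + of_int b) (a2 - of_int b)"
    using that by (auto simp: x_b0_def basis_elt_def lookup_single when_def)
  moreover have "tuple n (a1 + of_int b) (a2 - of_int b) $ i + tuple n (a1 + of_int b) (a2 - of_int b) $ (n + i) =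
      (if i = 0 then a2 - of_int b - 1 else if i = \<omega> then a1 + of_int b else -1)"
  proof -
    have "n + i \<noteq> n - 1" "n + i < 2 * n" "\<not> n + i < n - 1" "i < n - 1 \<or> i = n - 1" using assms n2 by auto
    then show ?thesis using assms n2 by (auto simp: tuple_def \<omega>_def)
  qed
  moreover have "lk (e i i x0) \<beta> = (\<beta> $ i + \<beta> $ (n + i)) * lk x0 \<beta>"
    using assms \<beta> xs by (simp add: e_def lookup_add lookup_eop_same algebra_simps)
  ultimately show "lk (e i i x0) \<beta> = lk (scale (if i = 0 then a2 - of_int b - 1 else if i = \<omega> then a1 + of_int b else -1) x0) \<beta>"
    by (cases "\<beta> = tuple n (a1 + of_int b) (a2 - of_int b)") simp_all
qed

definition T where "T v = (\<Sum>i\<in>mid. e \<omega> i (e i 0 v))"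

text \<open>
  In the polynomial picture \<open>S k\<close> is \<open>s^k\<close>: multiplication by \<open>s\<close> is \<open>e \<omega> 0\<close> plus the product of \<open>y_i\<close> and \<open>z_i\<close>
  summed over \<open>i\<close>, and \<open>e \<omega> i\<close> multiplies by \<open>y_i\<close> while \<open>e i 0\<close> multiplies \<open>s^k\<close> by \<open>\<tau> k z_i\<close>.
\<close>

primrec S :: "nat \<Rightarrow> complex vec \<Rightarrow>\<^sub>0 complex" where
  "S 0 = x0"
| "S (Suc k) = e \<omega> 0 (S k) + scale (1 / \<tau> k) (T (S k))"

lemma T_N [simp]: "v \<in> N \<Longrightarrow> T v \<in> N"
  unfolding T_def by (intro N_cl) simp

lemma S_N [simp]: "S k \<in> N"
  by (induction k) (auto intro!: N_cl)

lemma T_linear: "T (v + w) = T v + T w" "T (scale c v) = scale c (T v)"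
  "T (v - w) = T v - T w"
  by (simp_all add: T_def e_add e_scale e_diff sum.distrib sum_subtractf cvs.scale_sum_right)

lemma T_0 [simp]: "T 0 = 0"
  by (simp add: T_def)

lemma e_sum_delta: "i \<in> mid \<Longrightarrow> (\<Sum>l\<in>mid. if i = l then f l else 0) = f i" "i \<in> mid \<Longrightarrow> (\<Sum>l\<in>mid. if l = i then f l else 0) = f i"
  for f :: "nat \<Rightarrow> complex vec \<Rightarrow>\<^sub>0 complex"
  using mid_neq(10) by simp_all

lemma sum_const_scale: "(\<Sum>l\<in>A. w) = scale (of_nat (card A)) w" for A :: "nat set" and w :: "complex vec \<Rightarrow>\<^sub>0 complex"
  by (intro poly_mapping_eqI) (simp add: lookup_sum)

lemma T_levi:
  assumes v: "v \<in> N" and i: "i \<in> mid" and j: "j \<in> mid"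
  shows "e i j (T v) = T (e i j v)"
proof -
  have "e i j (e \<omega> l (e l 0 v)) = e \<omega> l (e l 0 (e i j v)) +
      (if j = l then e \<omega> l (e i 0 v) else 0) - (if l = i then e \<omega> j (e l 0 v) else 0)" if l: "l \<in> mid" for l
    using v i j l by (auto simp: e_swap[of "e l 0 v" i j] e_swap[of v i j l] e_add)
  then have "e i j (T v) = (\<Sum>l\<in>mid. e \<omega> l (e l 0 (e i j v)) +
      (if j = l then e \<omega> l (e i 0 v) else 0) - (if l = i then e \<omega> j (e l 0 v) else 0))"
    unfolding T_def e_sum by (rule sum.cong[OF refl])
  also have "\<dots> = T (e i j v)"
    using e_sum_delta[of j "\<lambda>l. e \<omega> l (e i 0 v)"] e_sum_delta[of i "\<lambda>l. e \<omega> j (e l 0 v)"] i j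
    by (simp add: sum.distrib sum_subtractf T_def)
  finally show ?thesis .
qed

lemma S_levi:
  assumes i: "i \<in> mid" and j: "j \<in> mid"
  shows "e i j (S k) = (if i = j then - S k else 0)"
proof (induction k)
  case 0
  show ?case
  proof (cases "i = j")
    case True
    then show ?thesis using e_diag_x[of i] i by simp
  next
    case False
    then show ?thesis using e_x_zero[of i j] i j by simp
  qed
next
  case (Suc k)
  have "e i j (e \<omega> 0 (S k)) = e \<omega> 0 (e i j (S k))"
    using i j by (simp add: e_swap[of "S k" i j])
  then show ?case using Suc T_linear(2)[of "-1" "S k"] i j by (simp add: e_add e_scale e_minus T_levi)
qed

lemma weight_T: "v \<in> N \<Longrightarrow> e 0 0 (T v) = T (e 0 0 v) - T v"
  "v \<in> N \<Longrightarrow> e \<omega> \<omega> (T v) = T (e \<omega> \<omega> v) + T v"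
proof -
  assume v: "v \<in> N"
  have "e 0 0 (e \<omega> l (e l 0 v)) = e \<omega> l (e l 0 (e 0 0 v)) - e \<omega> l (e l 0 v)" if l: "l \<in> mid" for l
    using v l by (simp add: e_swap[of "e l 0 v" 0 0] e_swap[of v 0 0] e_diff)
  then show "e 0 0 (T v) = T (e 0 0 v) - T v"
    unfolding T_def e_sum by (simp add: sum_subtractf)
  have "e \<omega> \<omega> (e \<omega> l (e l 0 v)) = e \<omega> l (e l 0 (e \<omega> \<omega> v)) + e \<omega> l (e l 0 v)" if l: "l \<in> mid" for l
    using v l by (simp add: e_swap[of "e l 0 v" \<omega> \<omega>] e_swap[of v \<omega> \<omega>] e_add)
  then show "e \<omega> \<omega> (T v) = T (e \<omega> \<omega> v) + T v"
    unfolding T_def e_sum by (simp add: sum.distrib)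
qed

lemma S_weight: "e 0 0 (S k) = scale (\<tau> k - 1) (S k)"
  "e \<omega> \<omega> (S k) = scale (a1 + of_int b + of_nat k) (S k)"
proof (induction k)
  case 0
  show "e 0 0 (S 0) = scale (\<tau> 0 - 1) (S 0)" "e \<omega> \<omega> (S 0) = scale (a1 + of_int b + of_nat 0) (S 0)"
    using e_diag_x[of 0] e_diag_x[of \<omega>] by (simp_all add: \<tau>_def)
next
  case (Suc k)
  have t: "\<tau> (Suc k) = \<tau> k - 1" by (simp add: \<tau>_def)
  have "e 0 0 (e \<omega> 0 (S k)) = e \<omega> 0 (e 0 0 (S k)) - e \<omega> 0 (S k)"
    by (simp add: e_swap[of "S k" 0 0])
  then have eq: "e 0 0 (S (Suc k)) = e \<omega> 0 (e 0 0 (S k)) - e \<omega> 0 (S k) + scale (1 / \<tau> k) (T (e 0 0 (S k)) - T (S k))"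
    by (simp add: e_add e_scale weight_T)
  show "e 0 0 (S (Suc k)) = scale (\<tau> (Suc k) - 1) (S (Suc k))"
    unfolding eq Suc(1) by (intro poly_mapping_eqI)
      (simp add: e_scale e_diff T_linear lookup_add lookup_minus t field_simps)
  have "e \<omega> \<omega> (e \<omega> 0 (S k)) = e \<omega> 0 (e \<omega> \<omega> (S k)) + e \<omega> 0 (S k)"
    by (simp add: e_swap[of "S k" \<omega> \<omega>])
  then have eq: "e \<omega> \<omega> (S (Suc k)) = e \<omega> 0 (e \<omega> \<omega> (S k)) + e \<omega> 0 (S k) + scale (1 / \<tau> k) (T (e \<omega> \<omega> (S k)) + T (S k))"
    by (simp add: e_add e_scale weight_T)
  show "e \<omega> \<omega> (S (Suc k)) = scale (a1 + of_int b + of_nat (Suc k)) (S (Suc k))"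
    unfolding eq Suc(2) by (intro poly_mapping_eqI)
      (simp add: e_scale e_add T_linear lookup_add lookup_minus field_simps)
qed

definition c :: complex where "c = a1 - a2 + 2 * of_int b - (of_nat n - 2)"

text \<open>
  The correction by \<open>T\<close> in the definition of \<open>S\<close> is the one that makes this true: \<open>e 0 j\<close> maps
  \<open>e \<omega> 0 (S k)\<close> to \<open>- e \<omega> j (S k)\<close> and \<open>T (S k)\<close> to \<open>\<tau> k\<close> times \<open>e \<omega> j (S k)\<close>.
\<close>

lemma S_P:
  assumes j: "j \<in> mid"
  shows "e 0 j (S k) = 0"
proof (induction k)
  case 0
  show ?case using e_raise_x j by simp
next
  case (Suc k)
  have f: "e 0 j (e \<omega> 0 (S k)) = - e \<omega> j (S k)"
    using j Suc by (simp add: e_swap[of "S k" 0 j])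
  have "e 0 j (e \<omega> l (e l 0 (S k))) = (if j = l then scale (\<tau> k) (e \<omega> l (S k)) else 0)" if l: "l \<in> mid" for l
  proof -
    have "e 0 j (e l 0 (S k)) = (if j = l then scale (\<tau> k) (S k) else 0)"
      using l j Suc by (auto simp: e_swap[of "S k" 0 j] S_weight S_levi cvs.scale_left_diff_distrib)
    then show ?thesis using l j by (auto simp: e_swap[of "e l 0 (S k)" 0 j] e_scale)
  qed
  then have "e 0 j (T (S k)) = scale (\<tau> k) (e \<omega> j (S k))"
    using j by (simp add: T_def e_sum)
  then show ?case by (simp add: e_add e_scale f)
qed

lemma F_T:
  assumes v: "v \<in> N" and j: "j \<in> mid"
  shows "e j 0 (T v) = T (e j 0 v) - e \<omega> 0 (e j 0 v)"
proof -
  have "e j 0 (e \<omega> l (e l 0 v)) = e \<omega> l (e l 0 (e j 0 v)) - (if j = l then e \<omega> 0 (e j 0 v) else 0)" if l: "l \<in> mid" for l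
    using v l j by (auto simp: e_swap[of "e l 0 v" j 0 \<omega> l] e_swap[of v j 0 l 0])
  then show ?thesis using j unfolding T_def e_sum by (simp add: sum_subtractf)
qed

lemma R_T_S:
  assumes j: "j \<in> mid"
  shows "e j \<omega> (T (S k)) = T (e j \<omega> (S k)) + scale (of_nat n - 3 - a1 - of_int b - of_nat k) (e j 0 (S k))"
proof -
  have "e j \<omega> (e \<omega> l (e l 0 (S k))) = e \<omega> l (e l 0 (e j \<omega> (S k))) + e j l (e l 0 (S k))
      - (if j = l then e \<omega> \<omega> (e l 0 (S k)) else 0)" if l: "l \<in> mid" for l
    using l j by (auto simp: e_swap[of "e l 0 (S k)" j \<omega> \<omega>] e_swap[of "S k" j \<omega> l 0])
  moreover have "e j l (e l 0 (S k)) = e j 0 (S k) - (if j = l then e l 0 (S k) else 0)" if l: "l \<in> mid" for l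
    using l j by (auto simp: e_swap[of "S k" j l l 0] S_levi e_minus)
  moreover have "e \<omega> \<omega> (e j 0 (S k)) = scale (a1 + of_int b + of_nat k) (e j 0 (S k))"
    using j by (simp add: e_swap[of "S k" \<omega> \<omega>] S_weight e_scale)
  ultimately have eq: "e j \<omega> (T (S k)) = T (e j \<omega> (S k)) + scale (of_nat (n - 2)) (e j 0 (S k))
      - e j 0 (S k) - scale (a1 + of_int b + of_nat k) (e j 0 (S k))"
    using j
    by (simp add: T_def e_sum sum.distrib sum_subtractf sum_const_scale card_mid)
  show ?thesis unfolding eq using n2 by (intro poly_mapping_eqI) (simp add: lookup_add lookup_minus of_nat_diff algebra_simps)
qed

text \<open>
  At \<open>k = 0\<close> the truncated subtraction on the right is harmless, because the scalar is zero there.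
\<close>

lemma S_R:
  assumes j: "j \<in> mid"
  shows "e j \<omega> (S k) = scale (- of_nat k * (c + of_nat k) / \<tau> (k - 1)) (e j 0 (S (k - 1)))"
proof (induction k)
  case 0
  show ?case using e_raise_x j by simp
next
  case (Suc k)
  define F where "F = e j 0 (S k)"
  have c: "of_nat n - 3 - a1 - of_int b - of_nat k = - c - 1 - 2 * of_nat k - \<tau> k"
    by (simp add: c_def \<tau>_def algebra_simps)
  have f: "e j \<omega> (e \<omega> 0 (S k)) = e \<omega> 0 (e j \<omega> (S k)) + F"
    using j by (auto simp: e_swap[of "S k" j \<omega>] F_def)
  have main: "e \<omega> 0 (e j \<omega> (S k)) + scale (1 / \<tau> k) (T (e j \<omega> (S k))) =
     scale (- of_nat k * (c + of_nat k) / \<tau> k) F"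
  proof (cases k)
    case 0
    then show ?thesis using Suc by simp
  next
    case (Suc m)
    have t: "\<tau> m = \<tau> k + 1" using Suc by (simp add: \<tau>_def)
    have nz: "\<tau> k + 1 \<noteq> 0" using \<tau>_nz[of m] t by simp
    have 1: "F = e j 0 (e \<omega> 0 (S m)) + scale (1 / \<tau> m) (e j 0 (T (S m)))"
      by (simp add: F_def Suc e_add e_scale)
    have 2: "e j 0 (e \<omega> 0 (S m)) = e \<omega> 0 (e j 0 (S m))"
      using j by (simp add: e_swap[of "S m" j 0])
    have 3: "e j 0 (T (S m)) = T (e j 0 (S m)) - e \<omega> 0 (e j 0 (S m))" by (rule F_T[OF S_N j])
    have m: "k - 1 = m" using Suc by simp
    define \<kappa> where "\<kappa> = - of_nat k * (c + of_nat k)"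
    show ?thesis unfolding Suc.IH 1 2 3 m \<kappa>_def[symmetric]
    proof (rule poly_mapping_eqI)
      fix \<beta>
      show "lk (e \<omega> 0 (scale (\<kappa> / \<tau> m) (e j 0 (S m))) + scale (1 / \<tau> k) (T (scale (\<kappa> / \<tau> m) (e j 0 (S m))))) \<beta> =
          lk (scale (\<kappa> / \<tau> k) (e \<omega> 0 (e j 0 (S m)) + scale (1 / \<tau> m) (T (e j 0 (S m)) - e \<omega> 0 (e j 0 (S m))))) \<beta>"
        unfolding e_scale T_linear lookup_add lookup_minus lookup_scale
        by (rule shifted_fraction_identities(1)) (use nz t in auto)
    qed
  qed
  have "e j \<omega> (S (Suc k)) = (e \<omega> 0 (e j \<omega> (S k)) + scale (1 / \<tau> k) (T (e j \<omega> (S k)))) + F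
      + scale (1 / \<tau> k * (- c - 1 - 2 * of_nat k - \<tau> k)) F"
    using j by (simp add: e_add e_scale f R_T_S c cvs.scale_right_distrib F_def)
  also have "\<dots> = scale (- of_nat (Suc k) * (c + of_nat (Suc k)) / \<tau> k) F"
    unfolding main by (intro poly_mapping_eqI) (simp add: lookup_add field_simps)
  finally show ?case by (simp add: F_def)
qed

text \<open>
  The scalar vanishes for \<open>k = 0\<close> and for \<open>k = -c\<close>. The second zero is the origin of the submodule in
  the case of negative \<open>c\<close>.
\<close>

lemma S_E: "e 0 \<omega> (S k) = scale (- of_nat k * (c + of_nat k)) (S (k - 1))"
proof (induction k)
  case 0
  show ?case using e_raise_x by simp
next
  case (Suc k)
  have f: "e 0 \<omega> (e \<omega> 0 (S k)) = e \<omega> 0 (e 0 \<omega> (S k)) + scale (\<tau> k - 1) (S k) - scale (a1 + of_int b + of_nat k) (S k)"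
    by (simp add: e_swap[of "S k" 0 \<omega>] S_weight)
  have "e 0 \<omega> (e \<omega> l (e l 0 (S k))) = e \<omega> l (e l 0 (e 0 \<omega> (S k))) - e \<omega> l (e l \<omega> (S k)) + scale (\<tau> k) (S k)" if l: "l \<in> mid" for l
  proof -
    have "e 0 l (e l 0 (S k)) = scale (\<tau> k) (S k)"
      using l by (simp add: e_swap[of "S k" 0 l] S_weight S_levi S_P cvs.scale_left_diff_distrib)
    moreover have "e 0 \<omega> (e l 0 (S k)) = e l 0 (e 0 \<omega> (S k)) - e l \<omega> (S k)"
      using l by (simp add: e_swap[of "S k" 0 \<omega> l 0])
    ultimately show ?thesis using l
      by (simp add: e_swap[of "e l 0 (S k)" 0 \<omega> \<omega> l] e_diff)
  qed
  then have "e 0 \<omega> (T (S k)) = T (e 0 \<omega> (S k)) - (\<Sum>l\<in>mid. e \<omega> l (e l \<omega> (S k))) + (\<Sum>l\<in>mid. scale (\<tau> k) (S k))"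
    by (simp add: T_def e_sum sum.distrib sum_subtractf)
  also have "(\<Sum>l\<in>mid. e \<omega> l (e l \<omega> (S k))) = scale (- of_nat k * (c + of_nat k) / \<tau> (k - 1)) (T (S (k - 1)))"
    by (simp add: S_R e_scale e_minus T_def cvs.scale_sum_right sum_negf)
  also have "(\<Sum>l\<in>mid. scale (\<tau> k) (S k)) = scale ((of_nat n - 2) * \<tau> k) (S k)"
    using n2 by (intro poly_mapping_eqI) (simp add: lookup_sum card_mid of_nat_diff)
  finally have TE: "e 0 \<omega> (T (S k)) = T (e 0 \<omega> (S k)) - scale (- of_nat k * (c + of_nat k) / \<tau> (k - 1)) (T (S (k - 1))) + scale ((of_nat n - 2) * \<tau> k) (S k)" .
  have main: "e \<omega> 0 (e 0 \<omega> (S k)) + scale (1 / \<tau> k) (T (e 0 \<omega> (S k)) - scale (- of_nat k * (c + of_nat k) / \<tau> (k - 1)) (T (S (k - 1))))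
     = scale (- of_nat k * (c + of_nat k)) (S k)"
  proof (cases k)
    case 0
    then show ?thesis using Suc by simp
  next
    case (Suc m)
    have t: "\<tau> m = \<tau> k + 1" using Suc by (simp add: \<tau>_def)
    have nz: "\<tau> k + 1 \<noteq> 0" using \<tau>_nz[of m] t by simp
    have 1: "S k = e \<omega> 0 (S m) + scale (1 / \<tau> m) (T (S m))" using Suc by simp
    have 2: "k - 1 = m" using Suc by simp
    define \<kappa> where "\<kappa> = - of_nat k * (c + of_nat k)"
    have 3: "scale \<kappa> (S k) = scale \<kappa> (e \<omega> 0 (S m) + scale (1 / \<tau> m) (T (S m)))" using 1 by simp
    show ?thesis unfolding Suc.IH 2 \<kappa>_def[symmetric] 3
      unfolding poly_mapping_eq_iff fun_eq_iff e_scale T_linear lookup_add lookup_minus lookup_scale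
      by (intro allI shifted_fraction_identities(2)) (use nz t in auto)
  qed
  have "e 0 \<omega> (S (Suc k)) = (e \<omega> 0 (e 0 \<omega> (S k)) + scale (1 / \<tau> k) (T (e 0 \<omega> (S k)) - scale (- of_nat k * (c + of_nat k) / \<tau> (k - 1)) (T (S (k - 1)))))
     + scale (\<tau> k - 1 - (a1 + of_int b + of_nat k) + (of_nat n - 2)) (S k)"
    unfolding S.simps(2) e_add e_scale f TE
    by (intro poly_mapping_eqI) (simp add: lookup_add lookup_minus field_simps)
  also have "\<dots> = scale (- of_nat (Suc k) * (c + of_nat (Suc k))) (S k)"
    unfolding main cvs.scale_left_distrib[symmetric]
    by (rule arg_cong[where f = "\<lambda>r. scale r (S k)"]) (simp add: c_def \<tau>_def algebra_simps)
  finally show ?case by simp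
qed

end

section \<open>A monomial basis\<close>

lemma foldr_perm:
  assumes comm: "\<And>i j v. i \<in> I \<Longrightarrow> j \<in> I \<Longrightarrow> v \<in> V \<Longrightarrow> h i (h j v) = h j (h i v)"
    and closed: "\<And>i v. i \<in> I \<Longrightarrow> v \<in> V \<Longrightarrow> h i v \<in> V"
    and "v \<in> V" "set xs \<subseteq> I" "mset xs = mset ys"
  shows "foldr h xs v = foldr h ys v"
  using assms(4,5)
proof (induction xs arbitrary: ys)
  case Nil
  then show ?case by simp
next
  case (Cons x xs)
  have cl: "foldr h zs v \<in> V" if "set zs \<subseteq> I" for zs
    using that by (induction zs) (auto simp: closed \<open>v \<in> V\<close>)
  have "x \<in> set ys" using Cons.prems(2) by (metis list.set_intros(1) set_mset_mset)
  then obtain us vs where ys: "ys = us @ x # vs" by (auto simp: in_set_conv_decomp)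
  have sub: "set us \<subseteq> I" "set vs \<subseteq> I" "x \<in> I"
    using Cons.prems(1) mset_eq_setD[OF Cons.prems(2)] ys by auto
  have "foldr h us (h x w) = h x (foldr h us w)" if "w \<in> V" for w
    using sub(1)
  proof (induction us)
    case (Cons u us)
    have "foldr h us w \<in> V" using Cons.prems that by (induction us) (auto simp: closed)
    then show ?case using Cons sub(3) by (simp add: comm)
  qed simp
  then have "foldr h ys v = h x (foldr h (us @ vs) v)" using cl sub(2) by (simp add: ys)
  moreover have "foldr h (us @ vs) v = foldr h xs v"
    using Cons.IH[of "us @ vs"] Cons.prems ys by simp
  ultimately show ?case by simp
qed

context dual_pair
begin

lemma mid_not [simp]: "0 \<notin> mid" "\<omega> \<notin> mid"
  by (simp_all add: mid_def)

definition Gw where "Gw gs v = foldr (\<lambda>i. e \<omega> i) gs v"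
definition Fw where "Fw ds v = foldr (\<lambda>i. e i 0) ds v"
text \<open>
  The monomial in the variables \<open>y_i\<close> (\<open>i\<close> in \<open>gs\<close>) and \<open>z_i\<close> (\<open>i\<close> in \<open>ds\<close>), times \<open>s^k\<close>, up to a scalar.
\<close>

definition bv where "bv k gs ds = Gw gs (Fw ds (S k))"

lemma w_simps [simp]: "Gw [] v = v" "Gw (i # gs) v = e \<omega> i (Gw gs v)" "Fw [] v = v" "Fw (i # gs) v = e i 0 (Fw gs v)"
  by (simp_all add: Gw_def Fw_def)

lemma w_N [simp]: "v \<in> N \<Longrightarrow> set gs \<subseteq> mid \<Longrightarrow> Gw gs v \<in> N" "v \<in> N \<Longrightarrow> set gs \<subseteq> mid \<Longrightarrow> Fw gs v \<in> N"
  by (induction gs) auto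

lemma w_linear: "Gw gs (v + w) = Gw gs v + Gw gs w" "Gw gs (scale r v) = scale r (Gw gs v)"
  "Fw gs (v + w) = Fw gs v + Fw gs w" "Fw gs (scale r v) = scale r (Fw gs v)"
  by (induction gs) (auto simp: e_add e_scale)

lemma w_0 [simp]: "Gw gs 0 = 0" "Fw gs 0 = 0"
  by (induction gs) auto

lemma bv_N [simp]: "set gs \<subseteq> mid \<Longrightarrow> set ds \<subseteq> mid \<Longrightarrow> bv k gs ds \<in> N"
  by (simp add: bv_def)

lemma G_G_commute: "v \<in> N \<Longrightarrow> i \<in> mid \<Longrightarrow> j \<in> mid \<Longrightarrow> e \<omega> i (e \<omega> j v) = e \<omega> j (e \<omega> i v)"
  using e_swap[of v \<omega> i \<omega> j] by simp

lemma F_F_commute: "v \<in> N \<Longrightarrow> i \<in> mid \<Longrightarrow> j \<in> mid \<Longrightarrow> e i 0 (e j 0 v) = e j 0 (e i 0 v)"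
  using e_swap[of v i 0 j 0] by simp

lemma Gw_perm: "v \<in> N \<Longrightarrow> set gs \<subseteq> mid \<Longrightarrow> mset gs = mset gs' \<Longrightarrow> Gw gs v = Gw gs' v"
  unfolding Gw_def by (rule foldr_perm[where I = mid and V = N]) (simp_all add: G_G_commute)

lemma Fw_perm: "v \<in> N \<Longrightarrow> set gs \<subseteq> mid \<Longrightarrow> mset gs = mset gs' \<Longrightarrow> Fw gs v = Fw gs' v"
  unfolding Fw_def by (rule foldr_perm[where I = mid and V = N]) (simp_all add: F_F_commute)

definition gens :: "nat set \<Rightarrow> (complex vec \<Rightarrow>\<^sub>0 complex) set" where
  "gens U = {bv k gs ds | k gs ds. k \<in> U \<and> set gs \<subseteq> mid \<and> set ds \<subseteq> mid}"
definition B where "B U = cvs.span (gens U)"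

lemma bv_B: "k \<in> U \<Longrightarrow> set gs \<subseteq> mid \<Longrightarrow> set ds \<subseteq> mid \<Longrightarrow> bv k gs ds \<in> B U"
  unfolding B_def gens_def by (rule cvs.span_base) auto

lemma B_cl [intro]: "v \<in> B U \<Longrightarrow> w \<in> B U \<Longrightarrow> v + w \<in> B U" "v \<in> B U \<Longrightarrow> w \<in> B U \<Longrightarrow> v - w \<in> B U"
  "v \<in> B U \<Longrightarrow> scale r v \<in> B U" "0 \<in> B U" "(\<And>i. i \<in> A \<Longrightarrow> f i \<in> B U) \<Longrightarrow> sum f A \<in> B U"
  unfolding B_def by (auto intro: cvs.span_add cvs.span_diff cvs.span_scale cvs.span_zero cvs.span_sum)

lemma B_mono: "U \<subseteq> U' \<Longrightarrow> B U \<subseteq> B U'"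
  unfolding B_def gens_def by (rule cvs.span_mono) blast

lemma B_induct [consumes 1, case_names gen add scale]:
  assumes "v \<in> B U" and gen: "\<And>k gs ds. k \<in> U \<Longrightarrow> set gs \<subseteq> mid \<Longrightarrow> set ds \<subseteq> mid \<Longrightarrow> P (bv k gs ds)"
    and add: "\<And>v w. P v \<Longrightarrow> P w \<Longrightarrow> P (v + w)" and scale: "\<And>r v. P v \<Longrightarrow> P (scale r v)" and "P 0"
  shows "P v"
  using assms(1) unfolding B_def
proof (induction rule: cvs.span_induct_alt)
  case base
  then show ?case by fact
next
  case (step c x y)
  then show ?case unfolding gens_def using gen add scale by blast
qed

lemma B_N: "B U \<subseteq> N"
proof
  show "v \<in> N" if "v \<in> B U" for v
    using that by (induction rule: B_induct) auto
qed

lemma B_op: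
  assumes "v \<in> B U" "\<And>k gs ds. k \<in> U \<Longrightarrow> set gs \<subseteq> mid \<Longrightarrow> set ds \<subseteq> mid \<Longrightarrow> e i j (bv k gs ds) \<in> B U"
  shows "e i j v \<in> B U"
  using assms(1) by (induction rule: B_induct) (use assms(2) in \<open>auto simp: e_add e_scale\<close>)

lemma G_B:
  assumes "i \<in> mid" "v \<in> B U"
  shows "e \<omega> i v \<in> B U"
proof (rule B_op[OF assms(2)])
  show "e \<omega> i (bv k gs ds) \<in> B U" if "k \<in> U" "set gs \<subseteq> mid" "set ds \<subseteq> mid" for k gs ds
    using bv_B[of k U "i # gs" ds] that assms(1) by (simp add: bv_def)
qed

lemma Gw_B: "set gs \<subseteq> mid \<Longrightarrow> v \<in> B U \<Longrightarrow> Gw gs v \<in> B U"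
  by (induction gs) (auto intro: G_B)

text \<open>
  Commuting \<open>e j 0\<close> with the summand \<open>e \<omega> j \<circ> e j 0\<close> of \<open>T\<close> leaves one copy of \<open>- e \<omega> 0 \<circ> e j 0\<close> for each letter.
\<close>

lemma Fw_T:
  assumes v: "v \<in> N" and "set ds \<subseteq> mid"
  shows "Fw ds (T v) = T (Fw ds v) - scale (of_nat (length ds)) (e \<omega> 0 (Fw ds v))"
  using assms(2)
proof (induction ds)
  case (Cons j ds)
  then have j: "j \<in> mid" "set ds \<subseteq> mid" by auto
  have "e j 0 (e \<omega> 0 (Fw ds v)) = e \<omega> 0 (e j 0 (Fw ds v))"
    using v j by (simp add: e_swap[of _ j 0])
  then have eq: "Fw (j # ds) (T v) = T (e j 0 (Fw ds v)) - e \<omega> 0 (e j 0 (Fw ds v))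
      - scale (of_nat (length ds)) (e \<omega> 0 (e j 0 (Fw ds v)))"
    using Cons.IH j v by (simp add: e_diff e_scale F_T)
  show ?case unfolding eq by (intro poly_mapping_eqI) (simp add: lookup_minus algebra_simps)
qed simp

lemma f_Fw: "v \<in> N \<Longrightarrow> set ds \<subseteq> mid \<Longrightarrow> Fw ds (e \<omega> 0 v) = e \<omega> 0 (Fw ds v)"
  by (induction ds) (auto simp: e_swap[of _ _ 0 \<omega> 0])

lemma f_Gw: "v \<in> N \<Longrightarrow> set gs \<subseteq> mid \<Longrightarrow> e \<omega> 0 (Gw gs v) = Gw gs (e \<omega> 0 v)"
  by (induction gs) (auto simp: e_swap[of _ \<omega> 0])

context
  fixes U :: "nat set" assumes U: "\<And>k. k \<in> U \<Longrightarrow> Suc k \<in> U"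
begin

text \<open>
  Applying the word \<open>ds\<close> to the recursion for \<open>S (Suc k)\<close> gives an equation for
  \<open>w = e \<omega> 0 (Fw ds (S k))\<close> in which \<open>w\<close> has the coefficient \<open>1 - length ds / \<tau> k\<close>. This is not zero since \<open>a2\<close> is not an
  integer, so the equation can be solved for \<open>w\<close>.
\<close>

lemma f_B:
  assumes "v \<in> B U"
  shows "e \<omega> 0 v \<in> B U"
proof (rule B_op[OF assms])
  fix k gs ds assume k: "k \<in> U" and gs: "set gs \<subseteq> mid" and ds: "set ds \<subseteq> mid"
  define w where "w = e \<omega> 0 (Fw ds (S k))"
  have eq: "Fw ds (S (Suc k)) = w + scale (1 / \<tau> k) (T (Fw ds (S k)) - scale (of_nat (length ds)) w)"
    using ds by (simp add: w_linear Fw_T f_Fw w_def)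
  have "scale (1 - of_nat (length ds) / \<tau> k) w = Fw ds (S (Suc k)) - scale (1 / \<tau> k) (T (Fw ds (S k)))"
    unfolding eq by (intro poly_mapping_eqI) (simp add: lookup_add lookup_minus algebra_simps)
  moreover have "Fw ds (S (Suc k)) \<in> B U" using bv_B[of "Suc k" U "[]" ds] U k ds by (simp add: bv_def)
  moreover have "T (Fw ds (S k)) \<in> B U" unfolding T_def
  proof (rule B_cl)
    show "e \<omega> i (e i 0 (Fw ds (S k))) \<in> B U" if "i \<in> mid" for i
      using bv_B[of k U "[i]" "i # ds"] that k ds by (simp add: bv_def)
  qed
  ultimately have rw: "scale (1 - of_nat (length ds) / \<tau> k) w \<in> B U" by auto
  define r where "r = 1 - of_nat (length ds) / \<tau> k"
  have "r \<noteq> 0" using \<tau>_minus_nz[of k "length ds"] by (auto simp: r_def field_simps)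
  then have "w \<in> B U" using B_cl(3)[OF rw[folded r_def], of "1 / r"] by simp
  then show "e \<omega> 0 (bv k gs ds) \<in> B U" using gs ds by (simp add: bv_def f_Gw Gw_B w_def)
qed

lemma F_B:
  assumes j: "j \<in> mid" and "v \<in> B U"
  shows "e j 0 v \<in> B U"
proof (rule B_op[OF assms(2)])
  fix k gs ds assume k: "k \<in> U" and gs: "set gs \<subseteq> mid" and ds: "set ds \<subseteq> mid"
  from gs show "e j 0 (bv k gs ds) \<in> B U"
  proof (induction gs)
    case Nil
    then show ?case using bv_B[of k U "[]" "j # ds"] j k ds by (simp add: bv_def)
  next
    case (Cons i gs)
    then have i: "i \<in> mid" "set gs \<subseteq> mid" by auto
    have "e j 0 (bv k (i # gs) ds) = e \<omega> i (e j 0 (bv k gs ds)) - (if i = j then e \<omega> 0 (bv k gs ds) else 0)"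
      using e_swap[of "bv k gs ds" j 0 \<omega> i] i j ds by (auto simp: bv_def)
    then show ?case using Cons i k ds by (auto intro!: B_cl G_B f_B bv_B)
  qed
qed

lemma levi_B:
  assumes i: "i \<in> mid" and j: "j \<in> mid" and "v \<in> B U"
  shows "e i j v \<in> B U"
proof (rule B_op[OF assms(3)])
  fix k gs ds assume k: "k \<in> U" and gs: "set gs \<subseteq> mid" and ds: "set ds \<subseteq> mid"
  have F: "e i j (Fw ds (S k)) \<in> B U" using ds
  proof (induction ds)
    case Nil
    have "- S k \<in> B U" using B_cl(3)[OF bv_B[of k U "[]" "[]"], of "-1"] k by (simp add: bv_def)
    then show ?case using S_levi[OF i j] by auto
  next
    case (Cons l ds)
    then have l: "l \<in> mid" "set ds \<subseteq> mid" by auto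
    have "e i j (Fw (l # ds) (S k)) = e l 0 (e i j (Fw ds (S k))) + (if j = l then e i 0 (Fw ds (S k)) else 0)"
      using e_swap[of "Fw ds (S k)" i j l 0] l i j by auto
    moreover have "Fw ds (S k) \<in> B U" using bv_B[of k U "[]" ds] k l by (simp add: bv_def)
    ultimately show ?case using Cons l i by (auto intro!: B_cl F_B)
  qed
  from gs show "e i j (bv k gs ds) \<in> B U"
  proof (induction gs)
    case Nil
    then show ?case using F by (simp add: bv_def)
  next
    case (Cons l gs)
    then have l: "l \<in> mid" "set gs \<subseteq> mid" by auto
    have "e i j (bv k (l # gs) ds) = e \<omega> l (e i j (bv k gs ds)) - (if l = i then e \<omega> j (bv k gs ds) else 0)"
      using e_swap[of "bv k gs ds" i j \<omega> l] l i j ds by (auto simp: bv_def)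
    then show ?case using Cons l j k ds by (auto intro!: B_cl G_B bv_B)
  qed
qed

lemma lower_B:
  assumes ij: "j < i" "i < n" and v: "v \<in> B U"
  shows "e i j v \<in> B U"
proof -
  consider "i = \<omega>" "j = 0" | "i = \<omega>" "j \<in> mid" | "i \<in> mid" "j = 0" | "i \<in> mid" "j \<in> mid"
    using ij by (cases "i = \<omega>"; cases "j = 0") (auto simp: mid_def \<omega>_def)
  then show ?thesis
    by cases (use v in \<open>auto intro: f_B G_B F_B levi_B\<close>)
qed

end

lemma bv_in_closed:
  assumes S: "S m \<in> W" and k: "m \<le> k" and gs: "set gs \<subseteq> mid" and ds: "set ds \<subseteq> mid"
    and lower: "\<And>i j v. j < i \<Longrightarrow> i < n \<Longrightarrow> v \<in> W \<Longrightarrow> e i j v \<in> W" and W: "cvs.subspace W"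
  shows "bv k gs ds \<in> W"
proof -
  have "S k \<in> W" using k
  proof (induction k rule: dec_induct)
    case (step k)
    then have "T (S k) \<in> W" unfolding T_def
      by (intro cvs.subspace_sum[OF W]) (auto intro!: lower)
    then show ?case using step
      by (auto intro!: cvs.subspace_add[OF W] cvs.subspace_scale[OF W] lower)
  qed (rule S)
  then have "Fw ds (S k) \<in> W" using ds by (induction ds) (auto intro!: lower)
  then show ?thesis unfolding bv_def using gs by (induction gs) (auto intro!: lower)
qed

lemma B_least:
  assumes "S m \<in> W" "\<And>i j v. j < i \<Longrightarrow> i < n \<Longrightarrow> v \<in> W \<Longrightarrow> e i j v \<in> W" "cvs.subspace W"
  shows "B {m..} \<subseteq> W"
proof
  show "v \<in> W" if "v \<in> B {m..}" for v
    using that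
  proof (induction rule: B_induct)
    case (gen k gs ds)
    then show ?case by (intro bv_in_closed[OF assms(1) _ _ _ assms(2,3)]) auto
  qed (use cvs.subspace_add[OF assms(3)] cvs.subspace_scale[OF assms(3)] cvs.subspace_0[OF assms(3)] in auto)
qed

section \<open>Coefficient functionals\<close>

text \<open>
  The tuple of the monomial with \<open>k\<close> units moved out of the first entry, multiplicities \<open>\<gamma>\<close> moved out of the
  middle entries of the first half, and all of this moved into the entry \<open>\<omega>\<close>. The second half is that of
  \<open>x(b,0)\<close>: these are the tuples at which all variables \<open>z_i\<close> are absent.
\<close>

definition bt :: "nat \<Rightarrow> nat multiset \<Rightarrow> complex vec" where
  "bt k \<gamma> = vec (2 * n) (\<lambda>i. if i = 0 then -1 - of_nat k else if i < \<omega> then -1 - of_nat (count \<gamma> i)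
     else if i = \<omega> then a1 + of_int b + of_nat (k + size \<gamma>) else if i = n then a2 - of_int b else 0)"

definition cf where "cf v k \<gamma> = lk v (bt k \<gamma>)"

lemma bt_carrier [simp]: "bt k \<gamma> \<in> carrier_vec (2 * n)"
  by (simp add: bt_def)

lemma cf_linear: "cf (v + w) k \<gamma> = cf v k \<gamma> + cf w k \<gamma>" "cf (scale r v) k \<gamma> = r * cf v k \<gamma>"
  "cf (v - w) k \<gamma> = cf v k \<gamma> - cf w k \<gamma>" "cf (- v) k \<gamma> = - cf v k \<gamma>" "cf 0 k \<gamma> = 0" "cf (sum h A) k \<gamma> = (\<Sum>a\<in>A. cf (h a) k \<gamma>)"
  by (simp_all add: cf_def lookup_add lookup_minus lookup_sum)

lemma \<omega>_bounds: "\<omega> < n" "n + \<omega> < 2 * n" "\<omega> < 2 * n" "n < n + \<omega>" "n - Suc 0 = \<omega>" "0 < \<omega>" "Suc \<omega> = n"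
  using n2 by (auto simp: \<omega>_def)

lemma bt_idx:
  "bt k \<gamma> $ 0 = -1 - of_nat k" "i \<in> mid \<Longrightarrow> bt k \<gamma> $ i = -1 - of_nat (count \<gamma> i)"
  "bt k \<gamma> $ \<omega> = a1 + of_int b + of_nat (k + size \<gamma>)" "bt k \<gamma> $ n = a2 - of_int b"
  "n < i \<Longrightarrow> i < 2 * n \<Longrightarrow> bt k \<gamma> $ i = 0"
  using \<omega>_bounds n2 by (auto simp: bt_def mid_def)

lemma qc_pc_values:
  "qc (-1 - of_nat m - 1) = - of_nat (Suc m)" "pc (- of_nat m) = (if m = 0 then 0 else 1)"
  "qc (a1 + of_int k + of_nat m - 1) = 1" "pc (a1 + of_int k + of_nat m + 1) = a1 + of_int k + of_nat m + 1"
proof -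
  have "neg_integer (-1 - of_nat m - 1)" by (auto simp: neg_integer_def)
  then show "qc (-1 - of_nat m - 1) = - of_nat (Suc m)" by (simp add: qc_def)
  show "pc (- of_nat m) = (if m = 0 then 0 else 1)" by (auto simp: pc_def neg_integer_def)
  have "a1 + of_int k + of_nat m - 1 \<notin> \<int>" "a1 + of_int k + of_nat m + 1 \<notin> \<int>"
    using nonint(2)[of k m] by (metis Ints_1 Ints_add diff_add_cancel, metis Ints_1 Ints_diff add_diff_cancel_right')
  then show "qc (a1 + of_int k + of_nat m - 1) = 1" "pc (a1 + of_int k + of_nat m + 1) = a1 + of_int k + of_nat m + 1"
    by (simp_all add: qc_def pc_def neg_integer_def)
qed

lemma lk_nonadmissible:
  assumes "v \<in> N" "n < i" "i < 2 * n" "Re (\<beta> $ i) < 0"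
  shows "lk v \<beta> = 0"
  using assms unfolding N_carrier admissible_def by (metis Suc_eq_plus1 Suc_leI atLeastLessThan_iff linorder_not_less)

text \<open>
  To reach one of the tuples \<open>bt k \<gamma>\<close> through the second half, one would have to start with the entry \<open>-1\<close> at a
  position at which only non-negative entries are admissible.
\<close>

lemma cf_lower_half:
  assumes v: "v \<in> N" and i: "0 < i" "i < n" and j: "j < n" "i \<noteq> j"
  shows "lk (eop n (n + i) (n + j) v) (bt k \<gamma>) = 0"
proof -
  have "lk v (bt k \<gamma> - unit_vec (2 * n) (n + i) + unit_vec (2 * n) (n + j)) = 0"
    by (rule lk_nonadmissible[OF v, of "n + i"]) (use i j in \<open>auto simp: bt_idx\<close>)
  then show ?thesis using lookup_eop[OF subsetD[OF N_supp v], of "n + i" "n + j" "bt k \<gamma>"] i j by simp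
qed

lemma cf_e:
  assumes v: "v \<in> N" and i: "0 < i" "i < n" and j: "j < n" "i \<noteq> j"
  shows "cf (e i j v) k \<gamma> = qc (bt k \<gamma> $ i - 1) * pc (bt k \<gamma> $ j + 1) * lk v (bt k \<gamma> - unit_vec (2 * n) i + unit_vec (2 * n) j)"
  using lookup_eop[OF subsetD[OF N_supp v], of i j "bt k \<gamma>"] cf_lower_half[OF assms] i j
  by (simp add: cf_def e_def lookup_add)

lemma bt_shift:
  assumes i: "i \<in> mid"
  shows "bt k \<gamma> - unit_vec (2 * n) i + unit_vec (2 * n) \<omega> = bt k (add_mset i \<gamma>)"
    "bt k (add_mset i \<gamma>) - unit_vec (2 * n) \<omega> + unit_vec (2 * n) i = bt k \<gamma>"
    "bt (Suc k) \<gamma> - unit_vec (2 * n) \<omega> + unit_vec (2 * n) 0 = bt k \<gamma>"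
    "bt (Suc k) \<gamma> - unit_vec (2 * n) i + unit_vec (2 * n) 0 = bt k (add_mset i \<gamma>)"
proof -
  have "i < n" by (rule mid_neq(7)[OF i])
  then have "i < 2 * n" by linarith
  then have b: "0 < i" "i < \<omega>" "i < 2 * n" "\<omega> < 2 * n" "0 < n" using i \<omega>_bounds(3) n2 by auto
  show "bt k \<gamma> - unit_vec (2 * n) i + unit_vec (2 * n) \<omega> = bt k (add_mset i \<gamma>)"
    by (rule eq_vecI) (use b in \<open>auto simp: bt_def\<close>)
  show "bt k (add_mset i \<gamma>) - unit_vec (2 * n) \<omega> + unit_vec (2 * n) i = bt k \<gamma>"
    by (rule eq_vecI) (use b in \<open>auto simp: bt_def\<close>)
  show "bt (Suc k) \<gamma> - unit_vec (2 * n) \<omega> + unit_vec (2 * n) 0 = bt k \<gamma>"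
    by (rule eq_vecI) (use b in \<open>auto simp: bt_def\<close>)
  show "bt (Suc k) \<gamma> - unit_vec (2 * n) i + unit_vec (2 * n) 0 = bt k (add_mset i \<gamma>)"
    by (rule eq_vecI) (use b in \<open>auto simp: bt_def\<close>)
qed

lemma bt_coeff:
  "i \<in> mid \<Longrightarrow> qc (bt k \<gamma> $ i - 1) = - of_nat (Suc (count \<gamma> i))"
  "qc (bt k \<gamma> $ \<omega> - 1) = 1" "pc (bt k \<gamma> $ 0 + 1) = (if k = 0 then 0 else 1)"
  "i \<in> mid \<Longrightarrow> pc (bt k \<gamma> $ i + 1) = (if i \<in># \<gamma> then 1 else 0)"
  "pc (bt k \<gamma> $ \<omega> + 1) = a1 + of_int b + of_nat (k + size \<gamma>) + 1"
proof -
  have "bt k \<gamma> $ 0 + 1 = - of_nat k" "i \<in> mid \<Longrightarrow> bt k \<gamma> $ i + 1 = - of_nat (count \<gamma> i)"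
    by (simp_all add: bt_idx)
  then show "pc (bt k \<gamma> $ 0 + 1) = (if k = 0 then 0 else 1)"
    "i \<in> mid \<Longrightarrow> pc (bt k \<gamma> $ i + 1) = (if i \<in># \<gamma> then 1 else 0)"
    using qc_pc_values(2) by (simp_all add: count_eq_zero_iff)
  show "i \<in> mid \<Longrightarrow> qc (bt k \<gamma> $ i - 1) = - of_nat (Suc (count \<gamma> i))"
    unfolding bt_idx(2) by (rule qc_pc_values(1))
  show "qc (bt k \<gamma> $ \<omega> - 1) = 1" "pc (bt k \<gamma> $ \<omega> + 1) = a1 + of_int b + of_nat (k + size \<gamma>) + 1"
    unfolding bt_idx(3) by (rule qc_pc_values(3), rule qc_pc_values(4))
qed

lemma cf_G:
  assumes v: "v \<in> N" and j: "j \<in> mid"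
  shows "cf (e \<omega> j v) k \<gamma> = (if j \<in># \<gamma> then cf v k (\<gamma> - {#j#}) else 0)"
proof (cases "j \<in># \<gamma>")
  case True
  then obtain \<gamma>' where \<gamma>: "\<gamma> = add_mset j \<gamma>'" by (metis insert_DiffM)
  show ?thesis using cf_e[OF v, of \<omega> j k \<gamma>] j bt_shift(2)[OF j, of k \<gamma>'] True
    by (simp add: bt_coeff cf_def \<gamma>)
next
  case False
  then show ?thesis using cf_e[OF v, of \<omega> j k \<gamma>] j by (simp add: bt_coeff)
qed

lemma cf_f:
  assumes v: "v \<in> N"
  shows "cf (e \<omega> 0 v) k \<gamma> = (case k of 0 \<Rightarrow> 0 | Suc k' \<Rightarrow> cf v k' \<gamma>)"
proof -
  have "1 \<in> mid" using n2 by (auto simp: mid_def \<omega>_def)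
  from bt_shift(3)[OF this] show ?thesis using cf_e[OF v, of \<omega> 0 k \<gamma>]
    by (cases k) (simp_all add: bt_coeff cf_def)
qed

lemma cf_F:
  assumes v: "v \<in> N" and i: "i \<in> mid"
  shows "cf (e i 0 v) k \<gamma> = (case k of 0 \<Rightarrow> 0 | Suc k' \<Rightarrow> - of_nat (Suc (count \<gamma> i)) * cf v k' (add_mset i \<gamma>))"
  using cf_e[OF v, of i 0 k \<gamma>] i bt_shift(4)[OF i]
  by (cases k) (simp_all add: bt_coeff cf_def)

lemma cf_R:
  assumes v: "v \<in> N" and i: "i \<in> mid"
  shows "cf (e i \<omega> v) k \<gamma> = - of_nat (Suc (count \<gamma> i)) * (a1 + of_int b + of_nat (k + size \<gamma>) + 1) * cf v k (add_mset i \<gamma>)"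
  using cf_e[OF v, of i \<omega> k \<gamma>] i bt_shift(1)[OF i] by (simp add: bt_coeff cf_def)

text \<open>
  In the coefficients without \<open>z_i\<close> the operator \<open>e \<omega> 0\<close> raises \<open>k\<close> by one, and \<open>T\<close> contributes nothing, as
  \<open>e i 0\<close> is there the derivation by \<open>y_i\<close> up to a factor.
\<close>

lemma cf_S: "cf (S k) k' \<gamma> = (if k' = k \<and> \<gamma> = {#} then 1 else 0)" if "set_mset \<gamma> \<subseteq> mid"
  using that
proof (induction k arbitrary: k' \<gamma>)
  case 0
  have "tuple n (a1 + of_int b) (a2 - of_int b) = bt k' \<gamma> \<longleftrightarrow> k' = 0 \<and> \<gamma> = {#}"
  proof
    assume eq: "tuple n (a1 + of_int b) (a2 - of_int b) = bt k' \<gamma>"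
    have "tuple n (a1 + of_int b) (a2 - of_int b) $ 0 = -1" "tuple n (a1 + of_int b) (a2 - of_int b) $ \<omega> = a1 + of_int b"
      using n2 by (simp_all add: tuple_def \<omega>_def)
    then have "bt k' \<gamma> $ 0 = -1" "bt k' \<gamma> $ \<omega> = a1 + of_int b" unfolding eq .
    then have "k' = 0" "of_nat (k' + size \<gamma>) = (0 :: complex)" by (simp_all add: bt_idx del: of_nat_add)
    then have "k' = 0" "k' + size \<gamma> = 0" by (simp_all only: of_nat_eq_0_iff)
    then show "k' = 0 \<and> \<gamma> = {#}" by simp
  next
    assume "k' = 0 \<and> \<gamma> = {#}"
    then show "tuple n (a1 + of_int b) (a2 - of_int b) = bt k' \<gamma>"
      using \<omega>_bounds by (auto simp: vec_eq_iff tuple_def bt_def)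
  qed
  then show ?case by (simp add: cf_def x_b0_def basis_elt_def lookup_single when_def)
next
  case (Suc k)
  have T: "cf (T (S k)) k' \<gamma> = 0"
  proof -
    have "cf (e \<omega> i (e i 0 (S k))) k' \<gamma> = 0" if i: "i \<in> mid" for i
    proof -
      have "cf (S k) m (add_mset i (\<gamma> - {#i#})) = 0" for m
        using Suc.prems i by (subst Suc.IH) (auto dest: in_diffD)
      then show ?thesis using i by (auto simp: cf_G cf_F split: nat.split)
    qed
    then show ?thesis by (simp add: T_def cf_linear)
  qed
  show ?case using Suc.prems Suc.IH by (auto simp: cf_linear T cf_f split: nat.split)
qed

lemma cf_Fw_S:
  assumes "set ds \<subseteq> mid" "set_mset \<gamma> \<subseteq> mid"
  shows "cf (Fw ds (S k)) k' \<gamma> = (if ds = [] \<and> k' = k \<and> \<gamma> = {#} then 1 else 0)"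
  using assms
proof (induction ds arbitrary: k' \<gamma>)
  case Nil
  then show ?case by (simp add: cf_S)
next
  case (Cons i ds)
  then show ?case by (auto simp: cf_F split: nat.split)
qed

lemma cf_Gw:
  assumes "v \<in> N" "set gs \<subseteq> mid"
  shows "cf (Gw gs v) k \<gamma> = (if mset gs \<subseteq># \<gamma> then cf v k (\<gamma> - mset gs) else 0)"
  using assms(2)
proof (induction gs arbitrary: \<gamma>)
  case (Cons i gs)
  have "mset (i # gs) \<subseteq># \<gamma> \<longleftrightarrow> i \<in># \<gamma> \<and> mset gs \<subseteq># \<gamma> - {#i#}"
    by (metis insert_subset_eq_iff mset.simps(2))
  then show ?case using Cons assms(1) by (auto simp: cf_G)
qed simp

section \<open>The dual functionals\<close>

text \<open>
  In the polynomial picture a word of derivations by the variables \<open>z_j\<close>.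
\<close>

definition Pw where "Pw es v = fold (\<lambda>j. e 0 j) es v"

lemma Pw_simps [simp]: "Pw [] v = v" "Pw (j # es) v = Pw es (e 0 j v)"
  by (simp_all add: Pw_def)

lemma Pw_linear: "Pw es (v + w) = Pw es v + Pw es w" "Pw es (scale r v) = scale r (Pw es v)" "Pw es 0 = 0" "Pw es (v - w) = Pw es v - Pw es w"
  by (induction es arbitrary: v w) (auto simp: e_add e_scale e_diff)

lemma Pw_Gw: "v \<in> N \<Longrightarrow> set es \<subseteq> mid \<Longrightarrow> set gs \<subseteq> mid \<Longrightarrow> Pw es (Gw gs v) = Gw gs (Pw es v)"
proof (induction es arbitrary: v)
  case (Cons j es)
  have "e 0 j (Gw gs v) = Gw gs (e 0 j v)"
    using Cons.prems by (induction gs) (auto simp: e_swap[of _ 0 j])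
  then show ?case using Cons by auto
qed simp

lemma levi_Fw:
  assumes i: "i \<in> mid" and j: "j \<in> mid" and "set ds \<subseteq> mid"
  shows "e i j (Fw ds (S k)) = scale (of_nat (count (mset ds) j)) (Fw (i # remove1 j ds) (S k)) - (if i = j then Fw ds (S k) else 0)"
  using assms(3)
proof (induction ds)
  case Nil
  then show ?case using S_levi[OF i j, of k] by simp
next
  case (Cons l ds)
  then have l: "l \<in> mid" "set ds \<subseteq> mid" by auto
  have r: "set (remove1 j ds) \<subseteq> mid" using l by (metis set_remove1_subset subset_trans)
  have "e i j (Fw (l # ds) (S k)) = e l 0 (e i j (Fw ds (S k))) + (if j = l then e i 0 (Fw ds (S k)) else 0)"
    using e_swap[of "Fw ds (S k)" i j l 0] l i j by auto
  also have "\<dots> = scale (of_nat (count (mset ds) j)) (e l 0 (e i 0 (Fw (remove1 j ds) (S k)))) - (if i = j then Fw (l # ds) (S k) else 0)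
      + (if j = l then e i 0 (Fw ds (S k)) else 0)"
    using Cons.IH l by (auto simp: e_diff e_scale)
  also have "e l 0 (e i 0 (Fw (remove1 j ds) (S k))) = e i 0 (e l 0 (Fw (remove1 j ds) (S k)))"
    using l i r by (simp add: e_swap[of _ l 0 i 0])
  finally have 1: "e i j (Fw (l # ds) (S k)) = scale (of_nat (count (mset ds) j)) (e i 0 (e l 0 (Fw (remove1 j ds) (S k))))
      - (if i = j then Fw (l # ds) (S k) else 0) + (if j = l then e i 0 (Fw ds (S k)) else 0)" .
  show ?case
  proof (cases "j = l")
    case True
    have 2: "scale (of_nat (count (mset ds) j)) (e i 0 (e l 0 (Fw (remove1 j ds) (S k)))) = scale (of_nat (count (mset ds) j)) (e i 0 (Fw ds (S k)))"
    proof (cases "j \<in> set ds")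
      case in_ds: True
      have "Fw (l # remove1 j ds) (S k) = Fw ds (S k)"
        by (rule Fw_perm) (use l r in_ds True in auto)
      then show ?thesis by simp
    qed (simp add: count_mset)
    show ?thesis unfolding 1 2 using True
      by (intro poly_mapping_eqI) (auto simp: lookup_add lookup_minus algebra_simps)
  next
    case False
    then show ?thesis unfolding 1 by auto
  qed
qed

lemma weight_Fw:
  assumes "set ds \<subseteq> mid"
  shows "e 0 0 (Fw ds (S k)) = scale (\<tau> k - 1 - of_nat (length ds)) (Fw ds (S k))"
  using assms
proof (induction ds)
  case (Cons l ds)
  then have "e 0 0 (Fw (l # ds) (S k)) = e l 0 (e 0 0 (Fw ds (S k))) - e l 0 (Fw ds (S k))"
    using e_swap[of "Fw ds (S k)" 0 0 l 0] by auto
  moreover have "e 0 0 (Fw ds (S k)) = scale (\<tau> k - 1 - of_nat (length ds)) (Fw ds (S k))" using Cons by simp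
  ultimately have eq: "e 0 0 (Fw (l # ds) (S k)) = scale (\<tau> k - 1 - of_nat (length ds)) (Fw (l # ds) (S k)) - Fw (l # ds) (S k)"
    by (simp only: e_scale w_simps)
  show ?case unfolding eq
    by (intro poly_mapping_eqI) (simp only: lookup_minus lookup_scale, simp add: algebra_simps)
qed (simp add: S_weight)

text \<open>
  The operator \<open>e 0 j\<close> acts as a derivation: it removes one letter \<open>j\<close>, in as many ways as there are such
  letters, and the commutators with the remaining letters shift the weight.
\<close>

lemma P_Fw:
  assumes j: "j \<in> mid" and "set ds \<subseteq> mid"
  shows "e 0 j (Fw ds (S k)) = scale (of_nat (count (mset ds) j) * (\<tau> k - of_nat (length ds) + 1)) (Fw (remove1 j ds) (S k))"
  using assms(2)
proof (induction ds)
  case Nil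
  then show ?case using S_P[OF j] by simp
next
  case (Cons i ds)
  then have i: "i \<in> mid" "set ds \<subseteq> mid" by auto
  define m where "m = count (mset ds) j"
  have r: "set (remove1 j ds) \<subseteq> mid" using i by (metis set_remove1_subset subset_trans)
  have "e 0 j (Fw (i # ds) (S k)) = e i 0 (e 0 j (Fw ds (S k))) + (if j = i then e 0 0 (Fw ds (S k)) else 0) - e i j (Fw ds (S k))"
    using e_swap[of "Fw ds (S k)" 0 j i 0] i j by auto
  also have "\<dots> = scale (of_nat m * (\<tau> k - of_nat (length ds) + 1)) (Fw (i # remove1 j ds) (S k))
      + (if j = i then scale (\<tau> k - 1 - of_nat (length ds)) (Fw ds (S k)) else 0)
      - scale (of_nat m) (Fw (i # remove1 j ds) (S k)) + (if i = j then Fw ds (S k) else 0)"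
    using Cons.IH[OF i(2)] levi_Fw[OF i(1) j i(2)] weight_Fw[OF i(2)] by (auto simp: e_scale m_def)
  finally have 1: "e 0 j (Fw (i # ds) (S k)) = \<dots>" .
  show ?case
  proof (cases "j = i")
    case True
    have 2: "scale r (Fw (i # remove1 j ds) (S k)) = scale r (Fw ds (S k))" if "m = 0 \<Longrightarrow> r = 0" for r
    proof (cases "j \<in> set ds")
      case in_ds: True
      have "Fw (i # remove1 j ds) (S k) = Fw ds (S k)"
        by (rule Fw_perm) (use i r in_ds True in auto)
      then show ?thesis by simp
    next
      case False
      then have "r = 0" using that by (simp add: m_def count_mset)
      then show ?thesis by simp
    qed
    have 3: "scale (of_nat m * (\<tau> k - of_nat (length ds) + 1)) (Fw (i # remove1 j ds) (S k)) = scale (of_nat m * (\<tau> k - of_nat (length ds) + 1)) (Fw ds (S k))"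
      "scale (of_nat m) (Fw (i # remove1 j ds) (S k)) = scale (of_nat m) (Fw ds (S k))"
      by (rule 2, simp)+
    show ?thesis unfolding 1 3 using True
      by (intro poly_mapping_eqI) (simp add: m_def lookup_add lookup_minus algebra_simps)
  next
    case False
    then show ?thesis unfolding 1
      by (intro poly_mapping_eqI) (simp add: m_def lookup_add lookup_minus algebra_simps)
  qed
qed

lemma Pw_Fw:
  assumes "set es \<subseteq> mid" "set ds \<subseteq> mid"
  shows "\<exists>r ds'. Pw es (Fw ds (S k)) = scale r (Fw ds' (S k)) \<and> set ds' \<subseteq> mid \<and> (r \<noteq> 0 \<and> ds' = [] \<longleftrightarrow> mset es = mset ds)"
  using assms
proof (induction es arbitrary: ds)
  case Nil
  then show ?case by (intro exI[of _ 1] exI[of _ ds]) auto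
next
  case (Cons j es)
  have r: "set (remove1 j ds) \<subseteq> mid" using Cons.prems(2) by (metis set_remove1_subset subset_trans)
  define q where "q = of_nat (count (mset ds) j) * (\<tau> k - of_nat (length ds) + 1)"
  obtain s ds' where IH: "Pw es (Fw (remove1 j ds) (S k)) = scale s (Fw ds' (S k))" "set ds' \<subseteq> mid"
    "s \<noteq> 0 \<and> ds' = [] \<longleftrightarrow> mset es = mset (remove1 j ds)"
    using Cons.IH[OF _ r] Cons.prems by auto
  have "Pw (j # es) (Fw ds (S k)) = scale (q * s) (Fw ds' (S k))"
    using Cons.prems by (simp add: P_Fw Pw_linear IH(1) q_def)
  moreover have "q * s \<noteq> 0 \<and> ds' = [] \<longleftrightarrow> mset (j # es) = mset ds"
  proof (cases "j \<in> set ds")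
    case True
    have "q = of_nat (count (mset ds) j) * (\<tau> k - of_nat (length ds - 1))"
      unfolding q_def using True by (cases ds) auto
    then have "q \<noteq> 0" using True \<tau>_minus_nz[of k "length ds - 1"] by (simp add: count_mset count_list_0_iff del: One_nat_def)
    moreover have "mset es = mset (remove1 j ds) \<longleftrightarrow> mset (j # es) = mset ds"
      using True by (auto simp: insert_DiffM) (metis add_mset_remove_trivial)
    ultimately show ?thesis using IH(3) by auto
  next
    case False
    then have "q = 0" by (simp add: q_def count_mset)
    moreover have "mset (j # es) \<noteq> mset ds" using False by (metis list.set_intros(1) mset_eq_setD)
    ultimately show ?thesis by auto
  qed
  ultimately show ?case using IH(2) by blast
qed

text \<open>
  The derivations \<open>Pw es\<close> commute with the operators \<open>e \<omega> i\<close>. They turn \<open>Fw ds (S k)\<close> into a non-zero multiple of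
  \<open>S k\<close> if the words agree up to order; otherwise the result is zero or still contains a letter, and then it has no
  coefficient without \<open>z_i\<close>.
\<close>

lemma dual_basis:
  assumes "set es \<subseteq> mid" "set ds \<subseteq> mid" "set gs \<subseteq> mid" "set_mset \<gamma> \<subseteq> mid"
  shows "cf (Pw es (bv k' gs ds)) k \<gamma> \<noteq> 0 \<longleftrightarrow> k = k' \<and> mset gs = \<gamma> \<and> mset es = mset ds"
proof -
  obtain r ds' where r: "Pw es (Fw ds (S k')) = scale r (Fw ds' (S k'))" "set ds' \<subseteq> mid"
    "r \<noteq> 0 \<and> ds' = [] \<longleftrightarrow> mset es = mset ds" using Pw_Fw[OF assms(1,2)] by blast
  have sub: "set_mset (\<gamma> - mset gs) \<subseteq> mid" using assms(4) by (auto dest: in_diffD)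
  have "cf (Pw es (bv k' gs ds)) k \<gamma> = (if mset gs \<subseteq># \<gamma> then r * cf (Fw ds' (S k')) k (\<gamma> - mset gs) else 0)"
    unfolding bv_def using assms r(2) by (simp add: Pw_Gw r(1) cf_Gw cf_linear w_linear N_cl)
  also have "\<dots> = (if mset gs \<subseteq># \<gamma> \<and> ds' = [] \<and> k = k' \<and> \<gamma> - mset gs = {#} then r else 0)"
    using r(2) sub by (auto simp: cf_Fw_S cf_S)
  also have "mset gs \<subseteq># \<gamma> \<and> ds' = [] \<and> k = k' \<and> \<gamma> - mset gs = {#} \<longleftrightarrow> ds' = [] \<and> k = k' \<and> mset gs = \<gamma>"
    by (auto simp: Diff_eq_empty_iff_mset subset_mset.antisym)
  finally show ?thesis using r(3) by auto
qed

lemma dual_vanish: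
  assumes "v \<in> B U" "k \<notin> U" "set es \<subseteq> mid" "set_mset \<gamma> \<subseteq> mid"
  shows "cf (Pw es v) k \<gamma> = 0"
  using assms(1)
proof (induction rule: B_induct)
  case (gen k' gs ds)
  then show ?case using dual_basis[of es ds gs \<gamma> k' k] assms by blast
qed (simp_all add: Pw_linear cf_linear)

text \<open>
  The dual functionals separate the monomials, so each of them reads off one coefficient of \<open>v\<close>, up to a non-zero factor.
\<close>

lemma in_B_if_dual_vanish:
  assumes v: "v \<in> B UNIV"
    and van: "\<And>k \<gamma> es. k \<notin> U \<Longrightarrow> set es \<subseteq> mid \<Longrightarrow> set_mset \<gamma> \<subseteq> mid \<Longrightarrow> cf (Pw es v) k \<gamma> = 0"
  shows "v \<in> B U"
proof -
  \<comment> \<open>The vector \<open>bv k gs ds\<close> depends on the words only up to order; sorting them gives one vector for each index.\<close>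
  define bw where "bw = (\<lambda>(k, \<gamma>, \<delta>). bv k (sorted_list_of_multiset \<gamma>) (sorted_list_of_multiset \<delta>))"
  define K where "K = {(k :: nat, \<gamma>, \<delta>). set_mset \<gamma> \<subseteq> mid \<and> set_mset \<delta> \<subseteq> mid}"
  have "gens UNIV \<subseteq> bw ` K"
  proof
    fix w assume "w \<in> gens UNIV"
    then obtain k gs ds where w: "w = bv k gs ds" "set gs \<subseteq> mid" "set ds \<subseteq> mid" by (auto simp: gens_def)
    have "Fw ds (S k) = Fw (sorted_list_of_multiset (mset ds)) (S k)" by (rule Fw_perm) (use w in auto)
    moreover have "Gw gs (Fw ds (S k)) = Gw (sorted_list_of_multiset (mset gs)) (Fw ds (S k))" by (rule Gw_perm) (use w in auto)
    ultimately have "w = bw (k, mset gs, mset ds)" by (simp add: bw_def w bv_def)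
    then show "w \<in> bw ` K" using w by (auto simp: K_def)
  qed
  then have "v \<in> cvs.span (bw ` K)" using v cvs.span_mono unfolding B_def by blast
  then obtain t r where t: "finite t" "t \<subseteq> bw ` K" "v = (\<Sum>a\<in>t. scale (r a) a)"
    unfolding cvs.span_explicit by auto
  obtain A where A: "A \<subseteq> K" "inj_on bw A" "t = bw ` A" using t(2) by (metis subset_image_inj)
  have fA: "finite A" using t(1) A by (simp add: finite_image_iff)
  have v_eq: "v = (\<Sum>\<kappa>\<in>A. scale (r (bw \<kappa>)) (bw \<kappa>))" using t(3) A by (simp add: sum.reindex)
  have "r (bw (k, \<gamma>, \<delta>)) = 0" if \<kappa>: "(k, \<gamma>, \<delta>) \<in> A" "k \<notin> U" for k \<gamma> \<delta>
  proof -
    define es where "es = sorted_list_of_multiset \<delta>"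
    have es: "mset es = \<delta>" "set es \<subseteq> mid" "set_mset \<gamma> \<subseteq> mid" using \<kappa> A(1) by (auto simp: es_def K_def)
    have d: "cf (Pw es (bw \<kappa>)) k \<gamma> \<noteq> 0 \<longleftrightarrow> \<kappa> = (k, \<gamma>, \<delta>)" if "\<kappa> \<in> A" for \<kappa>
    proof -
      obtain k' \<gamma>' \<delta>' where "\<kappa> = (k', \<gamma>', \<delta>')" by (cases \<kappa>)
      then show ?thesis using dual_basis[of es "sorted_list_of_multiset \<delta>'" "sorted_list_of_multiset \<gamma>'" \<gamma> k' k] that A(1) es
        by (auto simp: bw_def K_def)
    qed
    have Psum: "Pw es (\<Sum>\<kappa>\<in>A'. scale (r (bw \<kappa>)) (bw \<kappa>)) = (\<Sum>\<kappa>\<in>A'. scale (r (bw \<kappa>)) (Pw es (bw \<kappa>)))" for A'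
      by (induction A' rule: infinite_finite_induct) (simp_all add: Pw_linear)
    have "0 = cf (Pw es v) k \<gamma>" using van \<kappa> es by simp
    also have "\<dots> = (\<Sum>\<kappa>\<in>A. r (bw \<kappa>) * cf (Pw es (bw \<kappa>)) k \<gamma>)" by (simp add: v_eq Psum cf_linear)
    also have "\<dots> = (\<Sum>\<kappa>\<in>{(k, \<gamma>, \<delta>)}. r (bw \<kappa>) * cf (Pw es (bw \<kappa>)) k \<gamma>)"
      by (rule sum.mono_neutral_right) (use fA \<kappa> d in auto)
    finally show ?thesis using d[OF \<kappa>(1)] by simp
  qed
  moreover have "bw (k, \<gamma>, \<delta>) \<in> B U" if "(k, \<gamma>, \<delta>) \<in> A" "k \<in> U" for k \<gamma> \<delta>
    using subsetD[OF A(1) that(1)] that(2) by (simp add: bw_def K_def bv_B)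
  ultimately have "scale (r (bw \<kappa>)) (bw \<kappa>) \<in> B U" if "\<kappa> \<in> A" for \<kappa>
    using that by (cases \<kappa>) (metis B_cl(3) B_cl(4) cvs.scale_zero_left)
  then show ?thesis unfolding v_eq by (rule B_cl)
qed

lemma B_empty: "B {} = {0}"
  by (simp add: B_def gens_def)

section \<open>Singular vectors\<close>

text \<open>
  The case of an empty \<open>U\<close> describes the singular vectors; otherwise \<open>U\<close> is the set of all \<open>k\<close> with \<open>m \<le> k\<close>, and the vectors that are
  singular modulo the submodule \<open>B U\<close> are described. The functionals that contain some \<open>e 0 j\<close> vanish on \<open>v\<close> modulo \<open>B U\<close> by the
  assumption on \<open>e 0 j\<close>, and those for a non-empty \<open>\<gamma>\<close> by the assumption on \<open>e i \<omega>\<close>, which acts on these coefficients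
  as the derivation by \<open>y_i\<close> up to a non-zero factor. What remains is a combination of the \<open>S k\<close>, on which \<open>e 0 \<omega>\<close> is known.
\<close>

lemma singular_vectors:
  assumes v: "v \<in> B UNIV" and U: "\<And>k. k \<in> U \<Longrightarrow> Suc k \<in> U"
    and EU: "\<And>w. w \<in> B U \<Longrightarrow> e 0 \<omega> w \<in> B U"
    and P: "\<And>j. j \<in> mid \<Longrightarrow> e 0 j v \<in> B U" and R: "\<And>i. i \<in> mid \<Longrightarrow> e i \<omega> v \<in> B U" and E: "e 0 \<omega> v \<in> B U"
  shows "\<exists>A. finite A \<and> (\<forall>k\<in>A. k \<notin> U \<and> of_nat k * (c + of_nat k) = 0) \<and> v - (\<Sum>k\<in>A. scale (cf v k {#}) (S k)) \<in> B U"
proof -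
  \<comment> \<open>The exponents \<open>k\<close> of the part of \<open>v\<close> that is a polynomial in \<open>s\<close>.\<close>
  define A where "A = {k. k \<notin> U \<and> cf v k {#} \<noteq> 0}"
  have "finite A"
  proof (rule finite_imageD)
    show "finite ((\<lambda>k. bt k {#}) ` A)"
      by (rule finite_subset[of _ "Poly_Mapping.keys v"]) (auto simp: A_def cf_def in_keys_iff)
    show "inj_on (\<lambda>k. bt k {#}) A"
    proof (rule inj_onI)
      fix k k' assume "bt k {#} = bt k' {#}"
      then have "bt k {#} $ 0 = bt k' {#} $ 0" by simp
      then show "k = k'" by (simp add: bt_idx)
    qed
  qed
  define w where "w = (\<Sum>k\<in>A. scale (cf v k {#}) (S k))"
  have wB: "v - w \<in> B U"
  proof (rule in_B_if_dual_vanish)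
    have "S k \<in> B UNIV" for k using bv_B[of k UNIV "[]" "[]"] by (simp add: bv_def)
    then show "v - w \<in> B UNIV" unfolding w_def using v by (auto intro!: B_cl)
    fix k \<gamma> es assume k: "k \<notin> U" and es: "set es \<subseteq> mid" and \<gamma>: "set_mset \<gamma> \<subseteq> mid"
    have sumw: "cf w k \<gamma> = (if \<gamma> = {#} then cf v k {#} else 0)"
    proof -
      have "cf w k \<gamma> = (\<Sum>k'\<in>A. if k' = k then (if \<gamma> = {#} then cf v k {#} else 0) else 0)"
        unfolding w_def cf_linear by (rule sum.cong) (use \<gamma> in \<open>auto simp: cf_S\<close>)
      also have "\<dots> = (if \<gamma> = {#} then cf v k {#} else 0)" using \<open>finite A\<close> k by (auto simp: A_def)
      finally show ?thesis .
    qed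
    show "cf (Pw es (v - w)) k \<gamma> = 0"
    proof (cases es)
      case (Cons j es')
      have "e 0 j w = 0" using es Cons by (simp add: w_def e_sum e_scale S_P)
      then show ?thesis using dual_vanish[OF P k, of j es' \<gamma>] es \<gamma> Cons by (simp add: e_diff)
    next
      case Nil
      show ?thesis
      proof (cases "\<gamma> = {#}")
        case True
        then show ?thesis using sumw Nil by (simp add: cf_linear)
      next
        case False
        then obtain i \<gamma>' where \<gamma>': "\<gamma> = add_mset i \<gamma>'" by (metis multiset_cases)
        then have i: "i \<in> mid" "set_mset \<gamma>' \<subseteq> mid" using \<gamma> by auto
        have "cf (e i \<omega> v) k \<gamma>' = 0" using dual_vanish[OF R[OF i(1)] k, of "[]" \<gamma>'] i by simp
        moreover have "a1 + of_int b + of_nat (k + size \<gamma>') + 1 \<noteq> 0"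
          using nonint(1)[of b "Suc (k + size \<gamma>')"] by (simp add: algebra_simps)
        moreover have "v \<in> N" using v B_N by blast
        ultimately have "cf v k \<gamma> = 0" using cf_R[of v i k \<gamma>'] i \<gamma>' by (simp del: of_nat_Suc)
        then show ?thesis using sumw False Nil by (simp add: cf_linear)
      qed
    qed
  qed
  have Ew: "e 0 \<omega> w \<in> B U"
  proof -
    have "e 0 \<omega> w = e 0 \<omega> v - e 0 \<omega> (v - w)" by (simp add: e_diff)
    then show ?thesis using E EU[OF wB] by (auto intro: B_cl)
  qed
  have "of_nat k * (c + of_nat k) = 0" if k: "k \<in> A" for k
  proof (cases k)
    case (Suc m)
    have m: "m \<notin> U" using k U[of m] Suc by (auto simp: A_def)
    have "0 = cf (e 0 \<omega> w) m {#}" using dual_vanish[OF Ew m, of "[]" "{#}"] by simp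
    also have "\<dots> = (\<Sum>k'\<in>A. cf v k' {#} * (- of_nat k' * (c + of_nat k')) * cf (S (k' - 1)) m {#})"
      by (simp add: w_def e_sum e_scale S_E cf_linear)
    also have "\<dots> = (\<Sum>k'\<in>A. if k' = k then cf v k {#} * (- of_nat k * (c + of_nat k)) else 0)"
    proof (rule sum.cong[OF refl])
      show "cf v k' {#} * (- of_nat k' * (c + of_nat k')) * cf (S (k' - 1)) m {#} =
          (if k' = k then cf v k {#} * (- of_nat k * (c + of_nat k)) else 0)" for k'
        using Suc by (cases k') (auto simp: cf_S)
    qed
    also have "\<dots> = cf v k {#} * (- of_nat k * (c + of_nat k))" using \<open>finite A\<close> k by simp
    finally show ?thesis using k by (auto simp: A_def)
  qed simp
  then show ?thesis using \<open>finite A\<close> wB by (intro exI[of _ A]) (auto simp: A_def w_def)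
qed

section \<open>Local nilpotency of the raising operators\<close>

text \<open>
  Weights of the entries, chosen so that both summands of each raising operator \<open>e 0 j\<close>, \<open>e i \<omega>\<close>, \<open>e 0 \<omega>\<close> lower the
  weighted sum of the entries, while this sum is not negative on admissible tuples.
\<close>

definition wt :: "nat \<Rightarrow> real" where
  "wt i = (if i = 0 then -2 else if i < \<omega> then -1 else if i \<le> n then 0 else if i < n + \<omega> then 1 else 2)"

definition wd :: "complex vec \<Rightarrow> real" where "wd \<beta> = (\<Sum>i<2 * n. wt i * Re (\<beta> $ i))"

definition below :: "nat \<Rightarrow> (complex vec \<Rightarrow>\<^sub>0 complex) set" where
  "below d = {v \<in> N. \<forall>\<beta>. lk v \<beta> \<noteq> 0 \<longrightarrow> wd \<beta> < real d}"

lemma wd_nonneg: "admissible n a1 a2 \<beta> \<Longrightarrow> 0 \<le> wd \<beta>"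
  unfolding wd_def
proof (rule sum_nonneg)
  fix i assume adm: "admissible n a1 a2 \<beta>" and i: "i \<in> {..<2 * n}"
  have "i < n - 1 \<or> (i = \<omega> \<or> i = n) \<or> i \<in> {n + 1..<2 * n}" using i n2 by (auto simp: \<omega>_def)
  then consider "i < n - 1" | "i = \<omega> \<or> i = n" | "i \<in> {n + 1..<2 * n}" by blast
  then show "0 \<le> wt i * Re (\<beta> $ i)"
  proof cases
    case 1
    then have "Re (\<beta> $ i) < 0" "wt i < 0" using adm by (auto simp: admissible_def wt_def \<omega>_def)
    then show ?thesis by (simp add: mult_nonpos_nonpos)
  next
    case 2
    moreover have "\<omega> \<le> n" "\<not> n < \<omega>" using \<omega>_bounds(1) by linarith+
    ultimately show ?thesis using n2 by (auto simp: wt_def)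
  next
    case 3
    then have "Re (\<beta> $ i) \<ge> 0" "wt i \<ge> 0" using adm by (auto simp: admissible_def wt_def \<omega>_def)
    then show ?thesis by simp
  qed
qed

lemma below_0: "v \<in> below 0 \<Longrightarrow> v = 0"
  unfolding below_def N_carrier using wd_nonneg by (intro poly_mapping_eqI) fastforce

lemma below_exists:
  assumes "v \<in> N"
  shows "\<exists>d. v \<in> below d"
proof -
  obtain d :: nat where d: "\<forall>r\<in>wd ` Poly_Mapping.keys v. r < real d"
    using finite_imageI[OF finite_keys[of v], of wd]
    by (metis bdd_above_finite bdd_above_def reals_Archimedean2 order_le_less_trans)
  then show ?thesis using assms by (intro exI[of _ d]) (auto simp: below_def in_keys_iff)
qed

lemma wd_shift:
  assumes "\<beta> \<in> carrier_vec (2 * n)" "i < 2 * n" "j < 2 * n"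
  shows "wd (\<beta> - unit_vec (2 * n) i + unit_vec (2 * n) j) = wd \<beta> - wt i + wt j"
proof -
  have "wd (\<beta> - unit_vec (2 * n) i + unit_vec (2 * n) j) =
      (\<Sum>k<2 * n. wt k * Re (\<beta> $ k) - (if k = i then wt i else 0) + (if k = j then wt j else 0))"
    unfolding wd_def by (rule sum.cong) (use assms in \<open>auto simp: algebra_simps\<close>)
  also have "\<dots> = wd \<beta> - wt i + wt j"
    using assms by (simp add: sum.distrib sum_subtractf wd_def)
  finally show ?thesis .
qed

lemma wt_values:
  "wt 0 = -2" "i \<in> mid \<Longrightarrow> wt i = -1" "wt \<omega> = 0" "wt n = 0" "i \<in> mid \<Longrightarrow> wt (n + i) = 1" "wt (n + \<omega>) = 2"
proof -
  have "\<omega> \<le> n" "\<not> n < \<omega>" "\<not> n + k < \<omega>" for k using \<omega>_bounds(1) by linarith+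
  then show "wt 0 = -2" "i \<in> mid \<Longrightarrow> wt i = -1" "wt \<omega> = 0" "wt n = 0" "i \<in> mid \<Longrightarrow> wt (n + i) = 1" "wt (n + \<omega>) = 2"
    using n2 by (simp_all add: wt_def)
qed

lemma raise_below:
  assumes v: "v \<in> below (Suc d)" and ij: "(i = 0 \<and> j \<in> mid) \<or> (i \<in> mid \<and> j = \<omega>) \<or> (i = 0 \<and> j = \<omega>)"
  shows "e i j v \<in> below d"
proof -
  have vN: "v \<in> N" and vs: "v \<in> supp n" using v N_supp by (auto simp: below_def)
  have lt: "i < n" "j < n" "i \<noteq> j" using ij by auto
  have eN: "e i j v \<in> N" using vN lt by simp
  have bd: "wd \<gamma> < real (Suc d)" if "lk v \<gamma> \<noteq> 0" for \<gamma> using v that by (auto simp: below_def)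
  have w: "wt j \<ge> wt i + 1" "wt (n + j) \<ge> wt (n + i) + 1"
    using ij by (auto simp: wt_values)
  show ?thesis unfolding below_def
  proof (intro CollectI conjI eN allI impI)
    fix \<beta> assume nz: "lk (e i j v) \<beta> \<noteq> 0"
    have \<beta>: "\<beta> \<in> carrier_vec (2 * n)" using nz eN by (auto simp: N_carrier admissible_def)
    have "lk (eop n i j v) \<beta> \<noteq> 0 \<or> lk (eop n (n + i) (n + j) v) \<beta> \<noteq> 0"
      using nz by (auto simp: e_def lookup_add)
    then have "lk v (\<beta> - unit_vec (2 * n) i + unit_vec (2 * n) j) \<noteq> 0 \<or>
        lk v (\<beta> - unit_vec (2 * n) (n + i) + unit_vec (2 * n) (n + j)) \<noteq> 0"
      using lt \<beta> vs by (auto simp: lookup_eop)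
    then show "wd \<beta> < real d"
    proof
      assume "lk v (\<beta> - unit_vec (2 * n) i + unit_vec (2 * n) j) \<noteq> 0"
      from bd[OF this] show ?thesis using wd_shift[OF \<beta>, of i j] lt w by simp
    next
      assume "lk v (\<beta> - unit_vec (2 * n) (n + i) + unit_vec (2 * n) (n + j)) \<noteq> 0"
      from bd[OF this] show ?thesis using wd_shift[OF \<beta>, of "n + i" "n + j"] lt w by simp
    qed
  qed
qed

text \<open>
  The operators \<open>e 0 j\<close>, \<open>e i \<omega>\<close> and \<open>e 0 \<omega>\<close> can be applied only finitely often before the result is zero. Hence the process
  of replacing a vector outside \<open>Q\<close> by an image under one of them that is still outside \<open>Q\<close> comes to an end.
\<close>

lemma exists_singular:
  assumes "Z \<subseteq> N" "z \<in> Z" "z \<notin> Q" "0 \<in> Q"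
    and Z: "\<And>i j v. i < n \<Longrightarrow> j < n \<Longrightarrow> i \<noteq> j \<Longrightarrow> v \<in> Z \<Longrightarrow> e i j v \<in> Z"
  obtains v where "v \<in> Z" "v \<notin> Q" "\<And>j. j \<in> mid \<Longrightarrow> e 0 j v \<in> Q" "\<And>i. i \<in> mid \<Longrightarrow> e i \<omega> v \<in> Q" "e 0 \<omega> v \<in> Q"
proof -
  obtain d where "z \<in> below d" using below_exists assms(1,2) by blast
  then have "\<exists>v. v \<in> Z \<and> v \<notin> Q \<and> (\<forall>j\<in>mid. e 0 j v \<in> Q) \<and> (\<forall>i\<in>mid. e i \<omega> v \<in> Q) \<and> e 0 \<omega> v \<in> Q"
    using assms(2,3)
  proof (induction d arbitrary: z)
    case 0
    then show ?case using below_0 assms(4) by blast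
  next
    case (Suc d)
    show ?case
    proof (cases "(\<forall>j\<in>mid. e 0 j z \<in> Q) \<and> (\<forall>i\<in>mid. e i \<omega> z \<in> Q) \<and> e 0 \<omega> z \<in> Q")
      case True
      then show ?thesis using Suc.prems by blast
    next
      case False
      then obtain i j where ij: "(i = 0 \<and> j \<in> mid) \<or> (i \<in> mid \<and> j = \<omega>) \<or> (i = 0 \<and> j = \<omega>)" "e i j z \<notin> Q" by blast
      then have "e i j z \<in> Z" using Suc.prems by (intro Z) auto
      then show ?thesis using Suc.IH[OF raise_below[OF Suc.prems(1) ij(1)]] ij(2) by blast
    qed
  qed
  then show ?thesis using that by blast
qed

end

section \<open>Triangular decomposition of b\<close>

definition E_mat :: "nat \<Rightarrow> nat \<Rightarrow> nat \<Rightarrow> complex mat" where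
  "E_mat n i j = mat n n (\<lambda>(r, s). if r = i \<and> s = j then 1 else 0)"

definition nm_b :: "nat \<Rightarrow> complex mat set" where
  "nm_b n = {dbl n (E_mat n i j) | i j. j < i \<and> i < n}"

lemma dbl_carrier [simp]: "A \<in> carrier_mat n n \<Longrightarrow> dbl n A \<in> carrier_mat (2 * n) (2 * n)"
  by (auto simp: dbl_def)

lemma E_mat_carrier [simp]: "E_mat n i j \<in> carrier_mat n n"
  by (simp add: E_mat_def)

lemma dbl_linear:
  "A \<in> carrier_mat n n \<Longrightarrow> A' \<in> carrier_mat n n \<Longrightarrow> dbl n (A + A') = dbl n A + dbl n A'"
  "A \<in> carrier_mat n n \<Longrightarrow> dbl n (r \<cdot>\<^sub>m A) = r \<cdot>\<^sub>m dbl n A"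
  "A \<in> carrier_mat n n \<Longrightarrow> A' \<in> carrier_mat n n \<Longrightarrow> dbl n (A - A') = dbl n A - dbl n A'"
  by (auto simp: dbl_def intro!: eq_matI)

lemma dbl_bracket:
  assumes "A \<in> carrier_mat n n" "A' \<in> carrier_mat n n"
  shows "lie_bracket (dbl n A) (dbl n A') = dbl n (lie_bracket A A')"
proof -
  have "dbl n A * dbl n A' = dbl n (A * A')" if "A \<in> carrier_mat n n" "A' \<in> carrier_mat n n" for A A'
    using that unfolding dbl_def
    by (subst mult_four_block_mat[of _ n n _ n _ n _ _ n _ n]) auto
  then show ?thesis using assms by (simp add: lie_bracket_def dbl_linear)
qed

lemma sum_split_half: "(\<Sum>i<2 * n. h i) = (\<Sum>i<n. h i) + (\<Sum>i<n. h (n + i))" for h :: "nat \<Rightarrow> 'a :: comm_monoid_add"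
proof -
  have "(\<Sum>i<n + m. h i) = (\<Sum>i<n. h i) + (\<Sum>i<m. h (n + i))" for m
    by (induction m) (simp_all add: add.assoc)
  from this[of n] show ?thesis by (simp add: mult_2)
qed

lemma lie_closed_b: "lie_closed (b_alg n)"
proof -
  have tr: "(\<Sum>i<n. lie_bracket A A' $$ (i, i)) = 0" if "A \<in> carrier_mat n n" "A' \<in> carrier_mat n n" for A A'
  proof -
    have "(\<Sum>i<n. (A * A') $$ (i, i)) = (\<Sum>i<n. \<Sum>k<n. A $$ (i, k) * A' $$ (k, i))"
      using that by (simp add: scalar_prod_def lessThan_atLeast0)
    also have "\<dots> = (\<Sum>k<n. \<Sum>i<n. A $$ (i, k) * A' $$ (k, i))" by (rule sum.swap)
    also have "\<dots> = (\<Sum>k<n. (A' * A) $$ (k, k))"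
      using that by (simp add: scalar_prod_def lessThan_atLeast0 mult.commute)
    finally show ?thesis using that by (simp add: lie_bracket_def sum_subtractf)
  qed
  have cl: "lie_bracket A A' \<in> carrier_mat n n" if "A \<in> carrier_mat n n" "A' \<in> carrier_mat n n" for A A'
    using that by (auto simp: lie_bracket_def intro!: minus_carrier_mat mult_carrier_mat)
  have "A + A' \<in> sl n \<and> lie_bracket A A' \<in> sl n" if "A \<in> sl n" "A' \<in> sl n" for A A'
    using that tr[of A A'] cl[of A A'] by (auto simp: sl_def sum.distrib)
  moreover have "r \<cdot>\<^sub>m A \<in> sl n" if "A \<in> sl n" for r A
    using that by (auto simp: sl_def simp flip: sum_distrib_left)
  moreover have "A \<in> carrier_mat n n" if "A \<in> sl n" for A using that by (simp add: sl_def)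
  ultimately show ?thesis
    unfolding lie_closed_def b_alg_def
    by (auto simp flip: dbl_linear simp: dbl_bracket) 
qed

lemma b_alg_carrier: "b_alg n \<subseteq> carrier_mat (2 * n) (2 * n)"
  by (auto simp: b_alg_def sl_def)

lemma E_mat_b: "i \<noteq> j \<Longrightarrow> dbl n (E_mat n i j) \<in> b_alg n"
  by (auto simp: b_alg_def sl_def E_mat_def intro!: imageI sum.neutral)

lemma H_b_eq: "H_b n i = dbl n (mat n n (\<lambda>(r, c). if r = i \<and> c = i then 1 else if r = Suc i \<and> c = Suc i then -1 else 0))"
  by (simp add: H_b_def)

definition diag_mat :: "nat \<Rightarrow> (nat \<Rightarrow> complex) \<Rightarrow> complex mat" where
  "diag_mat n d = mat n n (\<lambda>(r, s). if r = s then d r else 0)"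

lemma diag_mat_carrier [simp]: "diag_mat n d \<in> carrier_mat n n"
  by (simp add: diag_mat_def)

text \<open>
  Summation by parts: a diagonal matrix of trace zero is the combination of the \<open>H_b n i\<close> with the partial
  sums of its entries as coefficients.
\<close>

lemma diag_in_span:
  assumes n: "n \<ge> 2" and tr: "(\<Sum>i<n. d i) = 0"
  shows "dbl n (diag_mat n d) \<in> mspan {H_b n i | i. i < n - 1}"
proof -
  define D where "D m = mat n n (\<lambda>(r, s). if r = s then (if r < m then d r else if r = m then - (\<Sum>k<m. d k) else 0) else 0)" for m
  have D0: "dbl n (D 0) = 0 \<cdot>\<^sub>m H_b n 0"
  proof -
    have "D 0 = 0 \<cdot>\<^sub>m mat n n (\<lambda>(r, c). if r = 0 \<and> c = 0 then 1 else if r = Suc 0 \<and> c = Suc 0 then -1 else 0)"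
      by (auto simp: D_def intro!: eq_matI)
    then show ?thesis by (simp add: H_b_eq dbl_linear)
  qed
  have "m < n \<Longrightarrow> dbl n (D m) \<in> mspan {H_b n i | i. i < n - 1}" for m
  proof (induction m)
    case 0
    then show ?case unfolding D0 using n by (intro mspan.smult mspan.base) auto
  next
    case (Suc m)
    let ?H = "mat n n (\<lambda>(r, c). if r = m \<and> c = m then 1 else if r = Suc m \<and> c = Suc m then -1 else 0)"
    have "D (Suc m) = D m + (\<Sum>k<Suc m. d k) \<cdot>\<^sub>m ?H"
      by (rule eq_matI) (auto simp: D_def less_Suc_eq)
    then have "dbl n (D (Suc m)) = dbl n (D m) + (\<Sum>k<Suc m. d k) \<cdot>\<^sub>m H_b n m"
      by (simp add: H_b_eq dbl_linear D_def del: sum.lessThan_Suc)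
    moreover have "H_b n m \<in> mspan {H_b n i | i. i < n - 1}" using Suc by (intro mspan.base) auto
    ultimately show ?case using Suc by (simp add: mspan.intros del: sum.lessThan_Suc)
  qed
  from this[of "n - 1"] n have "dbl n (D (n - 1)) \<in> mspan {H_b n i | i. i < n - 1}" by simp
  moreover have "D (n - 1) = diag_mat n d"
  proof -
    obtain m where m: "n = Suc m" using n by (cases n) auto
    have "- (\<Sum>k<m. d k) = d m" using tr unfolding m by (simp add: add_eq_0_iff)
    then show ?thesis unfolding D_def diag_mat_def m by (auto simp: less_Suc_eq intro!: eq_matI)
  qed
  ultimately show ?thesis by simp
qed

lemma mspan_mono: "A \<in> mspan S \<Longrightarrow> S \<subseteq> S' \<Longrightarrow> A \<in> mspan S'"
  by (induction rule: mspan.induct) (auto intro: mspan.intros)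

lemma low_in_span:
  assumes n: "n \<ge> 2" and "finite L" "\<forall>(i, j)\<in>L. j < i \<and> i < n"
  shows "dbl n (mat n n (\<lambda>p. if p \<in> L then a p else 0)) \<in> mspan (nm_b n)"
  using assms(2,3)
proof (induction L rule: finite_induct)
  case empty
  have "dbl n (mat n n (\<lambda>p. if p \<in> {} then a p else 0)) = 0 \<cdot>\<^sub>m dbl n (E_mat n 1 0)"
    by (subst dbl_linear(2)[symmetric]) (auto intro!: arg_cong[of _ _ "dbl n"] eq_matI simp: E_mat_def)
  moreover have "dbl n (E_mat n 1 0) \<in> nm_b n" using n by (force simp: nm_b_def)
  ultimately show ?case by (simp add: mspan.intros)
next
  case (insert p L)
  obtain i j where p: "p = (i, j)" by (cases p)
  have "mat n n (\<lambda>q. if q \<in> insert p L then a q else 0) = mat n n (\<lambda>q. if q \<in> L then a q else 0) + a p \<cdot>\<^sub>m E_mat n i j"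
    using insert.hyps(2) by (auto simp: p E_mat_def intro!: eq_matI)
  then have "dbl n (mat n n (\<lambda>q. if q \<in> insert p L then a q else 0)) =
      dbl n (mat n n (\<lambda>q. if q \<in> L then a q else 0)) + a p \<cdot>\<^sub>m dbl n (E_mat n i j)"
    by (simp add: dbl_linear)
  moreover have "dbl n (E_mat n i j) \<in> nm_b n" using insert.prems by (auto simp: nm_b_def p)
  ultimately show ?case using insert by (simp add: mspan.intros)
qed

text \<open>
  Half the sum of the positive coroots, for which the matrix unit at \<open>(i, j)\<close> has degree \<open>j - i\<close>.
\<close>

definition h0_b :: "nat \<Rightarrow> complex mat" where
  "h0_b n = dbl n (diag_mat n (\<lambda>i. (of_nat n - 1) / 2 - of_nat i))"

lemma diag_bracket:
  assumes "i < n" "j < n"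
  shows "lie_bracket (diag_mat n d) (E_mat n i j) = (d i - d j) \<cdot>\<^sub>m E_mat n i j"
proof (rule eq_matI)
  fix r s assume rs: "r < dim_row ((d i - d j) \<cdot>\<^sub>m E_mat n i j)" "s < dim_col ((d i - d j) \<cdot>\<^sub>m E_mat n i j)"
  then have rs: "r < n" "s < n" by (simp_all add: E_mat_def)
  have "(diag_mat n d * E_mat n i j) $$ (r, s) = (\<Sum>k = 0..<n. (if r = k then d r else 0) * (if k = i \<and> s = j then 1 else 0))"
    using rs by (simp add: diag_mat_def E_mat_def scalar_prod_def)
  also have "\<dots> = (\<Sum>k = 0..<n. if k = r then (if r = i \<and> s = j then d r else 0) else 0)"
    by (rule sum.cong) auto
  finally have 1: "(diag_mat n d * E_mat n i j) $$ (r, s) = (if r = i \<and> s = j then d r else 0)"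
    using rs by simp
  have "(E_mat n i j * diag_mat n d) $$ (r, s) = (\<Sum>k = 0..<n. (if r = i \<and> k = j then 1 else 0) * (if k = s then d k else 0))"
    using rs by (simp add: diag_mat_def E_mat_def scalar_prod_def)
  also have "\<dots> = (\<Sum>k = 0..<n. if k = s then (if r = i \<and> s = j then d s else 0) else 0)"
    by (rule sum.cong) auto
  finally have 2: "(E_mat n i j * diag_mat n d) $$ (r, s) = (if r = i \<and> s = j then d s else 0)"
    using rs by simp
  show "lie_bracket (diag_mat n d) (E_mat n i j) $$ (r, s) = ((d i - d j) \<cdot>\<^sub>m E_mat n i j) $$ (r, s)"
    unfolding lie_bracket_def using rs 1 2 by (auto simp: E_mat_def diag_mat_def)
qed (auto simp: lie_bracket_def E_mat_def diag_mat_def)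

lemma triangular_b:
  assumes n: "n \<ge> 2"
  shows "triangular (b_alg n) (nm_b n) (b_pos n) {(H_b n i, \<mu> i) | i. i < n - 1} (h0_b n)"
proof -
  let ?C = "{(H_b n i, \<mu> i) | i. i < n - 1}"
  have fC: "fst ` ?C = {H_b n i | i. i < n - 1}" by force
  have H_in: "{H_b n i | i. i < n - 1} \<subseteq> b_alg n"
  proof -
    have "(\<Sum>r<n. mat n n (\<lambda>(r, c). if r = i \<and> c = i then 1 else if r = Suc i \<and> c = Suc i then -1 else 0) $$ (r, r)) = (0 :: complex)"
      if "i < n - 1" for i
    proof -
      have "(\<Sum>r<n. mat n n (\<lambda>(r, c). if r = i \<and> c = i then 1 else if r = Suc i \<and> c = Suc i then -1 else 0) $$ (r, r)) =
          (\<Sum>r<n. (if r = i then 1 else 0) + (if r = Suc i then -1 else (0 :: complex)))"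
        by (rule sum.cong) auto
      also have "\<dots> = 0" using that by (simp add: sum.distrib)
      finally show ?thesis .
    qed
    then show ?thesis by (auto simp: H_b_eq b_alg_def sl_def intro!: imageI)
  qed
  have P_in: "b_pos n \<subseteq> b_alg n" by (auto simp: b_pos_def b_alg_def sl_def intro!: imageI sum.neutral)
  have nm_in: "nm_b n \<subseteq> b_alg n" by (auto simp: nm_b_def E_mat_b)
  have span: "b_alg n \<subseteq> mspan (nm_b n \<union> b_pos n \<union> fst ` ?C)"
  proof
    fix M assume "M \<in> b_alg n"
    then obtain A where A: "A \<in> carrier_mat n n" "(\<Sum>i<n. A $$ (i, i)) = 0" "M = dbl n A"
      by (auto simp: b_alg_def sl_def)
    define L where "L = {(i, j). j < i \<and> i < n}"
    define low where "low = mat n n (\<lambda>p. if p \<in> L then A $$ p else 0)"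
    define up where "up = mat n n (\<lambda>(i, j). if i < j then A $$ (i, j) else 0)"
    define dg where "dg = diag_mat n (\<lambda>i. A $$ (i, i))"
    have "finite L" by (rule finite_subset[of _ "{..<n} \<times> {..<n}"]) (auto simp: L_def)
    then have 1: "dbl n low \<in> mspan (nm_b n)" unfolding low_def by (rule low_in_span[OF n]) (auto simp: L_def)
    have 2: "dbl n dg \<in> mspan {H_b n i | i. i < n - 1}" unfolding dg_def by (rule diag_in_span[OF n A(2)])
    have 3: "dbl n up \<in> b_pos n" by (auto simp: b_pos_def up_def intro!: imageI)
    have "A = low + dg + up"
      using A(1) by (auto simp: low_def dg_def up_def L_def diag_mat_def intro!: eq_matI)
    then have "M = dbl n (low + dg + up)" using A(3) by simp
    moreover have "low \<in> carrier_mat n n" "dg \<in> carrier_mat n n" "up \<in> carrier_mat n n"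
      by (simp_all add: low_def dg_def up_def diag_mat_def)
    ultimately have "M = dbl n low + dbl n dg + dbl n up" by (simp only: dbl_linear add_carrier_mat)
    then show "M \<in> mspan (nm_b n \<union> b_pos n \<union> fst ` ?C)"
      unfolding fC
      by (simp only:) (intro mspan.add mspan_mono[OF 1] mspan_mono[OF 2] mspan.base, use 3 in auto)
  qed
  have h0: "h0_b n \<in> mspan (fst ` ?C)"
    unfolding fC h0_b_def
  proof (rule diag_in_span[OF n])
    have "(\<Sum>i<n. of_nat i) = of_nat n * (of_nat n - 1) / (2 :: complex)" for n
      by (induction n) (simp_all add: field_simps)
    then show "(\<Sum>i<n. (of_nat n - 1) / 2 - of_nat i) = (0 :: complex)" by (simp add: sum_subtractf)
  qed
  have br: "\<exists>d::nat. d > 0 \<and> lie_bracket (h0_b n) f = (- of_nat d) \<cdot>\<^sub>m f" if "f \<in> nm_b n" for f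
  proof -
    obtain i j where ij: "j < i" "i < n" "f = dbl n (E_mat n i j)" using \<open>f \<in> nm_b n\<close> by (auto simp: nm_b_def)
    have "lie_bracket (h0_b n) f = (of_nat j - of_nat i) \<cdot>\<^sub>m f"
      using ij by (simp add: h0_b_def dbl_bracket diag_bracket dbl_linear)
    also have "(of_nat j - of_nat i :: complex) = - of_nat (i - j)" using ij by (simp add: of_nat_diff)
    finally show ?thesis using ij by (intro exI[of _ "i - j"]) simp
  qed
  show ?thesis unfolding triangular_def
    using lie_closed_b nm_in P_in H_in span h0 br unfolding fC by blast
qed

section \<open>The module generated over b\<close>

context dual_pair
begin

abbreviation NM where "NM \<equiv> N_mod n a1 a2"

lemma act_dbl:
  assumes "A \<in> carrier_mat n n"
  shows "act NM (dbl n A) v = (\<Sum>i<n. \<Sum>j<n. scale (A $$ (i, j)) (e i j v))"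
  using assms by (simp add: N_act sum_split_half dbl_def e_def cvs.scale_right_distrib sum.distrib)

lemma act_E:
  assumes "i < n" "j < n"
  shows "act NM (dbl n (E_mat n i j)) v = e i j v"
proof -
  have "act NM (dbl n (E_mat n i j)) v = (\<Sum>r<n. \<Sum>s<n. if r = i then (if s = j then e i j v else 0) else 0)"
    unfolding act_dbl[OF E_mat_carrier] by (intro sum.cong) (auto simp: E_mat_def)
  also have "\<dots> = (\<Sum>r<n. if r = i then e i j v else 0)"
    using assms by (intro sum.cong) auto
  finally show ?thesis using assms by simp
qed

sublocale NB: lie_module "b_alg n" NM
  by (rule lie_module_N[OF b_alg_carrier])

lemma n_ge_2: "n \<ge> 2" using n2 by simp

lemmas tri_b = triangular_b[OF n_ge_2]

lemma hw_b:
  assumes v: "v \<in> N" and up: "\<And>i j. i < j \<Longrightarrow> j < n \<Longrightarrow> e i j v = 0"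
    and w: "\<And>i. i < n \<Longrightarrow> e i i v = scale (w i) v"
  shows "hw_vector NM (b_pos n) {(H_b n i, w i - w (Suc i)) | i. i < n - 1} v"
  unfolding hw_vector_def
proof (intro conjI ballI v)
  fix M assume "M \<in> b_pos n"
  then obtain A where A: "A \<in> carrier_mat n n" "\<forall>i<n. \<forall>j\<le>i. A $$ (i, j) = 0" "M = dbl n A"
    by (auto simp: b_pos_def)
  have "scale (A $$ (i, j)) (e i j v) = 0" if "i < n" "j < n" for i j
    using A(2) that up[of i j] by (cases "j \<le> i") auto
  then have "(\<Sum>i<n. \<Sum>j<n. scale (A $$ (i, j)) (e i j v)) = 0" by (intro sum.neutral ballI) auto
  then show "act NM M v = \<zero>\<^bsub>NM\<^esub>" unfolding A(3) act_dbl[OF A(1)] by simp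
next
  fix hc assume "hc \<in> {(H_b n i, w i - w (Suc i)) | i. i < n - 1}"
  then obtain m where m: "hc = (H_b n m, w m - w (Suc m))" "m < n - 1" by blast
  have "act NM (H_b n m) v = (\<Sum>i<n. \<Sum>j<n. scale (if i = m \<and> j = m then 1 else if i = Suc m \<and> j = Suc m then -1 else 0) (e i j v))"
    unfolding H_b_eq by (subst act_dbl) (auto intro!: sum.cong)
  also have "\<dots> = (\<Sum>i<n. \<Sum>j<n. if j = i then (if i = m then e m m v else if i = Suc m then - e (Suc m) (Suc m) v else 0) else 0)"
    by (intro sum.cong refl) auto
  also have "\<dots> = (\<Sum>i<n. if i = m then e m m v else if i = Suc m then - e (Suc m) (Suc m) v else 0)"
    by (intro sum.cong refl) auto
  also have "\<dots> = (\<Sum>i<n. (if i = m then e m m v else 0) + (if i = Suc m then - e (Suc m) (Suc m) v else 0))"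
    by (intro sum.cong refl) auto
  also have "\<dots> = e m m v - e (Suc m) (Suc m) v"
  proof -
    have "m < n" "Suc m < n" using m(2) by auto
    then show ?thesis by (simp add: sum.distrib)
  qed
  also have "\<dots> = scale (w m - w (Suc m)) v"
    using m(2) by (simp add: w cvs.scale_left_diff_distrib)
  finally show "case hc of (h, r) \<Rightarrow> act NM h v = r \<odot>\<^bsub>NM\<^esub> v" by (simp add: m(1))
qed

lemma index_cases:
  assumes "i < n"
  obtains "i = 0" | "i \<in> mid" | "i = \<omega>"
  using assms by (cases "i = 0"; cases "i = \<omega>") (auto simp: mid_def \<omega>_def)

text \<open>
  The two vectors singled out by the condition on \<open>m\<close> are \<open>x(b,0)\<close> itself, for \<open>m = 0\<close>, and \<open>S m\<close> for \<open>m = -c\<close>.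
\<close>

lemma S_singular:
  assumes m: "of_nat m * (c + of_nat m) = 0" and ij: "i < j" "j < n"
  shows "e i j (S m) = 0"
proof -
  have "i < n" using ij by simp
  then show ?thesis
    by (cases rule: index_cases; cases rule: index_cases[OF ij(2)])
      (use ij m in \<open>auto simp: S_P S_E S_R S_levi mid_def\<close>)
qed

definition wS :: "nat \<Rightarrow> nat \<Rightarrow> complex" where
  "wS m i = (if i = 0 then \<tau> m - 1 else if i = \<omega> then a1 + of_int b + of_nat m else -1)"

lemma S_weights: "i < n \<Longrightarrow> e i i (S m) = scale (wS m i) (S m)"
  by (erule index_cases) (simp_all add: wS_def S_weight S_levi)

lemma hw_S:
  assumes "of_nat m * (c + of_nat m) = 0"
  shows "hw_vector NM (b_pos n) {(H_b n i, wS m i - wS m (Suc i)) | i. i < n - 1} (S m)"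
  by (rule hw_b[OF S_N S_singular[OF assms] S_weights])

lemma submodule_e:
  assumes "lie_submodule (b_alg n) NM W" "i < n" "j < n" "i \<noteq> j" "v \<in> W"
  shows "e i j v \<in> W"
  using assms E_mat_b[of i j n] unfolding NB.lie_submodule_iff by (metis act_E)

lemma submodule_subspace:
  assumes "lie_submodule (b_alg n) NM W"
  shows "cvs.subspace W" "W \<subseteq> N"
  using assms unfolding NB.lie_submodule_iff by (auto intro!: cvs.subspaceI)

text \<open>
  Both sides are the smallest subspace that contains \<open>S m\<close> and is stable under the lowering operators.
\<close>

lemma cyc_S:
  assumes m: "of_nat m * (c + of_nat m) = 0"
  shows "NB.cyc (S m) = B {m..}"
proof
  have low: "lower_span NM (nm_b n) (S m) = NB.cyc (S m)"
    by (rule NB.lower_span_eq_cyc[OF tri_b hw_S[OF m]])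
  show "NB.cyc (S m) \<subseteq> B {m..}" unfolding low[symmetric]
  proof (rule NB.lower_span_least)
    show "S m \<in> B {m..}" using bv_B[of m "{m..}" "[]" "[]"] by (simp add: bv_def)
    show "act NM f v \<in> B {m..}" if f: "f \<in> nm_b n" and v: "v \<in> B {m..}" for f v
    proof -
      obtain i j where ij: "j < i" "i < n" "f = dbl n (E_mat n i j)" using f by (auto simp: nm_b_def)
      then have "act NM f v = e i j v" using act_E[of i j] by simp
      moreover have "e i j v \<in> B {m..}" by (rule lower_B[OF _ ij(1,2) v]) auto
      ultimately show ?thesis by simp
    qed
  qed (auto intro: B_cl)
  have sub: "lie_submodule (b_alg n) NM (NB.cyc (S m))" by (rule NB.lie_submodule_cyc) simp
  show "B {m..} \<subseteq> NB.cyc (S m)"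
    by (rule B_least[OF NB.generator_in_cyc]) (use submodule_e[OF sub] submodule_subspace(1)[OF sub] in auto)
qed

lemma submodule_B: "of_nat m * (c + of_nat m) = 0 \<Longrightarrow> lie_submodule (b_alg n) NM (B {m..})"
  using NB.lie_submodule_cyc[of "S m"] cyc_S[of m] by simp

lemma B_in_submodule:
  assumes "lie_submodule (b_alg n) NM W" "S m \<in> W" "of_nat m * (c + of_nat m) = 0"
  shows "B {m..} \<subseteq> W"
  using NB.cyc_least[OF assms(1,2)] cyc_S[OF assms(3)] by simp

lemma Ub_eq: "Ub_x n a1 a2 b = NM\<lparr>carrier := B {0..}\<rparr>"
proof -
  have "Ub_x n a1 a2 b = NM\<lparr>carrier := NB.cyc x0\<rparr>"
    unfolding Ub_x_def by (rule NB.cyclic_module_eq[OF lie_closed_b]) simp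
  then show ?thesis using cyc_S[of 0] by simp
qed

lemma Ub_cyclic: "Ub_x n a1 a2 b = cyclic_module (b_alg n) NM x0"
  by (simp add: Ub_x_def)

lemma B0_UNIV: "B {0..} = B UNIV"
  by (simp add: atLeast_0)

lemma S_nz: "S m \<noteq> 0"
  using cf_S[of "{#}" m m] by (auto simp: cf_linear)

lemma submodule_contains_singular:
  assumes Z: "lie_submodule (b_alg n) NM Z" "Z \<subseteq> B {0..}" and z: "z \<in> Z" "z \<notin> B U" and U: "\<And>k. k \<in> U \<Longrightarrow> Suc k \<in> U"
    and EU: "\<And>w. w \<in> B U \<Longrightarrow> e 0 \<omega> w \<in> B U"
  obtains v A where "v \<in> Z" "v \<notin> B U" "finite A" "\<And>k. k \<in> A \<Longrightarrow> k \<notin> U \<and> of_nat k * (c + of_nat k) = 0"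
    "v - (\<Sum>k\<in>A. scale (cf v k {#}) (S k)) \<in> B U"
proof -
  obtain v where v: "v \<in> Z" "v \<notin> B U" "\<And>j. j \<in> mid \<Longrightarrow> e 0 j v \<in> B U" "\<And>i. i \<in> mid \<Longrightarrow> e i \<omega> v \<in> B U" "e 0 \<omega> v \<in> B U"
    using exists_singular[OF submodule_subspace(2)[OF Z(1)] z B_cl(4)] submodule_e[OF Z(1)] by metis
  have "v \<in> B UNIV" using v(1) Z(2) B0_UNIV by blast
  from singular_vectors[OF this U EU v(3-5)] show ?thesis using that v(1,2) by blast
qed

lemma c_nonneg_roots:
  assumes "Re c \<ge> 0" "of_nat k * (c + of_nat k) = 0"
  shows "k = 0"
proof (rule ccontr)
  assume "k \<noteq> 0"
  then have "c + of_nat k = 0" using assms(2) by simp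
  then have "Re c + real k = 0" by (metis Re_complex_of_real complex_Re_of_nat plus_complex.sel(1) zero_complex.sel(1))
  then show False using assms(1) \<open>k \<noteq> 0\<close> by simp
qed

text \<open>
  Every non-zero submodule contains a non-zero singular vector, and the only root of \<open>k (c + k)\<close> is \<open>0\<close>, so this
  vector is a multiple of the generator.
\<close>

theorem Ub_simple:
  assumes c: "Re c \<ge> 0"
  shows "simple_module (b_alg n) (Ub_x n a1 a2 b)"
  unfolding simple_module_def Ub_eq
proof (intro conjI allI impI)
  have sub: "lie_submodule (b_alg n) NM (B {0..})" by (rule submodule_B) simp
  show "lie_module (b_alg n) (NM\<lparr>carrier := B {0..}\<rparr>)" by (rule NB.lie_module_restrict[OF sub])
  have "S 0 \<in> B {0..}" using bv_B[of 0 "{0..}" "[]" "[]"] by (simp add: bv_def)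
  then show "carrier (NM\<lparr>carrier := B {0..}\<rparr>) \<noteq> {\<zero>\<^bsub>NM\<lparr>carrier := B {0..}\<rparr>\<^esub>}"
    using S_nz[of 0] by auto
  fix W assume "lie_submodule (b_alg n) (NM\<lparr>carrier := B {0..}\<rparr>) W"
  then have W: "lie_submodule (b_alg n) NM W" "W \<subseteq> B {0..}"
    using NB.lie_submodule_restrict[OF sub] by auto
  show "W = {\<zero>\<^bsub>NM\<lparr>carrier := B {0..}\<rparr>\<^esub>} \<or> W = carrier (NM\<lparr>carrier := B {0..}\<rparr>)"
  proof (cases "W \<subseteq> {0}")
    case True
    then show ?thesis using W(1) by (auto simp: NB.lie_submodule_iff)
  next
    case False
    then obtain z where z: "z \<in> W" "z \<notin> B {}" by (auto simp: B_empty)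
    obtain v A where v: "v \<in> W" "v \<notin> B {}" "finite A" "\<And>k. k \<in> A \<Longrightarrow> k \<notin> {} \<and> of_nat k * (c + of_nat k) = 0"
      "v - (\<Sum>k\<in>A. scale (cf v k {#}) (S k)) \<in> B {}"
      by (rule submodule_contains_singular[OF W z]) (auto simp: B_empty)
    have "A \<subseteq> {0}" using v(4) c_nonneg_roots[OF c] by blast
    then consider "A = {}" | "A = {0}" by blast
    then have "v = scale (cf v 0 {#}) x0" using v(2,5) by cases (auto simp: B_empty)
    moreover have "v \<noteq> 0" using v(2) by (simp add: B_empty)
    ultimately have "cf v 0 {#} \<noteq> 0" by auto
    then have "x0 = scale (1 / cf v 0 {#}) v" using \<open>v = _\<close> by (metis cvs.scale_one cvs.scale_scale nonzero_divide_eq_eq)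
    then have "S 0 \<in> W" using cvs.subspace_scale[OF submodule_subspace(1)[OF W(1)] v(1)] by simp
    then have "B {0..} \<subseteq> W" by (rule B_in_submodule[OF W(1)]) simp
    then show ?thesis using W(2) by auto
  qed
qed

lemma C_list:
  "{(H_b n i, ([a2 - of_int b] @ replicate (n - 3) 0 @ [-1 - a1 - of_int b]) ! i) | i. i < n - 1}
    = {(H_b n i, wS 0 i - wS 0 (Suc i)) | i. i < n - 1}"
proof -
  have "([a2 - of_int b] @ replicate (n - 3) 0 @ [-1 - a1 - of_int b]) ! i = wS 0 i - wS 0 (Suc i)" if i: "i < n - 1" for i
  proof -
    consider "i = 0" | "0 < i" "i < n - 2" | "i = n - 2" using i by linarith
    then show ?thesis
    proof cases
      case 1
      then show ?thesis using n2 by (auto simp: wS_def \<omega>_def \<tau>_def)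
    next
      case 2
      then show ?thesis using n2 by (auto simp: wS_def \<omega>_def nth_Cons' nth_append)
    next
      case 3
      then show ?thesis using n2 by (auto simp: wS_def \<omega>_def nth_Cons' nth_append)
    qed
  qed
  then show ?thesis by (intro Collect_cong ex_cong1) auto
qed

theorem Ub_iso:
  assumes c: "Re c \<ge> 0"
  shows "lie_iso (b_alg n) (Ub_x n a1 a2 b) (L_b n ([a2 - of_int b] @ replicate (n - 3) 0 @ [-1 - a1 - of_int b]))"
  unfolding Ub_cyclic L_b_def C_list
proof (rule simple_cyclic_iso_simple_hw[OF tri_b NB.lie_module_axioms])
  show "hw_vector NM (b_pos n) {(H_b n i, wS 0 i - wS 0 (Suc i)) | i. i < n - 1} x0"
    using hw_S[of 0] by simp
  show "simple_module (b_alg n) (cyclic_module (b_alg n) NM x0)"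
    using Ub_simple[OF c] by (simp add: Ub_cyclic)
qed

theorem Ub_indecomposable: "indecomposable_module (b_alg n) (Ub_x n a1 a2 b)"
proof -
  have sub: "lie_submodule (b_alg n) NM (B {0..})" by (rule submodule_B) simp
  interpret U: lie_module "b_alg n" "NM\<lparr>carrier := B {0..}\<rparr>" by (rule NB.lie_module_restrict[OF sub])
  have S0: "S 0 \<in> B {0..}" using bv_B[of 0 "{0..}" "[]" "[]"] by (simp add: bv_def)
  show ?thesis unfolding Ub_eq
  proof (rule U.indecomposable_hw[OF tri_b])
    show "hw_vector (NM\<lparr>carrier := B {0..}\<rparr>) (b_pos n) {(H_b n i, wS 0 i - wS 0 (Suc i)) | i. i < n - 1} (S 0)"
      using hw_S[of 0] S0 by (simp add: hw_vector_def)
    show "S 0 \<noteq> \<zero>\<^bsub>NM\<lparr>carrier := B {0..}\<rparr>\<^esub>" using S_nz[of 0] by simp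
    fix W assume W: "lie_submodule (b_alg n) (NM\<lparr>carrier := B {0..}\<rparr>) W" "S 0 \<in> W"
    then have "B {0..} \<subseteq> W" "W \<subseteq> B {0..}"
      using B_in_submodule[of W 0] NB.lie_submodule_restrict[OF sub] by auto
    then show "W = carrier (NM\<lparr>carrier := B {0..}\<rparr>)" by simp
  qed
qed

text \<open>
  The composition series is \<open>0 \<subset> B {m..} \<subset> B {0..}\<close>. A singular vector in a submodule of \<open>B {m..}\<close> is a
  combination of \<open>S 0\<close> and \<open>S m\<close>, and \<open>S 0\<close> does not occur because its dual functional vanishes on
  \<open>B {m..}\<close>. In a submodule above \<open>B {m..}\<close> a vector that is singular modulo \<open>B {m..}\<close> is a multiple of \<open>S 0\<close>
  modulo \<open>B {m..}\<close>, as \<open>m\<close> itself is no longer available.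
\<close>

theorem Ub_length:
  assumes m: "c = - of_nat m" "m > 0"
  shows "has_length (b_alg n) (Ub_x n a1 a2 b) 2"
proof -
  have root: "of_nat m * (c + of_nat m) = 0" using m by simp
  have roots: "k = 0 \<or> k = m" if "of_nat k * (c + of_nat k) = 0" for k
    using that m(1) by (auto simp: add_eq_0_iff2)
  have sub0: "lie_submodule (b_alg n) NM (B {0..})" by (rule submodule_B) simp
  have subm: "lie_submodule (b_alg n) NM (B {m..})" by (rule submodule_B[OF root])
  have le: "B {m..} \<subseteq> B {0..}" by (rule B_mono) auto
  interpret U: lie_module "b_alg n" "NM\<lparr>carrier := B {0..}\<rparr>" by (rule NB.lie_module_restrict[OF sub0])
  interpret V: lie_module "b_alg n" "NM\<lparr>carrier := B {m..}\<rparr>" by (rule NB.lie_module_restrict[OF subm])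
  have S_in: "S k \<in> B {k..}" for k using bv_B[of k "{k..}" "[]" "[]"] by (simp add: bv_def)
  have bottom: "simple_module (b_alg n) (quotient_module (NM\<lparr>carrier := B {m..}\<rparr>) {0})"
  proof (rule V.simple_quotientI[OF lie_closed_b])
    show "lie_submodule (b_alg n) (NM\<lparr>carrier := B {m..}\<rparr>) {0}" using V.lie_submodule_zero by simp
    show "{0} \<noteq> carrier (NM\<lparr>carrier := B {m..}\<rparr>)" using S_in[of m] S_nz[of m] by auto
    fix Z assume Z: "lie_submodule (b_alg n) (NM\<lparr>carrier := B {m..}\<rparr>) Z" "{0} \<subseteq> Z" "Z \<noteq> {0}"
    then have Z': "lie_submodule (b_alg n) NM Z" "Z \<subseteq> B {m..}" "Z \<subseteq> B {0..}"
      using NB.lie_submodule_restrict[OF subm] le by auto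
    obtain z where z: "z \<in> Z" "z \<notin> B {}" using Z by (auto simp: B_empty)
    obtain v A where v: "v \<in> Z" "v \<notin> B {}" "finite A" "\<And>k. k \<in> A \<Longrightarrow> k \<notin> {} \<and> of_nat k * (c + of_nat k) = 0"
      "v - (\<Sum>k\<in>A. scale (cf v k {#}) (S k)) \<in> B {}"
      by (rule submodule_contains_singular[OF Z'(1,3) z]) (auto simp: B_empty)
    have "cf v 0 {#} = 0" using dual_vanish[of v "{m..}" 0 "[]" "{#}"] v(1) Z'(2) m(2) by auto
    then have "(\<Sum>k\<in>A. scale (cf v k {#}) (S k)) = (\<Sum>k\<in>A \<inter> {m}. scale (cf v k {#}) (S k))"
      using v(3,4) roots by (intro sum.mono_neutral_right) auto
    then have "v = (\<Sum>k\<in>A \<inter> {m}. scale (cf v k {#}) (S k))" using v(5) by (simp add: B_empty)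
    moreover have "v \<noteq> 0" using v(2) by (simp add: B_empty)
    ultimately have eq: "v = scale (cf v m {#}) (S m)" by (cases "m \<in> A") auto
    then have "cf v m {#} \<noteq> 0" using \<open>v \<noteq> 0\<close> by auto
    then have "S m = scale (1 / cf v m {#}) v" using eq by (metis cvs.scale_one cvs.scale_scale nonzero_divide_eq_eq)
    then have "S m \<in> Z" using cvs.subspace_scale[OF submodule_subspace(1)[OF Z'(1)] v(1)] by simp
    then show "Z = carrier (NM\<lparr>carrier := B {m..}\<rparr>)" using B_in_submodule[OF Z'(1) _ root] Z'(2) by auto
  qed
  have S0m: "S 0 \<notin> B {m..}"
    using dual_vanish[of "S 0" "{m..}" 0 "[]" "{#}"] m(2) cf_S[of "{#}" 0 0] by auto
  have top: "simple_module (b_alg n) (quotient_module (NM\<lparr>carrier := B {0..}\<rparr>) (B {m..}))"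
  proof (rule U.simple_quotientI[OF lie_closed_b])
    show "lie_submodule (b_alg n) (NM\<lparr>carrier := B {0..}\<rparr>) (B {m..})"
      using NB.lie_submodule_restrict[OF sub0] subm le by blast
    show "B {m..} \<noteq> carrier (NM\<lparr>carrier := B {0..}\<rparr>)" using S0m S_in[of 0] by auto
    fix Z assume Z: "lie_submodule (b_alg n) (NM\<lparr>carrier := B {0..}\<rparr>) Z" "B {m..} \<subseteq> Z" "Z \<noteq> B {m..}"
    then have Z': "lie_submodule (b_alg n) NM Z" "Z \<subseteq> B {0..}"
      using NB.lie_submodule_restrict[OF sub0] by auto
    obtain z where z: "z \<in> Z" "z \<notin> B {m..}" using Z by auto
    obtain v A where v: "v \<in> Z" "v \<notin> B {m..}" "finite A" "\<And>k. k \<in> A \<Longrightarrow> k \<notin> {m..} \<and> of_nat k * (c + of_nat k) = 0"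
      "v - (\<Sum>k\<in>A. scale (cf v k {#}) (S k)) \<in> B {m..}"
      by (rule submodule_contains_singular[OF Z' z]) (use submodule_e[OF subm] in auto)
    have "A \<subseteq> {0}" using v(4) roots by fastforce
    then have "A = {} \<or> A = {0}" by blast
    moreover have "A \<noteq> {}" using v(2,5) by auto
    ultimately have "A = {0}" by blast
    then have vx: "v - scale (cf v 0 {#}) (S 0) \<in> B {m..}" using v(5) by simp
    then have nz: "cf v 0 {#} \<noteq> 0" using v(2) by auto
    note sp = submodule_subspace(1)[OF Z'(1)]
    have "v - (v - scale (cf v 0 {#}) (S 0)) \<in> Z" using vx v(1) Z(2) cvs.subspace_diff[OF sp] by blast
    then have "scale (1 / cf v 0 {#}) (v - (v - scale (cf v 0 {#}) (S 0))) \<in> Z"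
      by (rule cvs.subspace_scale[OF sp])
    then have "S 0 \<in> Z" using nz by simp
    then show "Z = carrier (NM\<lparr>carrier := B {0..}\<rparr>)" using B_in_submodule[OF Z'(1), of 0] Z'(2) by auto
  qed
  define W where "W i = (if i = 0 then {0} else if i = Suc 0 then B {m..} else B {0..})" for i :: nat
  have "lie_submodule (b_alg n) (NM\<lparr>carrier := B {0..}\<rparr>) (W i)" for i
    using NB.lie_submodule_restrict[OF sub0] subm sub0 le U.lie_submodule_zero by (auto simp: W_def)
  moreover have "W i \<subseteq> W (Suc i) \<and> simple_module (b_alg n)
      (quotient_module (NM\<lparr>carrier := B {0..}\<rparr>\<lparr>carrier := W (Suc i)\<rparr>) (W i))" if i2: "i < 2" for i
  proof -
    consider "i = 0" | "i = Suc 0" using i2 by linarith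
    then show ?thesis by cases (use bottom top le in \<open>auto simp: W_def intro: B_cl\<close>)
  qed
  ultimately show ?thesis unfolding has_length_def Ub_eq
    by (intro conjI U.lie_module_axioms exI[of _ W]) (auto simp: W_def)
qed

end

section \<open>The module generated over a\<close>

text \<open>
  The elements of \<open>a_alg n\<close>: the two by two matrices of trace zero, with each entry multiplied by the identity
  matrix of size \<open>n\<close>.
\<close>

definition blk :: "nat \<Rightarrow> complex \<Rightarrow> complex \<Rightarrow> complex \<Rightarrow> complex mat" where
  "blk n h y x = four_block_mat (h \<cdot>\<^sub>m 1\<^sub>m n) (y \<cdot>\<^sub>m 1\<^sub>m n) (x \<cdot>\<^sub>m 1\<^sub>m n) ((- h) \<cdot>\<^sub>m 1\<^sub>m n)"

lemma blk_carrier: "blk n h y x \<in> carrier_mat (2 * n) (2 * n)"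
  by (auto simp: blk_def)

lemma blk_linear: "blk n h y x + blk n h' y' x' = blk n (h + h') (y + y') (x + x')"
  "r \<cdot>\<^sub>m blk n h y x = blk n (r * h) (r * y) (r * x)"
  by (auto simp: blk_def algebra_simps intro!: eq_matI)

lemma blk_generators: "X_a n = blk n 0 0 1" "H_a n = blk n 1 0 0" "Y_a n = blk n 0 1 0"
  by (auto simp: blk_def X_a_def H_a_def Y_a_def intro!: eq_matI)

lemma a_alg_eq: "a_alg n = {blk n h y x | h y x. True}"
  unfolding a_alg_def blk_generators by (auto simp: blk_linear)

lemma blk_bracket:
  "lie_bracket (blk n h y x) (blk n h' y' x') = blk n (y * x' - y' * x) (2 * (h * y' - y * h')) (2 * (x * h' - h * x'))"
proof -
  have s: "(r \<cdot>\<^sub>m 1\<^sub>m n) * (s \<cdot>\<^sub>m 1\<^sub>m n) = (r * s) \<cdot>\<^sub>m (1\<^sub>m n :: complex mat)" for r s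
    by (simp add: mult_smult_distrib[of _ n n _ n]) (auto intro!: eq_matI)
  have a: "(r \<cdot>\<^sub>m 1\<^sub>m n) + (s \<cdot>\<^sub>m 1\<^sub>m n) = (r + s) \<cdot>\<^sub>m (1\<^sub>m n :: complex mat)" for r s
    by (auto simp: algebra_simps intro!: eq_matI)
  have p: "blk n h y x * blk n h' y' x' = four_block_mat ((h * h' + y * x') \<cdot>\<^sub>m 1\<^sub>m n) ((h * y' - y * h') \<cdot>\<^sub>m 1\<^sub>m n)
      ((x * h' - h * x') \<cdot>\<^sub>m 1\<^sub>m n) ((x * y' + h * h') \<cdot>\<^sub>m 1\<^sub>m n)" for h y x h' y' x'
    unfolding blk_def by (subst mult_four_block_mat[of _ n n _ n _ n _ _ n _ n]) (simp_all add: s a)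
  show ?thesis unfolding lie_bracket_def p unfolding blk_def
    by (auto simp: algebra_simps intro!: eq_matI)
qed

lemma lie_closed_a: "lie_closed (a_alg n)"
  unfolding lie_closed_def a_alg_eq by (auto simp: blk_linear blk_bracket) blast+

lemma a_alg_carrier: "a_alg n \<subseteq> carrier_mat (2 * n) (2 * n)"
  unfolding a_alg_eq using blk_carrier by auto

lemma in_a_alg: "X_a n \<in> a_alg n" "H_a n \<in> a_alg n" "Y_a n \<in> a_alg n"
  unfolding a_alg_eq blk_generators by auto

lemma bracket_a: "lie_bracket (Y_a n) (X_a n) = H_a n" "lie_bracket (H_a n) (X_a n) = (-2) \<cdot>\<^sub>m X_a n"
  unfolding blk_generators blk_bracket blk_linear by simp_all

lemma triangular_a: "triangular (a_alg n) {X_a n} {Y_a n} {(H_a n, \<mu>)} (H_a n)"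
proof -
  have "x \<cdot>\<^sub>m X_a n + h \<cdot>\<^sub>m H_a n + y \<cdot>\<^sub>m Y_a n \<in> mspan ({X_a n} \<union> {Y_a n} \<union> fst ` {(H_a n, \<mu>)})" for x h y
    by (rule mspan.add[OF mspan.add]; rule mspan.smult; rule mspan.base) auto
  then have "a_alg n \<subseteq> mspan ({X_a n} \<union> {Y_a n} \<union> fst ` {(H_a n, \<mu>)})"
    unfolding a_alg_def by blast
  moreover have "\<exists>d::nat. d > 0 \<and> lie_bracket (H_a n) (X_a n) = (- of_nat d) \<cdot>\<^sub>m X_a n"
    unfolding bracket_a by (intro exI[of _ 2]) simp
  ultimately show ?thesis
    unfolding triangular_def using lie_closed_a in_a_alg by (auto intro: mspan.base)
qed

context dual_pair
begin

sublocale NA: lie_module "a_alg n" NM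
  by (rule lie_module_N[OF a_alg_carrier])

abbreviation Xo where "Xo \<equiv> act NM (X_a n)"
abbreviation Yo where "Yo \<equiv> act NM (Y_a n)"
abbreviation Ho where "Ho \<equiv> act NM (H_a n)"

lemma act_linear: "act NM A (v + w) = act NM A v + act NM A w" "act NM A (scale r v) = scale r (act NM A v)"
  by (simp_all add: N_act eop_linear cvs.scale_right_distrib sum.distrib cvs.scale_sum_right mult.commute)

lemma act_0: "act NM A 0 = 0"
  using act_linear(2)[of A 0 0] by simp

lemma act_sum: "act NM A (sum h I) = (\<Sum>i\<in>I. act NM A (h i))"
  by (induction I rule: infinite_finite_induct) (simp_all add: act_linear act_0)

lemma act_blk: "act NM (blk n h y x) v = (\<Sum>i<n. scale h (eop n i i v - eop n (n + i) (n + i) v) +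
    scale y (eop n i (n + i) v) + scale x (eop n (n + i) i v))"
proof -
  have d: "(\<Sum>j<n. scale (if i = j then r else 0) (g j)) = scale r (g i)" if "i < n" for r i and g :: "nat \<Rightarrow> complex vec \<Rightarrow>\<^sub>0 complex"
  proof -
    have "(\<Sum>j<n. scale (if i = j then r else 0) (g j)) = (\<Sum>j<n. if j = i then scale r (g i) else 0)"
      by (rule sum.cong) auto
    then show ?thesis using that by simp
  qed
  have "act NM (blk n h y x) v = (\<Sum>i<n. (\<Sum>j<n. scale (if i = j then h else 0) (eop n i j v)) + (\<Sum>j<n. scale (if i = j then y else 0) (eop n i (n + j) v)))
    + (\<Sum>i<n. (\<Sum>j<n. scale (if i = j then x else 0) (eop n (n + i) j v)) + (\<Sum>j<n. scale (if i = j then - h else 0) (eop n (n + i) (n + j) v)))"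
    unfolding N_act sum_split_half blk_def
    by (intro arg_cong2[where f = "(+)"] sum.cong refl) auto
  also have "\<dots> = (\<Sum>i<n. scale h (eop n i i v) + scale y (eop n i (n + i) v)) + (\<Sum>i<n. scale x (eop n (n + i) i v) + scale (- h) (eop n (n + i) (n + i) v))"
    by (simp add: d del: cvs.scale_minus_left)
  finally show ?thesis by (simp add: cvs.scale_right_diff_distrib sum.distrib sum_subtractf sum_negf)
qed

text \<open>
  The tuple reached from \<open>x(b,0)\<close> by \<open>k\<close> applications of the first summand \<open>E_(n+1,1)\<close> of \<open>X\<close>.
\<close>

definition bk :: "nat \<Rightarrow> complex vec" where
  "bk k = vec (2 * n) (\<lambda>i. if i = 0 then -1 - of_nat k else if i < \<omega> then -1
     else if i = \<omega> then a1 + of_int b else if i = n then a2 - of_int b + of_nat k else 0)"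

text \<open>
  Only the first summand of \<open>X\<close> leads to one of the tuples \<open>bk k\<close>: any other summand would have to start with an
  entry \<open>-1\<close> at a position at which only non-negative entries are admissible.
\<close>

lemma lk_X:
  assumes v: "v \<in> N"
  shows "lk (Xo v) (bk k) = (case k of 0 \<Rightarrow> 0 | Suc k' \<Rightarrow> lk v (bk k'))"
proof -
  have vs: "v \<in> supp n" using v N_supp by blast
  have bk: "bk k \<in> carrier_vec (2 * n)" by (simp add: bk_def)
  have z: "lk (eop n (n + i) i v) (bk k) = 0" if i: "0 < i" "i < n" for i
  proof -
    have ni: "n + i \<noteq> \<omega>" "\<not> n + i < \<omega>" using \<omega>_bounds(1) by linarith+
    have "lk v (bk k - unit_vec (2 * n) (n + i) + unit_vec (2 * n) i) = 0"
      by (rule lk_nonadmissible[OF v, of "n + i"]) (use i ni in \<open>auto simp: bk_def\<close>)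
    then show ?thesis using lookup_eop[OF vs, of "n + i" i "bk k"] i bk by simp
  qed
  have "lk (Xo v) (bk k) = (\<Sum>i<n. lk (eop n (n + i) i v) (bk k))"
    unfolding blk_generators act_blk by (simp add: lookup_sum)
  also have "\<dots> = (\<Sum>i\<in>{0}. lk (eop n (n + i) i v) (bk k))"
    by (rule sum.mono_neutral_right) (use n2 z in auto)
  also have "\<dots> = qc (bk k $ n - 1) * pc (bk k $ 0 + 1) * lk v (bk k - unit_vec (2 * n) n + unit_vec (2 * n) 0)"
    using lookup_eop[OF vs, of n 0 "bk k"] bk n2 by simp
  also have "qc (bk k $ n - 1) = 1"
  proof -
    have no: "n \<noteq> \<omega>" "\<not> n < \<omega>" "n \<noteq> 0" using \<omega>_bounds(1) n2 by linarith+
    have "a2 - of_int b + of_nat k - 1 \<notin> \<int>"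
    proof
      assume "a2 - of_int b + of_nat k - 1 \<in> \<int>"
      then have "a2 - of_int b + of_nat k - 1 - of_nat k + 1 \<in> \<int>" by (intro Ints_add Ints_diff) auto
      then show False using nonint(3)[of b] by simp
    qed
    then have "qc (a2 - of_int b + of_nat k - 1) = 1" by (simp add: qc_def neg_integer_def)
    moreover have "bk k $ n = a2 - of_int b + of_nat k" using no n2 by (simp add: bk_def)
    ultimately show ?thesis by simp
  qed
  also have "pc (bk k $ 0 + 1) = (if k = 0 then 0 else 1)"
    using qc_pc_values(2)[of k] n2 by (simp add: bk_def)
  finally have eq: "lk (Xo v) (bk k) = (if k = 0 then 0 else 1) * lk v (bk k - unit_vec (2 * n) n + unit_vec (2 * n) 0)" by simp
  show ?thesis
  proof (cases k)
    case (Suc k')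
    have b: "0 < n" "n < 2 * n" "n \<noteq> 0" "n \<noteq> \<omega>" "\<not> n < \<omega>" using \<omega>_bounds(1) n2 by linarith+
    have "bk (Suc k') - unit_vec (2 * n) n + unit_vec (2 * n) 0 = bk k'"
      by (rule eq_vecI) (use b in \<open>auto simp: bk_def\<close>)
    then show ?thesis using eq Suc by simp
  qed (use eq in simp)
qed

lemma lk_x0_bk: "lk x0 (bk k) = (if k = 0 then 1 else 0)"
proof -
  have "tuple n (a1 + of_int b) (a2 - of_int b) = bk k \<longleftrightarrow> k = 0"
  proof
    assume "tuple n (a1 + of_int b) (a2 - of_int b) = bk k"
    then have "tuple n (a1 + of_int b) (a2 - of_int b) $ 0 = bk k $ 0" by simp
    then show "k = 0" using n2 by (simp add: tuple_def bk_def)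
  next
    assume "k = 0"
    then show "tuple n (a1 + of_int b) (a2 - of_int b) = bk k"
      using n2 by (auto simp: tuple_def bk_def \<omega>_def intro!: eq_vecI)
  qed
  then show ?thesis by (simp add: x_b0_def basis_elt_def lookup_single when_def)
qed

lemma lk_horner: "lk (horner NM (X_a n) x0 cs) (bk k) = (if k < length cs then cs ! k else 0)"
proof (induction cs arbitrary: k)
  case (Cons r cs)
  have "horner NM (X_a n) x0 cs \<in> N" by (rule NA.horner_closed[OF in_a_alg(1) x_N])
  then show ?case using Cons by (cases k) (auto simp: lookup_add lk_X lk_x0_bk)
qed simp

lemma Y_x0: "Yo x0 = 0"
proof -
  let ?t = "tuple n (a1 + of_int b) (a2 - of_int b)"
  have "eop n i (n + i) x0 = 0" if i: "i < n" for i
  proof -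
    have "pc (?t $ (n + i)) * qc (?t $ i) = 0"
    proof (cases "i = 0")
      case True
      then have "?t $ i = -1" using n2 by (simp add: tuple_def)
      then show ?thesis by (simp add: qc_def neg_integer_def)
    next
      case False
      then have "?t $ (n + i) = 0" using i by (auto simp: tuple_def)
      then show ?thesis by (simp add: pc_def neg_integer_def)
    qed
    then show ?thesis using i n2 by (simp add: x_b0_def eop_basis[OF _ _ tuple_carrier])
  qed
  then show ?thesis unfolding blk_generators act_blk by simp
qed

lemma H_x0: "Ho x0 = scale (c - 1) x0"
proof (rule supp_eqI[of _ n])
  let ?t = "tuple n (a1 + of_int b) (a2 - of_int b)"
  have xs: "x0 \<in> supp n" using x_N N_supp by blast
  show "Ho x0 \<in> supp n" "scale (c - 1) x0 \<in> supp n"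
    using N_act_closed[OF x_N] N_supp xs by (blast intro: supp_closed)+
  fix \<beta> :: "complex vec" assume \<beta>: "\<beta> \<in> carrier_vec (2 * n)"
  have "lk (Ho x0) \<beta> = (\<Sum>i<n. (\<beta> $ i - \<beta> $ (n + i)) * lk x0 \<beta>)"
    unfolding blk_generators act_blk using xs \<beta>
    by (simp add: lookup_sum lookup_minus lookup_eop_same left_diff_distrib)
  moreover have "(\<Sum>i<n. ?t $ i - ?t $ (n + i)) = c - 1"
  proof -
    have "(\<Sum>i<n. ?t $ i - ?t $ (n + i)) = (\<Sum>i<n. (if i = \<omega> then a1 + of_int b + 1 else 0) - 1 - (if i = 0 then a2 - of_int b else 0))"
    proof (rule sum.cong[OF refl])
      fix i assume "i \<in> {..<n}"
      then have "n + i \<noteq> n - 1" "n + i < 2 * n" "\<not> n + i < n - 1" "i < n - 1 \<or> i = n - 1" "n - 1 \<noteq> 0" using n2 by auto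
      then show "?t $ i - ?t $ (n + i) = (if i = \<omega> then a1 + of_int b + 1 else 0) - 1 - (if i = 0 then a2 - of_int b else 0)"
        by (auto simp: tuple_def \<omega>_def)
    qed
    also have "\<dots> = c - 1" by (simp add: sum.distrib sum_subtractf c_def)
    finally show ?thesis .
  qed
  moreover have "lk x0 \<beta> = 0" if "\<beta> \<noteq> ?t"
    using that by (auto simp: x_b0_def basis_elt_def lookup_single when_def)
  ultimately show "lk (Ho x0) \<beta> = lk (scale (c - 1) x0) \<beta>"
    by (cases "\<beta> = ?t") (simp_all flip: sum_distrib_right)
qed

lemma hw_a: "hw_vector NM {Y_a n} {(H_a n, c - 1)} x0"
  by (simp add: hw_vector_def Y_x0 H_x0)

theorem Ua_iso_verma: "lie_iso (a_alg n) (Ua_x n a1 a2 b) (V_a n (c - 1))"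
  unfolding Ua_x_def V_a_def
proof (rule cyclic_iso_verma_rank_one[OF triangular_a NA.lie_module_axioms hw_a])
  fix cs assume "horner NM (X_a n) x0 cs = \<zero>\<^bsub>NM\<^esub>"
  then have "(if k < length cs then cs ! k else 0) = 0" for k using lk_horner[of cs k] by simp
  then show "set cs \<subseteq> {0}" by (auto simp: in_set_conv_nth) metis
qed

definition u where "u k = (Xo ^^ k) x0"

lemma u_simps: "u 0 = x0" "u (Suc k) = Xo (u k)"
  by (simp_all add: u_def)

lemma u_N [simp]: "u k \<in> N"
  by (induction k) (simp_all add: u_simps N_act_closed)

lemma lk_u: "lk (u k) (bk j) = (if j = k then 1 else 0)"
  by (induction k arbitrary: j) (auto simp: u_simps lk_x0_bk lk_X split: nat.split)

lemma swap_X: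
  assumes "A \<in> a_alg n" "v \<in> N"
  shows "act NM A (Xo v) = act NM (lie_bracket A (X_a n)) v + Xo (act NM A v)"
  using NA.act_act_eq[OF assms(1) in_a_alg(1) assms(2)] by simp

lemma H_u: "Ho (u k) = scale (c - 1 - 2 * of_nat k) (u k)"
proof (induction k)
  case 0
  show ?case by (simp add: u_simps H_x0)
next
  case (Suc k)
  have "act NM ((-2) \<cdot>\<^sub>m X_a n) (u k) = scale (-2) (Xo (u k))"
    using NA.act_smult_left[OF in_a_alg(1) u_N, of "-2" k] by simp
  then have eq: "Ho (u (Suc k)) = scale (-2) (Xo (u k)) + scale (c - 1 - 2 * of_nat k) (Xo (u k))"
    unfolding u_simps using swap_X[OF in_a_alg(2) u_N, of k] Suc by (simp add: bracket_a act_linear)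
  show ?case unfolding eq cvs.scale_left_distrib[symmetric]
    by (rule arg_cong2[where f = scale]) (simp_all add: u_simps algebra_simps)
qed

lemma Y_u: "Yo (u k) = scale (of_nat k * (c - of_nat k)) (u (k - 1))"
proof (induction k)
  case 0
  show ?case by (simp add: u_simps Y_x0)
next
  case (Suc k)
  have "Yo (u (Suc k)) = scale (c - 1 - 2 * of_nat k) (u k) + scale (of_nat k * (c - of_nat k)) (Xo (u (k - 1)))"
    unfolding u_simps using swap_X[OF in_a_alg(3) u_N, of k] Suc by (simp add: bracket_a act_linear H_u)
  also have "scale (of_nat k * (c - of_nat k)) (Xo (u (k - 1))) = scale (of_nat k * (c - of_nat k)) (u k)"
    by (cases k) (simp_all add: u_simps)
  finally have eq: "Yo (u (Suc k)) = scale (c - 1 - 2 * of_nat k) (u k) + scale (of_nat k * (c - of_nat k)) (u k)" .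
  show ?case unfolding eq cvs.scale_left_distrib[symmetric]
    by (rule arg_cong2[where f = scale]) (simp_all add: algebra_simps)
qed

lemma horner_u: "horner NM (X_a n) x0 cs = (\<Sum>k<length cs. scale (cs ! k) (u k))"
proof (induction cs)
  case (Cons r cs)
  then show ?case
    by (simp add: act_sum act_linear u_simps sum.lessThan_Suc_shift del: sum.lessThan_Suc flip: u_simps(2))
qed simp

text \<open>
  The operator \<open>Y\<close> lowers the number of terms by one. If it kills the vector, then all coefficients but the first are
  zero, because the scalars \<open>k (c - k)\<close> do not vanish for positive \<open>k\<close> and the \<open>u k\<close> are independent.
\<close>

lemma x0_in_submodule:
  assumes W: "lie_submodule (a_alg n) NM W" and c: "\<And>k. k > 0 \<Longrightarrow> c \<noteq> of_nat k"
    and v: "v = (\<Sum>k<d. scale (r k) (u k))" "v \<in> W" "v \<noteq> 0"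
  shows "x0 \<in> W"
  using v
proof (induction d arbitrary: v r)
  case 0
  then show ?case by simp
next
  case (Suc d)
  define r' where "r' k = r (Suc k) * (of_nat (Suc k) * (c - of_nat (Suc k)))" for k
  have Yv: "Yo v = (\<Sum>k<d. scale (r' k) (u k))"
    unfolding Suc.prems(1) act_sum act_linear Y_u
    by (simp add: sum.lessThan_Suc_shift r'_def del: sum.lessThan_Suc of_nat_Suc)
  have "Yo v \<in> W" using W Suc.prems(2) in_a_alg(3) by (simp add: NA.lie_submodule_iff)
  show ?case
  proof (cases "Yo v = 0")
    case False
    then show ?thesis by (rule Suc.IH[OF Yv \<open>Yo v \<in> W\<close>])
  next
    case True
    have "r (Suc k) = 0" if "k < d" for k
    proof -
      have "0 = lk (Yo v) (bk k)" using True by simp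
      also have "\<dots> = (\<Sum>j<d. if j = k then r' k else 0)"
        unfolding Yv lookup_sum by (rule sum.cong) (auto simp: lk_u)
      finally have "r' k = 0" using that by simp
      then show ?thesis using c[of "Suc k"] by (simp add: r'_def del: of_nat_Suc)
    qed
    then have "v = scale (r 0) x0"
      unfolding Suc.prems(1) by (simp add: sum.lessThan_Suc_shift u_simps del: sum.lessThan_Suc)
    moreover then have "r 0 \<noteq> 0" using Suc.prems(3) by auto
    ultimately have "x0 = scale (1 / r 0) v" by simp
    then show ?thesis using W Suc.prems(2) by (simp add: NA.lie_submodule_iff)
  qed
qed

theorem Ua_simple:
  assumes c: "\<And>k::nat. k > 0 \<Longrightarrow> c \<noteq> of_nat k"
  shows "simple_module (a_alg n) (Ua_x n a1 a2 b)"
proof -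
  have eq: "Ua_x n a1 a2 b = NM\<lparr>carrier := NA.cyc x0\<rparr>"
    unfolding Ua_x_def by (rule NA.cyclic_module_eq[OF lie_closed_a]) simp
  have sub: "lie_submodule (a_alg n) NM (NA.cyc x0)" by (rule NA.lie_submodule_cyc) simp
  show ?thesis unfolding simple_module_def eq
  proof (intro conjI allI impI)
    show "lie_module (a_alg n) (NM\<lparr>carrier := NA.cyc x0\<rparr>)" by (rule NA.lie_module_restrict[OF sub])
    have "x0 \<in> NA.cyc x0" by (rule NA.generator_in_cyc) simp
    moreover have "x0 \<noteq> 0" using S_nz[of 0] by simp
    ultimately show "carrier (NM\<lparr>carrier := NA.cyc x0\<rparr>) \<noteq> {\<zero>\<^bsub>NM\<lparr>carrier := NA.cyc x0\<rparr>\<^esub>}" by auto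
    fix W assume "lie_submodule (a_alg n) (NM\<lparr>carrier := NA.cyc x0\<rparr>) W"
    then have W: "lie_submodule (a_alg n) NM W" "W \<subseteq> NA.cyc x0"
      using NA.lie_submodule_restrict[OF sub] by auto
    show "W = {\<zero>\<^bsub>NM\<lparr>carrier := NA.cyc x0\<rparr>\<^esub>} \<or> W = carrier (NM\<lparr>carrier := NA.cyc x0\<rparr>)"
    proof (cases "W \<subseteq> {0}")
      case True
      then show ?thesis using W(1) by (auto simp: NA.lie_submodule_iff)
    next
      case False
      then obtain v where v: "v \<in> W" "v \<noteq> 0" by auto
      then have "v \<in> lower_span NM {X_a n} x0"
        using W(2) NA.lower_span_eq_cyc[OF triangular_a hw_a] by auto
      then obtain cs where "v = horner NM (X_a n) x0 cs"
        using NA.lower_span_horner[OF in_a_alg(1) x_N] by blast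
      then have "v = (\<Sum>k<length cs. scale (cs ! k) (u k))" by (simp add: horner_u)
      then have "x0 \<in> W" using x0_in_submodule[OF W(1) c _ v] by blast
      then show ?thesis using NA.cyc_least[OF W(1)] W(2) by auto
    qed
  qed
qed

theorem Ua_iso_simple:
  assumes "\<And>k::nat. k > 0 \<Longrightarrow> c \<noteq> of_nat k"
  shows "lie_iso (a_alg n) (Ua_x n a1 a2 b) (L_a n (c - 1))"
  using simple_cyclic_iso_simple_hw[OF triangular_a NA.lie_module_axioms hw_a] Ua_simple[OF assms]
  unfolding Ua_x_def L_a_def by blast

end

section \<open>The modules generated by x(b,0)\<close>

theorem theorem3p7:
  fixes n :: nat and a1 a2 :: complex and b :: int
  assumes "n > 2" and "a1 \<notin> \<int>" and "a2 \<notin> \<int>" and "a1 - a2 \<in> \<int>"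
  shows "(a1 - a2 + 2 * of_int b - (of_nat n - 2) = 0 \<longrightarrow>
            simple_module (b_alg n) (Ub_x n a1 a2 b) \<and>
            lie_iso (b_alg n) (Ub_x n a1 a2 b)
              (L_b n ([a2 - of_int b] @ replicate (n - 3) 0 @ [-1 - a1 - of_int b])) \<and>
            lie_iso (a_alg n) (Ua_x n a1 a2 b) (L_a n (-1))) \<and>
         (Re (a1 - a2 + 2 * of_int b - (of_nat n - 2)) > 0 \<longrightarrow>
            simple_module (b_alg n) (Ub_x n a1 a2 b) \<and>
            lie_iso (b_alg n) (Ub_x n a1 a2 b)
              (L_b n ([a2 - of_int b] @ replicate (n - 3) 0 @ [-1 - a1 - of_int b])) \<and>
            lie_iso (a_alg n) (Ua_x n a1 a2 b)
              (V_a n (a1 - a2 + 2 * of_int b - (of_nat n - 1)))) \<and>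
         (Re (a1 - a2 + 2 * of_int b - (of_nat n - 2)) < 0 \<longrightarrow>
            indecomposable_module (b_alg n) (Ub_x n a1 a2 b) \<and>
            has_length (b_alg n) (Ub_x n a1 a2 b) 2 \<and>
            lie_iso (a_alg n) (Ua_x n a1 a2 b)
              (L_a n (a1 - a2 + 2 * of_int b - (of_nat n - 1))))"
proof -
  interpret dual_pair n a1 a2 b by unfold_locales (use assms in auto)
  have c: "a1 - a2 + 2 * of_int b - (of_nat n - 2) = c" "a1 - a2 + 2 * of_int b - (of_nat n - 1) = c - 1"
    by (simp_all add: c_def algebra_simps)
  have no_root: "c \<noteq> of_nat k" if "Re c \<le> 0" "k > 0" for k :: nat
    using that by auto
  show ?thesis unfolding c
  proof (intro conjI impI)
    assume c0: "c = 0"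
    show "simple_module (b_alg n) (Ub_x n a1 a2 b)"
      "lie_iso (b_alg n) (Ub_x n a1 a2 b) (L_b n ([a2 - of_int b] @ replicate (n - 3) 0 @ [-1 - a1 - of_int b]))"
      by (rule Ub_simple, simp add: c0) (rule Ub_iso, simp add: c0)
    have "c - 1 = -1" using c0 by simp
    then show "lie_iso (a_alg n) (Ua_x n a1 a2 b) (L_a n (-1))"
      using Ua_iso_simple[OF no_root] c0 by simp
  next
    assume "Re c > 0"
    then have c0: "Re c \<ge> 0" by simp
    show "simple_module (b_alg n) (Ub_x n a1 a2 b)"
      "lie_iso (b_alg n) (Ub_x n a1 a2 b) (L_b n ([a2 - of_int b] @ replicate (n - 3) 0 @ [-1 - a1 - of_int b]))"
      by (rule Ub_simple[OF c0]) (rule Ub_iso[OF c0])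
    show "lie_iso (a_alg n) (Ua_x n a1 a2 b) (V_a n (c - 1))" by (rule Ua_iso_verma)
  next
    assume neg: "Re c < 0"
    show "indecomposable_module (b_alg n) (Ub_x n a1 a2 b)" by (rule Ub_indecomposable)
    show "lie_iso (a_alg n) (Ua_x n a1 a2 b) (L_a n (c - 1))"
      using neg by (intro Ua_iso_simple no_root) auto
    have "c = (a1 - a2) + (2 * of_int b - (of_nat n - 2))" by (simp add: c_def)
    also have "\<dots> \<in> \<int>" by (rule Ints_add[OF assms(4)]) (intro Ints_diff Ints_mult, auto)
    finally have "c \<in> \<int>" .
    then obtain k :: int where k: "c = of_int k" by (elim Ints_cases)
    then have "k < 0" using neg by simp
    then have "c = - of_nat (nat (- k))" "nat (- k) > 0" using k by (simp_all add: of_nat_nat)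
    then show "has_length (b_alg n) (Ub_x n a1 a2 b) 2" by (rule Ub_length)
  qed
qed

end
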